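(* Let $\beta>0$, $p>2$ and $\omega\in\mathbb{R}$. Then there exists an action minimizer at frequency $\omega$ if and only if $\omega>0$. Moreover, for $\omega>0$, up to multiplication by a phase factor $e^{i\theta}$, $\theta\in\mathbb{R}$, and the transformation $u\mapsto u(-\,\cdot)$, the action minimizer at frequency $\omega$ is unique, positive and of the form $$u(x)=\begin{cases}\phi_\omega(x+x_+),& x>0,\\ \phi_\omega(x+x_-),& x<0,\end{cases}$$ with $x_+>x_->0$, where $t_\pm:=\tanh\left(\frac{p-2}{2}\sqrt{\omega}\,x_\pm\right)$ solve the system $$\begin{cases}t_+(1-t_+^2)^{\frac{1}{p-2}}=t_-(1-t_-^2)^{\frac{1}{p-2}},\\ t_+^{-1}-t_-^{-1}=-\beta\sqrt{\omega}.\end{cases}$$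
   Context: Functions are complex-valued. $\mathbb{R}^-=(-\infty,0)$, $\mathbb{R}^+=(0,+\infty)$; the space $H^1(\mathbb{R}^-)\oplus H^1(\mathbb{R}^+)$ consists of functions on $\mathbb{R}\setminus\{0\}$ whose restrictions to the two half-lines are in $H^1$, and $u(0^\pm)$ denote one-sided limits at $0$. For $\beta>0$, $\omega\in\mathbb{R}$ and $u\in H^1(\mathbb{R}^-)\oplus H^1(\mathbb{R}^+)$, set $$Q_\beta(u):=\|u'\|_{L^2(\mathbb{R}^-)}^2+\|u'\|_{L^2(\mathbb{R}^+)}^2+\frac1\beta|u(0^+)-u(0^-)|^2,$$ $$S_{\beta,\omega}(u):=\frac12Q_\beta(u)-\frac1p\|u\|_{L^p(\mathbb{R})}^p+\frac\omega2\|u\|_{L^2(\mathbb{R})}^2,\qquad I_{\beta,\omega}(u):=Q_\beta(u)+\omega\|u\|_{L^2(\mathbb{R})}^2-\|u\|_{L^p(\mathbb{R})}^p.$$ The Nehari manifold is $N_{\beta,\omega}:=\{u\in H^1(\mathbb{R}^-)\oplus H^1(\mathbb{R}^+)\setminus\{0\}: I_{\beta,\omega}(u)=0\}$, and $d_\beta(\omega):=\inf\{S_{\beta,\omega}(v): v\in N_{\beta,\omega}\}$. An action minimizer at frequency $\omega$ is a function $u\in N_{\beta,\omega}$ with $S_{\beta,\omega}(u)=d_\beta(\omega)$. The soliton at frequency $\omega>0$ is $$\phi_\omega(x):=\left(\frac{\omega p}{2\cosh^2\left(\frac{p-2}{2}\sqrt{\omega}\,x\right)}\right)^{\frac1{p-2}},\quad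 x\in\mathbb{R}.$$ *)

theory Defs
  imports "HOL-Analysis.Analysis"
begin

text \<open>
  Elements of Lebesgue and Sobolev spaces are represented by functions \<open>real \<Rightarrow> complex\<close>, and
  equality in these spaces is equality almost everywhere. Every equivalence class of Lebesgue
  measurable functions contains a Borel measurable one, so \<open>lborel\<close> is used throughout.
  The value at the origin is irrelevant.
\<close>

definition L2_on :: "real set \<Rightarrow> (real \<Rightarrow> complex) \<Rightarrow> bool" where
  "L2_on A f \<longleftrightarrow>
     set_borel_measurable lborel A f \<and> set_integrable lborel A (\<lambda>x. (norm (f x))\<^sup>2)"

text \<open>
  The test functions are real-valued; testing against complex-valued ones is equivalent by linearity.
\<close>

definition test_function :: "real set \<Rightarrow> (real \<Rightarrow> real) \<Rightarrow> bool" where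
  "test_function A \<psi> \<longleftrightarrow>
     (\<forall>n x. (deriv ^^ n) \<psi> differentiable at x) \<and>
     (\<exists>K. compact K \<and> K \<subseteq> A \<and> (\<forall>x. x \<notin> K \<longrightarrow> \<psi> x = 0))"

definition is_weak_deriv :: "real set \<Rightarrow> (real \<Rightarrow> complex) \<Rightarrow> (real \<Rightarrow> complex) \<Rightarrow> bool" where
  "is_weak_deriv A u g \<longleftrightarrow>
     (\<forall>\<psi>. test_function A \<psi> \<longrightarrow>
        (LINT x:A|lborel. deriv \<psi> x *\<^sub>R u x) = - (LINT x:A|lborel. \<psi> x *\<^sub>R g x))"

definition H1_on :: "real set \<Rightarrow> (real \<Rightarrow> complex) \<Rightarrow> bool" where
  "H1_on A u \<longleftrightarrow> L2_on A u \<and> (\<exists>g. L2_on A g \<and> is_weak_deriv A u g)"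

text \<open>The choice is unique up to a null set when \<open>A\<close> is open and \<open>H1_on A u\<close>.\<close>

definition weak_deriv :: "real set \<Rightarrow> (real \<Rightarrow> complex) \<Rightarrow> real \<Rightarrow> complex" where
  "weak_deriv A u = (SOME g. L2_on A g \<and> is_weak_deriv A u g)"

definition H1_split :: "(real \<Rightarrow> complex) set" where
  "H1_split = {u. H1_on {..<0} u \<and> H1_on {0<..} u}"

text \<open>
  The one-sided limit at the origin, taken along the continuous representative of \<open>u\<close> on \<open>A\<close>:
  \<open>u(0\<^sup>+)\<close> is \<open>trace0 {0<..} u\<close> and \<open>u(0\<^sup>-)\<close> is \<open>trace0 {..<0} u\<close>.
\<close>

definition trace0 :: "real set \<Rightarrow> (real \<Rightarrow> complex) \<Rightarrow> complex" where
  "trace0 A u = (THE l. \<exists>v. continuous_on A v \<and> (AE x in lborel. x \<in> A \<longrightarrow> v x = u x) \<and>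
                            (v \<longlongrightarrow> l) (at 0 within A))"

definition Qf :: "real \<Rightarrow> (real \<Rightarrow> complex) \<Rightarrow> real" where
  "Qf \<beta> u =
     (LINT x:{..<0}|lborel. (norm (weak_deriv {..<0} u x))\<^sup>2)
     + (LINT x:{0<..}|lborel. (norm (weak_deriv {0<..} u x))\<^sup>2)
     + 1 / \<beta> * (norm (trace0 {0<..} u - trace0 {..<0} u))\<^sup>2"

text \<open>
  For \<open>u \<in> H1_split\<close> and \<open>p \<ge> 2\<close> the function \<open>\<bar>u\<bar>\<^sup>p\<close> is integrable, since \<open>u\<close> is
  essentially bounded and square integrable; so the integrals below are the powers of the norms.
\<close>

definition norm_Lp_pow :: "real \<Rightarrow> (real \<Rightarrow> complex) \<Rightarrow> real" where
  "norm_Lp_pow p u = (LINT x|lborel. norm (u x) powr p)"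

definition action :: "real \<Rightarrow> real \<Rightarrow> real \<Rightarrow> (real \<Rightarrow> complex) \<Rightarrow> real" where
  "action \<beta> p \<omega> u =
     1 / 2 * Qf \<beta> u - 1 / p * norm_Lp_pow p u + \<omega> / 2 * norm_Lp_pow 2 u"

definition nehari_functional :: "real \<Rightarrow> real \<Rightarrow> real \<Rightarrow> (real \<Rightarrow> complex) \<Rightarrow> real" where
  "nehari_functional \<beta> p \<omega> u = Qf \<beta> u + \<omega> * norm_Lp_pow 2 u - norm_Lp_pow p u"

definition nehari_manifold :: "real \<Rightarrow> real \<Rightarrow> real \<Rightarrow> (real \<Rightarrow> complex) set" where
  "nehari_manifold \<beta> p \<omega> =
     {u \<in> H1_split. \<not> (AE x in lborel. u x = 0) \<and> nehari_functional \<beta> p \<omega> u = 0}"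

text \<open>
  For \<open>\<beta> > 0\<close> and \<open>p > 2\<close> the infimum is over a nonempty set of reals that is bounded below: on
  the Nehari manifold the action equals \<open>(1/2 - 1/p) * norm_Lp_pow p u\<close>, which is nonnegative.
\<close>

definition action_level :: "real \<Rightarrow> real \<Rightarrow> real \<Rightarrow> real" where
  "action_level \<beta> p \<omega> = (INF v\<in>nehari_manifold \<beta> p \<omega>. action \<beta> p \<omega> v)"

definition action_minimizer :: "real \<Rightarrow> real \<Rightarrow> real \<Rightarrow> (real \<Rightarrow> complex) \<Rightarrow> bool" where
  "action_minimizer \<beta> p \<omega> u \<longleftrightarrow>
     u \<in> nehari_manifold \<beta> p \<omega> \<and> action \<beta> p \<omega> u = action_level \<beta> p \<omega>"

definition soliton :: "real \<Rightarrow> real \<Rightarrow> real \<Rightarrow> real" where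
  "soliton p \<omega> x =
     (\<omega> * p / (2 * (cosh ((p - 2) / 2 * sqrt \<omega> * x))\<^sup>2)) powr (1 / (p - 2))"

end

theory Submission
  imports Defs
begin

text \<open>
  Why the theorem holds. On the Nehari manifold the action of \<open>u\<close> is \<open>(1/2 - 1/p) * P\<close>, where \<open>P\<close> is the
  \<open>p\<close>-th power of the \<open>L\<^sup>p\<close> norm, and it is the maximum over \<open>t > 0\<close> of the action of \<open>t u\<close>, attained only
  at \<open>t = 1\<close>. Hence every amplitude \<open>t\<close> yields a lower bound for the action of \<open>u\<close>. The useful one is the
  \<open>t\<close> for which the supremum of \<open>\<bar>t u\<bar>\<close> is the height \<open>M\<close> of the soliton, given by \<open>M powr (p - 2) = \<omega> p / 2\<close>.
  On \<open>[0, M]\<close> the potential \<open>\<omega> s\<^sup>2 / 2 - s powr p / p\<close> is one half of the square of a nonnegative function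
  \<open>f\<close> (below: \<open>slope\<close>), so the action density of a function with \<open>\<bar>u\<bar> \<le> M\<close> is
  \<open>(\<bar>u'\<bar>\<^sup>2 + (f \<bar>u\<bar>)\<^sup>2) / 2 = f \<bar>u\<bar> \<bar>u'\<bar> + (\<bar>u'\<bar> - f \<bar>u\<bar>)\<^sup>2 / 2\<close>, and the integral of \<open>f \<bar>u\<bar> \<bar>u'\<bar>\<close> is at least
  the variation of \<open>F \<bar>u\<bar>\<close>, for the antiderivative \<open>F\<close> of \<open>f\<close> with \<open>F 0 = 0\<close> (below: \<open>cost\<close>).
  If the height \<open>M\<close> is reached on the side where the modulus of the trace at the origin is \<open>a\<close>, and the
  modulus of the other trace is \<open>b\<close>, then the action is at least
  \<open>G a b = 2 * F M - F a + F b + (a - b)\<^sup>2 / (2 * \<beta>)\<close> (below: \<open>jump_cost\<close>).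
  
  What remains is to minimize \<open>G\<close> on the square \<open>[0, M]\<^sup>2\<close>. A minimum exists by compactness of the square,
  the signs of the partial derivatives on the boundary place it in the interior with \<open>b < a\<close>, and there
  \<open>f a = f b = (a - b) / \<beta>\<close>. As \<open>f\<close> first increases and then decreases, this system has only one solution
  with \<open>b < a\<close>. The soliton \<open>\<phi>\<close> satisfies \<open>\<bar>\<phi>'\<bar> = f \<phi>\<close>, and it runs through \<open>a\<close> and \<open>b\<close> at points
  \<open>0 < x\<^sub>m < x\<^sub>p\<close>. In terms of the hyperbolic tangents at these points the system is the one in the theorem.
  The function made of the two pieces of \<open>\<phi>\<close> loses nothing in the estimates above, so its action is the
  minimum of \<open>G\<close>, and it lies on the Nehari manifold by integration of
  \<open>(\<phi> \<phi>')' = \<phi>'\<^sup>2 + \<omega> \<phi>\<^sup>2 - \<phi> powr p\<close>. This is the existence part (\<open>nehari_action_ge_stitched\<close>,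
  \<open>stitched_nehari_action\<close>).
  
  For a second minimizer \<open>v\<close> all these inequalities are equalities (\<open>sharp_lower_bound\<close>): \<open>t = 1\<close>, the moduli
  of the traces are \<open>a\<close> and \<open>b\<close>, the jump has modulus \<open>a - b\<close>, and \<open>\<bar>v'\<bar> = f \<bar>v\<bar>\<close> almost everywhere.
  The last property says that \<open>\<bar>v\<bar>\<close> cannot descend faster than the soliton, so \<open>\<bar>v\<bar>\<close> lies above a translate of
  \<open>\<phi>\<close> on each side. Both minimizers have the same \<open>L\<^sup>p\<close> norm, and therefore \<open>\<bar>v\<bar>\<close> is that translate. This
  step also excludes a plateau of height \<open>M\<close>, on which \<open>\<bar>v'\<bar> = f \<bar>v\<bar>\<close> holds as well. Finally the modulus of
  \<open>v\<close> varies as much as \<open>v\<close> itself, so the phase is constant on each side, and the size of the jump makes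
  the two phases equal (\<open>equality_case\<close>).
  
  For \<open>\<omega> \<le> 0\<close> the multiples of \<open>exp (- l * \<bar>x\<bar>)\<close> on the Nehari manifold have arbitrarily small action as
  \<open>l\<^sup>2\<close> decreases to \<open>- \<omega>\<close>, whereas every action on the manifold is positive.
  
  The first half of the text replaces weak derivatives and traces by continuous representatives that are
  indefinite integrals (\<open>H1_rep\<close>). The left half-line is treated as the reflection of the right one.
\<close>

abbreviation half_line_integral :: "(real \<Rightarrow> 'a::{banach, second_countable_topology}) \<Rightarrow> 'a"
  (binder \<open>HINT \<close> 10) where
  "half_line_integral f \<equiv> set_lebesgue_integral lborel {0<..} f"

section \<open>Set integrals over intervals\<close>

lemma set_integral_mono_set:
  fixes f :: "'a \<Rightarrow> real"
  assumes "set_integrable M A f" "B \<in> sets M" "B \<subseteq> A" "\<And>x. x \<in> A \<Longrightarrow> 0 \<le> f x"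
  shows "(LINT x:B|M. f x) \<le> (LINT x:A|M. f x)"
  unfolding set_lebesgue_integral_def
proof (rule integral_mono)
  show "integrable M (\<lambda>x. indicator B x *\<^sub>R f x)" "integrable M (\<lambda>x. indicator A x *\<^sub>R f x)"
    using assms(1) set_integrable_subset[OF assms(1-3)] by (simp_all add: set_integrable_def)
qed (use assms in \<open>auto split: split_indicator\<close>)

lemma set_integrable_Icc_iff_Ioc:
  fixes f :: "real \<Rightarrow> 'a :: {banach, second_countable_topology}"
  shows "set_integrable lborel {a..b} f \<longleftrightarrow> set_integrable lborel {a<..b} f"
  by (rule set_integrable_discrete_difference[where X = "{a}"]) auto

lemma set_integral_Icc_eq_Ioc:
  fixes f :: "real \<Rightarrow> 'a :: {banach, second_countable_topology}"
  shows "(LINT x:{a..b}|lborel. f x) = (LINT x:{a<..b}|lborel. f x)"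
  by (rule set_integral_discrete_difference[where X = "{a}"]) auto

lemma set_integral_Icc_combine:
  fixes f :: "real \<Rightarrow> 'a :: {banach, second_countable_topology}"
  assumes "set_integrable lborel {a..c} f" "a \<le> b" "b \<le> c"
  shows "(LINT x:{a..c}|lborel. f x) = (LINT x:{a..b}|lborel. f x) + (LINT x:{b..c}|lborel. f x)"
proof -
  have i: "set_integrable lborel {a<..c} f" using assms(1) by (simp add: set_integrable_Icc_iff_Ioc)
  have "(LINT x:{a<..b} \<union> {b<..c}|lborel. f x) = (LINT x:{a<..b}|lborel. f x) + (LINT x:{b<..c}|lborel. f x)"
    by (rule set_integral_Un) (use assms in \<open>auto intro!: set_integrable_subset[OF i]\<close>)
  moreover have "{a<..b} \<union> {b<..c} = {a<..c}" using assms by auto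
  ultimately show ?thesis by (simp add: set_integral_Icc_eq_Ioc)
qed

lemma continuous_on_imp_set_measurable:
  fixes r :: "real \<Rightarrow> 'a :: real_normed_vector"
  assumes "continuous_on {0..} r" shows "set_borel_measurable lborel {0<..} r"
  unfolding set_borel_measurable_def
  using borel_measurable_continuous_on_indicator[OF _ continuous_on_subset[OF assms, of "{0<..}"]]
  by (simp add: subset_eq)

section \<open>Smooth test functions\<close>

text \<open>
  The flat function \<open>exp (- 1 / y)\<close> times powers of \<open>1 / y\<close>, extended by zero. Derivatives are combinations of
  functions of the same family, which is why all powers are included.
\<close>

definition flat_exp :: "nat \<Rightarrow> real \<Rightarrow> real" where
  "flat_exp k y = (if y \<le> 0 then 0 else inverse y ^ k * exp (- inverse y))"

lemma flat_exp_over_linear_tendsto_0: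
  "((\<lambda>h. flat_exp k h / h) \<longlongrightarrow> 0) (at 0)"
proof -
  have "((\<lambda>z::real. z ^ Suc k / exp z) \<longlongrightarrow> 0) at_top"
    by (rule tendsto_power_div_exp_0)
  hence "((\<lambda>h. inverse h ^ Suc k / exp (inverse h)) \<longlongrightarrow> (0::real)) (at_right 0)"
    by (rule filterlim_compose) (rule filterlim_inverse_at_top_right)
  moreover have "eventually (\<lambda>h::real. inverse h ^ Suc k / exp (inverse h) = flat_exp k h / h) (at_right 0)"
    unfolding eventually_at_right_field
    by (intro exI[of _ 1]) (auto simp: flat_exp_def exp_minus field_simps)
  ultimately have r: "((\<lambda>h. flat_exp k h / h) \<longlongrightarrow> 0) (at_right 0)"
    by (rule Lim_transform_eventually)
  (* To the left of 0 the function vanishes, so only the limit from the right has content. *)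
  have "eventually (\<lambda>h::real. 0 = flat_exp k h / h) (at_left 0)"
    unfolding eventually_at_left_field
    by (intro exI[of _ "-1"]) (auto simp: flat_exp_def)
  hence "((\<lambda>h. flat_exp k h / h) \<longlongrightarrow> 0) (at_left 0)"
    by (rule Lim_transform_eventually[rotated]) simp
  with r show ?thesis
    by (simp add: filterlim_split_at)
qed

lemma flat_exp_has_derivative:
  "(flat_exp k has_real_derivative flat_exp (k + 2) y - real k * flat_exp (Suc k) y) (at y)"
proof -
  consider "y < 0" | "y = 0" | "y > 0" by linarith
  thus ?thesis
  proof cases
    case 1
    have "((\<lambda>_. 0) has_real_derivative 0) (at y)" by simp
    moreover have "eventually (\<lambda>x. x \<in> {..<0}) (nhds y)"
      using 1 by (intro eventually_nhds_in_open) auto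
    hence "eventually (\<lambda>x. flat_exp k x = 0) (nhds y)"
      by eventually_elim (auto simp: flat_exp_def)
    ultimately have "(flat_exp k has_real_derivative 0) (at y)"
      by (subst DERIV_cong_ev[OF refl _ refl]) auto
    thus ?thesis using 1 by (simp add: flat_exp_def)
  next
    case 2
    have "(flat_exp k has_real_derivative 0) (at 0)"
      unfolding DERIV_def using flat_exp_over_linear_tendsto_0[of k]
      by (simp add: flat_exp_def)
    thus ?thesis using 2 by (simp add: flat_exp_def)
  next
    case 3
    have "((\<lambda>x. inverse x ^ k * exp (- inverse x)) has_real_derivative
            flat_exp (k + 2) y - real k * flat_exp (Suc k) y) (at y)"
      using 3 apply (auto intro!: derivative_eq_intros simp: flat_exp_def)
      by (cases k) (auto simp: field_simps power2_eq_square)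
    moreover have "eventually (\<lambda>x. x \<in> {0<..}) (nhds y)"
      using 3 by (intro eventually_nhds_in_open) auto
    hence "eventually (\<lambda>x. flat_exp k x = inverse x ^ k * exp (- inverse x)) (nhds y)"
      by eventually_elim (auto simp: flat_exp_def)
    ultimately show ?thesis
      by (subst DERIV_cong_ev[OF refl _ refl])
  qed
qed

lemma flat_exp_nonneg: "0 \<le> flat_exp k y"
  by (simp add: flat_exp_def)

lemma flat_exp_0_le_1: "flat_exp 0 y \<le> 1"
  by (simp add: flat_exp_def)

lemma flat_exp_0_tendsto:
  assumes "0 < a"
  shows "(\<lambda>n. flat_exp 0 (real n * a)) \<longlonglongrightarrow> 1"
proof -
  have "filterlim (\<lambda>n. real n * a) at_top sequentially"
    using filterlim_tendsto_pos_mult_at_top[OF tendsto_const assms filterlim_real_sequentially]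
    by (simp add: mult.commute)
  hence "(\<lambda>n. exp (- inverse (real n * a))) \<longlonglongrightarrow> exp (- 0)"
    by (intro tendsto_intros tendsto_inverse_0_at_top)
  moreover have "eventually (\<lambda>n. exp (- inverse (real n * a)) = flat_exp 0 (real n * a)) sequentially"
    using eventually_gt_at_top[of 0] by eventually_elim (use assms in \<open>auto simp: flat_exp_def mult_le_0_iff\<close>)
  ultimately show ?thesis using Lim_transform_eventually by fastforce
qed

text \<open>
  An algebra of functions that contains the derivatives of its elements; all of them are therefore smooth.
\<close>

inductive_set flat_exp_algebra :: "(real \<Rightarrow> real) set" where
  const: "(\<lambda>_. c) \<in> flat_exp_algebra"
| base: "(\<lambda>x. flat_exp k (a * x + b)) \<in> flat_exp_algebra"
| add: "f \<in> flat_exp_algebra \<Longrightarrow> g \<in> flat_exp_algebra \<Longrightarrow> (\<lambda>x. f x + g x) \<in> flat_exp_algebra"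
| mult: "f \<in> flat_exp_algebra \<Longrightarrow> g \<in> flat_exp_algebra \<Longrightarrow> (\<lambda>x. f x * g x) \<in> flat_exp_algebra"

lemma flat_exp_algebra_has_derivative:
  assumes "f \<in> flat_exp_algebra"
  shows "\<exists>g\<in>flat_exp_algebra. \<forall>x. (f has_real_derivative g x) (at x)"
  using assms
proof induction
  case (const c)
  show ?case by (intro bexI[of _ "\<lambda>_. 0"] flat_exp_algebra.const) auto
next
  case (base k a b)
  define g where "g = (\<lambda>x. a * (flat_exp (k + 2) (a * x + b) + (- real k) * flat_exp (Suc k) (a * x + b)))"
  have "g \<in> flat_exp_algebra"
    unfolding g_def by (intro flat_exp_algebra.intros)
  moreover have "((\<lambda>x. flat_exp k (a * x + b)) has_real_derivative g x) (at x)" for x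
    unfolding g_def by (rule DERIV_cong[OF DERIV_chain2[where f = "flat_exp k" and g = "\<lambda>x. a * x + b",
              OF flat_exp_has_derivative, of a]])
       (auto intro!: derivative_eq_intros)
  ultimately show ?case by blast
next
  case (add f g)
  then obtain f' g' where "f' \<in> flat_exp_algebra" "g' \<in> flat_exp_algebra"
    "\<And>x. (f has_real_derivative f' x) (at x)" "\<And>x. (g has_real_derivative g' x) (at x)" by blast
  thus ?case by (intro bexI[of _ "\<lambda>x. f' x + g' x"] flat_exp_algebra.add allI DERIV_add)
next
  case (mult f g)
  then obtain f' g' where "f' \<in> flat_exp_algebra" "g' \<in> flat_exp_algebra"
    "\<And>x. (f has_real_derivative f' x) (at x)" "\<And>x. (g has_real_derivative g' x) (at x)" by blast
  thus ?case using mult.hyps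
    by (intro bexI[of _ "\<lambda>x. f' x * g x + g' x * f x"] flat_exp_algebra.add allI DERIV_mult flat_exp_algebra.mult)
qed

definition smooth :: "(real \<Rightarrow> real) \<Rightarrow> bool" where
  "smooth f \<longleftrightarrow> (\<forall>n x. (deriv ^^ n) f differentiable at x)"

lemma flat_exp_algebra_smooth:
  assumes "f \<in> flat_exp_algebra"
  shows "smooth f"
proof -
  have "(deriv ^^ n) f \<in> flat_exp_algebra" for n
  proof (induction n)
    case (Suc n)
    then obtain g where g: "g \<in> flat_exp_algebra" "\<And>x. ((deriv ^^ n) f has_real_derivative g x) (at x)"
      using flat_exp_algebra_has_derivative by blast
    have "(deriv ^^ Suc n) f = g"
      using g(2) by (auto simp: fun_eq_iff DERIV_imp_deriv)
    thus ?case using g(1) by simp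
  qed (use assms in simp)
  thus ?thesis unfolding smooth_def
    using flat_exp_algebra_has_derivative real_differentiable_def by blast
qed

lemma smooth_has_derivative: "smooth f \<Longrightarrow> (f has_real_derivative deriv f x) (at x)"
  unfolding smooth_def by (metis DERIV_deriv_iff_real_differentiable funpow_0)

lemma smooth_deriv: "smooth f \<Longrightarrow> smooth (deriv f)"
  unfolding smooth_def by (metis funpow_swap1 comp_apply funpow.simps(2))

lemma smooth_antiderivative:
  assumes "smooth f" "\<And>x. (F has_real_derivative f x) (at x)"
  shows "smooth F"
proof -
  have dF: "deriv F = f" using assms(2) by (auto simp: fun_eq_iff DERIV_imp_deriv)
  have "(deriv ^^ n) F differentiable at x" for n x
  proof (cases n)
    case 0
    thus ?thesis using assms(2) real_differentiable_def by auto
  next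
    case (Suc m)
    hence "(deriv ^^ n) F = (deriv ^^ m) f" using dF by (simp add: funpow_swap1)
    thus ?thesis using assms(1) by (simp add: smooth_def)
  qed
  thus ?thesis by (simp add: smooth_def)
qed

lemma smooth_linear_combination:
  assumes "smooth f" "smooth g"
  shows "smooth (\<lambda>x. f x + c * g x)"
proof -
  have "(deriv ^^ n) (\<lambda>x. f x + c * g x) = (\<lambda>x. (deriv ^^ n) f x + c * (deriv ^^ n) g x)" for n
  proof (induction n)
    case (Suc n)
    have "((\<lambda>x. (deriv ^^ n) f x + c * (deriv ^^ n) g x) has_real_derivative
            deriv ((deriv ^^ n) f) x + c * deriv ((deriv ^^ n) g) x) (at x)" for x
      using assms unfolding smooth_def
      by (intro DERIV_add DERIV_cmult) (auto simp: DERIV_deriv_iff_real_differentiable)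
    thus ?case by (simp add: Suc fun_eq_iff DERIV_imp_deriv)
  qed simp
  thus ?thesis using assms by (simp add: smooth_def)
qed

lemma smooth_reflect:
  assumes "smooth f"
  shows "smooth (\<lambda>x. f (- x))"
proof -
  have D: "((\<lambda>x. (- 1) ^ n * (deriv ^^ n) f (- x)) has_real_derivative
           (- 1) ^ Suc n * deriv ((deriv ^^ n) f) (- x)) (at x)" for x n
  proof -
    have "((deriv ^^ n) f has_real_derivative deriv ((deriv ^^ n) f) (- x)) (at (- x))"
      using assms by (auto simp: smooth_def DERIV_deriv_iff_real_differentiable)
    hence "((\<lambda>x. (deriv ^^ n) f (- x)) has_real_derivative deriv ((deriv ^^ n) f) (- x) * - 1) (at x)"
      by (rule DERIV_chain2[where g = uminus]) (auto intro!: derivative_eq_intros)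
    from DERIV_cmult[OF this, of "(-1) ^ n"] show ?thesis
      by (simp add: mult_ac)
  qed
  have "(deriv ^^ n) (\<lambda>x. f (- x)) = (\<lambda>x. (- 1) ^ n * (deriv ^^ n) f (- x))" for n
  proof (induction n)
    case (Suc n)
    have "deriv (\<lambda>x. (- 1) ^ n * (deriv ^^ n) f (- x)) x = (- 1) ^ Suc n * (deriv ^^ Suc n) f (- x)" for x
      using DERIV_imp_deriv[OF D] by simp
    hence "deriv ((deriv ^^ n) (\<lambda>x. f (- x))) = (\<lambda>x. (- 1) ^ Suc n * (deriv ^^ Suc n) f (- x))"
      unfolding Suc by (rule ext)
    thus ?case by simp
  qed simp
  thus ?thesis unfolding smooth_def using D real_differentiable_def by metis
qed

lemma smooth_isCont: "smooth f \<Longrightarrow> isCont f x"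
  using smooth_has_derivative DERIV_isCont by blast

lemma test_function_iff_halfline:
  "test_function {0<..} \<psi> \<longleftrightarrow> smooth \<psi> \<and> (\<exists>a b. 0 < a \<and> a < b \<and> (\<forall>x. x \<notin> {a..b} \<longrightarrow> \<psi> x = 0))"
proof
  assume t: "test_function {0<..} \<psi>"
  then obtain K where K: "compact K" "K \<subseteq> {0<..}" "\<forall>x. x \<notin> K \<longrightarrow> \<psi> x = 0"
    unfolding test_function_def by blast
  show "smooth \<psi> \<and> (\<exists>a b. 0 < a \<and> a < b \<and> (\<forall>x. x \<notin> {a..b} \<longrightarrow> \<psi> x = 0))"
  proof (cases "K = {}")
    case True
    have "smooth \<psi>" using t unfolding test_function_def smooth_def by blast
    moreover have "\<forall>x. x \<notin> {1..2} \<longrightarrow> \<psi> x = 0" using True K by simp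
    moreover have "(0::real) < 1" "(1::real) < 2" by simp_all
    ultimately show ?thesis by blast
  next
    case False
    obtain a where a: "a \<in> K" "\<forall>x\<in>K. a \<le> x" using compact_attains_inf[OF K(1) False] by blast
    obtain b where b: "b \<in> K" "\<forall>x\<in>K. x \<le> b" using compact_attains_sup[OF K(1) False] by blast
    have "a \<le> b" using a(2) b(1) by blast
    hence "0 < a" "a < b + 1" using a(1) K(2) by auto
    moreover have "\<psi> x = 0" if "x \<notin> {a..b+1}" for x
    proof -
      have "x \<notin> K"
      proof
        assume "x \<in> K"
        hence "a \<le> x" "x \<le> b" using a b by auto
        thus False using that by auto
      qed
      thus ?thesis using K(3) by blast
    qed
    ultimately show ?thesis using t unfolding test_function_def smooth_def by blast
  qed
next
  assume "smooth \<psi> \<and> (\<exists>a b. 0 < a \<and> a < b \<and> (\<forall>x. x \<notin> {a..b} \<longrightarrow> \<psi> x = 0))"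
  then obtain a b where "smooth \<psi>" "0 < a" "a < b" "\<forall>x. x \<notin> {a..b} \<longrightarrow> \<psi> x = 0" by blast
  thus "test_function {0<..} \<psi>"
    unfolding test_function_def smooth_def by (auto intro!: exI[of _ "{a..b}"])
qed

text \<open>
  Products of two flat functions, one opening at \<open>s\<close> and one closing at \<open>t\<close>. They increase to the indicator
  function of the open interval as \<open>n\<close> grows.
\<close>

definition bump :: "real \<Rightarrow> real \<Rightarrow> nat \<Rightarrow> real \<Rightarrow> real" where
  "bump s t n x = flat_exp 0 (real n * x + - real n * s) * flat_exp 0 (- real n * x + real n * t)"

lemma bump_smooth: "smooth (bump s t n)"
  unfolding bump_def by (intro flat_exp_algebra_smooth flat_exp_algebra.intros)

lemma bump_eq_0: "x \<notin> {s<..<t} \<Longrightarrow> bump s t n x = 0"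
proof -
  assume "x \<notin> {s<..<t}"
  hence "real n * x + - real n * s \<le> 0 \<or> - real n * x + real n * t \<le> 0"
    by (auto simp: mult_left_mono not_less)
  thus ?thesis by (auto simp: bump_def flat_exp_def)
qed

lemma bump_test_function: "0 < s \<Longrightarrow> s < t \<Longrightarrow> test_function {0<..} (bump s t n)"
  unfolding test_function_iff_halfline using bump_smooth bump_eq_0
  by (metis atLeastAtMost_iff greaterThanLessThan_iff less_imp_le)

lemma bump_bounds: "0 \<le> bump s t n x" "bump s t n x \<le> 1"
  unfolding bump_def using flat_exp_nonneg flat_exp_0_le_1 by (auto intro: mult_le_one)

lemma bump_tendsto: "(\<lambda>n. bump s t n x) \<longlonglongrightarrow> indicator {s<..<t} x"
proof (cases "x \<in> {s<..<t}")
  case True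
  have "(\<lambda>n. flat_exp 0 (real n * (x - s)) * flat_exp 0 (real n * (t - x))) \<longlonglongrightarrow> 1 * 1"
    using True by (intro tendsto_mult flat_exp_0_tendsto) auto
  moreover have "bump s t n x = flat_exp 0 (real n * (x - s)) * flat_exp 0 (real n * (t - x))" for n
    by (simp add: bump_def algebra_simps)
  ultimately show ?thesis using True by simp
qed (simp add: bump_eq_0)

section \<open>The fundamental lemma of the calculus of variations\<close>

lemma AE_zero_if_interval_integrals_zero:
  fixes h :: "real \<Rightarrow> complex"
  assumes int: "integrable lborel h"
    and zero: "\<And>s t. s < t \<Longrightarrow> (LINT x:{s<..<t}|lborel. h x) = 0"
    and total: "(LINT x|lborel. h x) = 0"
  shows "AE x in lborel. h x = 0"
proof (rule sigma_finite_measure.density_zero[OF sigma_finite_lborel int])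
  (* Open intervals form an intersection-stable generator of the Borel sets, so the sets
     with vanishing integral, being closed under complements and disjoint unions, are all of them. *)
  have borel_eq: "(borel :: real measure) = sigma UNIV (range (\<lambda>(a, b). {a <..< b}))"
    using borel_eq_box[where 'a = real] by (simp add: box_real)
  fix A assume "A \<in> sets (lborel :: real measure)"
  hence A: "A \<in> sigma_sets UNIV (range (\<lambda>(a, b). {a <..< b :: real}))"
    by (simp add: borel_eq)
  have si: "set_integrable lborel B h" if "B \<in> sets borel" for B
    using int that unfolding set_integrable_def by (intro integrable_mult_indicator) auto
  have sg: "sigma_sets UNIV (range (\<lambda>(a, b). {a <..< b :: real})) = sets borel"
    by (simp add: borel_eq)
  show "(LINT x:A|lborel. h x) = 0"
  proof (rule sigma_sets_induct_disjoint[OF _ _ A])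
    show "Int_stable (range (\<lambda>(a, b). {a <..< b :: real}))"
    proof (rule Int_stableI)
      fix a b :: "real set" assume "a \<in> range (\<lambda>(a, b). {a <..< b})" "b \<in> range (\<lambda>(a, b). {a <..< b})"
      then obtain a1 a2 b1 b2 where "a = {a1<..<a2}" "b = {b1<..<b2}" by auto
      hence "a \<inter> b = {max a1 b1<..<min a2 b2}" by auto
      thus "a \<inter> b \<in> range (\<lambda>(a, b). {a <..< b})" by auto
    qed
  next
    fix B :: "real set" assume "B \<in> range (\<lambda>(a, b). {a <..< b})"
    then obtain a b where B: "B = {a<..<b}" by auto
    show "(LINT x:B|lborel. h x) = 0"
      by (cases "a < b") (use zero[of a b] in \<open>auto simp: B set_lebesgue_integral_def\<close>)
  next
    fix B assume B: "B \<in> sigma_sets UNIV (range (\<lambda>(a, b). {a <..< b :: real}))"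
      and 0: "(LINT x:B|lborel. h x) = 0"
    hence "B \<in> sets borel" by (simp add: sg)
    hence "(LINT x:(UNIV - B) \<union> B|lborel. h x) = (LINT x:(UNIV - B)|lborel. h x) + (LINT x:B|lborel. h x)"
      by (intro set_integral_Un si) auto
    moreover have "(UNIV - B) \<union> B = UNIV" by auto
    ultimately show "(LINT x:UNIV - B|lborel. h x) = 0"
      using 0 total by (simp add: set_lebesgue_integral_def)
  next
    fix B :: "nat \<Rightarrow> real set"
    assume B: "disjoint_family B" "range B \<subseteq> sigma_sets UNIV (range (\<lambda>(a, b). {a <..< b}))"
      and 0: "\<And>i. (LINT x:B i|lborel. h x) = 0"
    have [measurable]: "B i \<in> sets borel" for i using B(2) sg by auto
    have "(LINT x:(\<Union>i. B i)|lborel. h x) = (\<Sum>i. LINT x:B i|lborel. h x)"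
      using B(1) by (intro lebesgue_integral_countable_add si) (auto simp: disjoint_family_on_def)
    thus "(LINT x:(\<Union>i. B i)|lborel. h x) = 0" by (simp add: 0)
  qed (auto simp: set_lebesgue_integral_def)
qed

text \<open>
  Integrability is required up to the origin, where square integrable functions on the half-line have it.
  Integrals can then start at 0.
\<close>

definition loc_int :: "(real \<Rightarrow> complex) \<Rightarrow> bool" where
  "loc_int h \<longleftrightarrow> (\<forall>T. set_integrable lborel {0..T} h)"

lemma loc_intD: "loc_int h \<Longrightarrow> set_integrable lborel {a..b} h" if "0 \<le> a" for a b
  by (rule set_integrable_subset[of _ "{0..b}"]) (use that in \<open>auto simp: loc_int_def\<close>)

text \<open>
  Bumps converge boundedly to indicators of intervals, so all integrals of \<open>h\<close> over intervals vanish.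
\<close>

lemma fundamental_lemma_halfline:
  fixes h :: "real \<Rightarrow> complex"
  assumes h: "loc_int h"
    and zero: "\<And>\<psi>. test_function {0<..} \<psi> \<Longrightarrow> (HINT x. \<psi> x *\<^sub>R h x) = 0"
  shows "AE x in lborel. 0 < x \<longrightarrow> h x = 0"
proof -
  have I: "(LINT x:{s<..<t}|lborel. h x) = 0" if "0 < s" "s < t" for s t
  proof -
    have int: "set_integrable lborel {s..t} h" using loc_intD[OF _ h, of s] that by simp
    hence m: "(\<lambda>x. indicator {s..t} x *\<^sub>R h x) \<in> borel_measurable borel"
      unfolding set_integrable_def by (simp add: borel_measurable_integrable)
    have bm: "bump s t n \<in> borel_measurable borel" for n
      by (intro borel_measurable_continuous_onI continuous_at_imp_continuous_on ballI smooth_isCont bump_smooth)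
    have "(\<lambda>n. LINT x|lborel. bump s t n x *\<^sub>R (indicator {s..t} x *\<^sub>R h x)) \<longlonglongrightarrow>
            (LINT x|lborel. indicator {s<..<t} x *\<^sub>R (indicator {s..t} x *\<^sub>R h x))"
    proof (rule integral_dominated_convergence[where w = "\<lambda>x. norm (indicator {s..t} x *\<^sub>R h x)"])
      show "integrable lborel (\<lambda>x. norm (indicat_real {s..t} x *\<^sub>R h x))"
        using int unfolding set_integrable_def by (rule integrable_norm)
      show "AE x in lborel. (\<lambda>n. bump s t n x *\<^sub>R indicat_real {s..t} x *\<^sub>R h x) \<longlonglongrightarrow>
          indicat_real {s<..<t} x *\<^sub>R indicat_real {s..t} x *\<^sub>R h x"
        by (intro AE_I2 tendsto_scaleR bump_tendsto tendsto_const)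
      show "AE x in lborel. norm (bump s t n x *\<^sub>R indicat_real {s..t} x *\<^sub>R h x)
          \<le> norm (indicat_real {s..t} x *\<^sub>R h x)" for n
        using bump_bounds[of s t n] by (intro AE_I2) (auto simp: mult_left_le_one_le split: split_indicator)
      show "(\<lambda>x. bump s t n x *\<^sub>R indicat_real {s..t} x *\<^sub>R h x) \<in> borel_measurable lborel" for n
        by (rule borel_measurable_scaleR) (use m bm[of n] in simp_all)
      show "(\<lambda>x. indicat_real {s<..<t} x *\<^sub>R indicat_real {s..t} x *\<^sub>R h x) \<in> borel_measurable lborel"
        by (rule borel_measurable_scaleR) (use m in simp_all)
    qed
    moreover have "(LINT x|lborel. bump s t n x *\<^sub>R (indicator {s..t} x *\<^sub>R h x)) = 0" for n
    proof -
      have "(LINT x|lborel. bump s t n x *\<^sub>R (indicator {s..t} x *\<^sub>R h x)) =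
            (HINT x. bump s t n x *\<^sub>R h x)"
        unfolding set_lebesgue_integral_def
        by (rule Bochner_Integration.integral_cong) (use that bump_eq_0[of _ s t n] in \<open>auto split: split_indicator\<close>)
      thus ?thesis using zero[OF bump_test_function[OF that]] by simp
    qed
    ultimately have "(LINT x|lborel. indicator {s<..<t} x *\<^sub>R (indicator {s..t} x *\<^sub>R h x)) = 0"
      by (simp add: LIMSEQ_const_iff)
    also have "(LINT x|lborel. indicator {s<..<t} x *\<^sub>R (indicator {s..t} x *\<^sub>R h x)) =
        (LINT x:{s<..<t}|lborel. h x)"
      unfolding set_lebesgue_integral_def
      by (rule Bochner_Integration.integral_cong) (auto split: split_indicator)
    finally show ?thesis .
  qed
  have "AE x in lborel. inverse (real (Suc n)) < x \<and> x < real n \<longrightarrow> h x = 0" for n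
  proof (cases "inverse (real (Suc n)) < real n")
    case True
    let ?a = "inverse (real (Suc n))" and ?b = "real n"
    have a: "?a > 0" by simp
    have "AE x in lborel. indicator {?a<..<?b} x *\<^sub>R h x = 0"
    proof (rule AE_zero_if_interval_integrals_zero)
      show "integrable lborel (\<lambda>x. indicat_real {?a<..<?b} x *\<^sub>R h x)"
        using set_integrable_subset[OF loc_intD[OF _ h, of ?a ?b], of "{?a<..<?b}"]
        by (force simp: set_integrable_def)
      show "(LINT x|lborel. indicator {?a<..<?b} x *\<^sub>R h x) = 0"
        using I[OF a True] by (simp add: set_lebesgue_integral_def)
      fix s t :: real
      have "(LINT x:{s<..<t}|lborel. indicator {?a<..<?b} x *\<^sub>R h x) = (LINT x:{max s ?a<..<min t ?b}|lborel. h x)"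
        unfolding set_lebesgue_integral_def
        by (rule Bochner_Integration.integral_cong) (auto split: split_indicator)
      also have "\<dots> = 0"
      proof (cases "max s ?a < min t ?b")
        case True
        moreover have "0 < max s ?a" using a by linarith
        ultimately show ?thesis by (intro I)
      next
        case False
        hence e: "{max s ?a<..<min t ?b} = {}" by auto
        show ?thesis unfolding e by (simp add: set_lebesgue_integral_def)
      qed
      finally show "(LINT x:{s<..<t}|lborel. indicator {?a<..<?b} x *\<^sub>R h x) = 0" .
    qed
    thus ?thesis by eventually_elim auto
  qed auto
  hence "AE x in lborel. \<forall>n. inverse (real (Suc n)) < x \<and> x < real n \<longrightarrow> h x = 0"
    by (subst AE_all_countable) auto
  thus ?thesis
  proof eventually_elim
    case (elim x)
    show ?case
    proof
      assume "0 < x"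
      then obtain n where n: "inverse (real (Suc n)) < x" using reals_Archimedean by blast
      obtain m where m: "x < real m" using reals_Archimedean2 by blast
      let ?k = "max n m"
      have "inverse (real (Suc ?k)) \<le> inverse (real (Suc n))" by (intro le_imp_inverse_le) auto
      hence "inverse (real (Suc ?k)) < x" using n by linarith
      moreover have "x < real ?k" using m by simp
      ultimately show "h x = 0" using elim by blast
    qed
  qed
qed

lemma smooth_mult_loc_int:
  assumes w: "loc_int w" and f: "smooth f" "\<And>x. x \<notin> {a..b} \<Longrightarrow> f x = 0" "0 < a"
  shows "integrable lborel (\<lambda>x. indicator {0<..} x *\<^sub>R f x *\<^sub>R w x)"
proof -
  note that = f
  have cf: "continuous_on A f" for A
    by (intro continuous_at_imp_continuous_on ballI smooth_isCont f)
  obtain B where B: "\<And>x. x \<in> {a..b} \<Longrightarrow> \<bar>f x\<bar> \<le> B" "B \<ge> 0"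
    using compact_imp_bounded[OF compact_continuous_image[OF cf, of "{a..b}"]]
    unfolding bounded_real by (metis abs_ge_zero compact_Icc imageI order_trans linear)
  have wi: "integrable lborel (\<lambda>x. indicator {a..b} x *\<^sub>R w x)"
    using loc_intD[OF _ w, of a b] that(3) by (simp add: set_integrable_def)
  have "integrable lborel (\<lambda>x. f x *\<^sub>R (indicator {a..b} x *\<^sub>R w x))"
  proof (rule Bochner_Integration.integrable_bound[OF integrable_scaleR_right[OF wi, of B]])
    show "(\<lambda>x. f x *\<^sub>R indicat_real {a..b} x *\<^sub>R w x) \<in> borel_measurable lborel"
      by (rule borel_measurable_scaleR) (use borel_measurable_continuous_onI[OF cf] borel_measurable_integrable[OF wi] in simp_all)
    show "AE x in lborel. norm (f x *\<^sub>R indicat_real {a..b} x *\<^sub>R w x) \<le> norm (B *\<^sub>R indicat_real {a..b} x *\<^sub>R w x)"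
      using B by (intro AE_I2) (auto intro!: mult_right_mono split: split_indicator)
  qed
  also have "(\<lambda>x. f x *\<^sub>R (indicator {a..b} x *\<^sub>R w x)) = (\<lambda>x. indicator {0<..} x *\<^sub>R f x *\<^sub>R w x)"
    using that by (auto simp: fun_eq_iff split: split_indicator)
  finally show ?thesis .
qed

lemma test_function_support:
  assumes "test_function {0<..} \<psi>"
  obtains a b where "0 < a" "a < b" "smooth \<psi>" "\<And>x. x \<notin> {a..b} \<Longrightarrow> \<psi> x = 0" "\<And>x. x \<notin> {a..b} \<Longrightarrow> deriv \<psi> x = 0"
proof -
  obtain a b where ab: "0 < a" "a < b" "\<And>x. x \<notin> {a..b} \<Longrightarrow> \<psi> x = 0" and sm: "smooth \<psi>"
    using assms unfolding test_function_iff_halfline by blast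
  have "deriv \<psi> x = 0" if "x \<notin> {a..b}" for x
  proof -
    have "eventually (\<lambda>y. y \<in> - {a..b}) (nhds x)"
      using that by (intro eventually_nhds_in_open) auto
    hence "eventually (\<lambda>y. \<psi> y = 0) (nhds x)" by eventually_elim (use ab in auto)
    hence "deriv \<psi> x = deriv (\<lambda>_. 0) x" by (intro deriv_cong_ev) auto
    thus ?thesis by simp
  qed
  with ab sm show ?thesis by (intro that)
qed

text \<open>
  An indefinite integral has its integrand as weak derivative. This is Fubini's theorem on a triangle, since the
  integrand has no pointwise meaning as a derivative.
\<close>

lemma integration_by_parts_halfline:
  fixes V g :: "real \<Rightarrow> complex"
  assumes g: "loc_int g"
    and V: "\<And>x. 0 \<le> x \<Longrightarrow> V x = V 0 + (LINT y:{0..x}|lborel. g y)"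
    and \<psi>: "test_function {0<..} \<psi>"
  shows "(HINT x. deriv \<psi> x *\<^sub>R V x) = - (HINT x. \<psi> x *\<^sub>R g x)"
proof -
  obtain a b where ab: "0 < a" "a < b" and sm: "smooth \<psi>"
    and ab3: "\<And>x. x \<notin> {a..b} \<Longrightarrow> \<psi> x = 0" and d\<psi>: "\<And>x. x \<notin> {a..b} \<Longrightarrow> deriv \<psi> x = 0"
    using test_function_support[OF \<psi>] by metis
  have \<psi>a: "\<psi> 0 = 0" "\<psi> (b+1) = 0" using ab ab3 by auto
  have cd: "continuous_on UNIV (deriv \<psi>)"
    by (intro continuous_at_imp_continuous_on ballI smooth_isCont smooth_deriv sm)
  hence [measurable]: "deriv \<psi> \<in> borel_measurable borel" by (rule borel_measurable_continuous_onI)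
  have FTC: "(LINT x:{s..t}|lborel. deriv \<psi> x) = \<psi> t - \<psi> s" if "s \<le> t" for s t
    unfolding set_lebesgue_integral_def using that
    by (intro integral_FTC_atLeastAtMost continuous_on_subset[OF cd])
       (auto simp: has_real_derivative_iff_has_vector_derivative[symmetric]
             intro!: has_field_derivative_at_within[OF smooth_has_derivative[OF sm]])
  (* Integrate \<open>deriv \<psi> x * g y\<close> over the triangle \<open>0 \<le> y \<le> x \<le> T\<close> in both orders,
     with T beyond the support of the test function. *)
  define T where "T = b + 1"
  have T: "0 < T" "b < T" using ab by (auto simp: T_def)
  define G where "G = (\<lambda>y. indicator {0..T} y *\<^sub>R g y)"
  define D where "D = (\<lambda>x. indicator {0..T} x *\<^sub>R deriv \<psi> x)"
  have Gint: "integrable lborel G" using g unfolding G_def loc_int_def set_integrable_def by blast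
  hence [measurable]: "G \<in> borel_measurable borel" using borel_measurable_integrable by fastforce
  have Dint: "integrable lborel D"
    unfolding D_def using borel_integrable_atLeastAtMost'[OF continuous_on_subset[OF cd], of 0 T]
    by (simp add: set_integrable_def)
  hence [measurable]: "D \<in> borel_measurable borel" using borel_measurable_integrable by fastforce
  have DG: "integrable (lborel \<Otimes>\<^sub>M lborel) (\<lambda>(x, y). D x *\<^sub>R G y)"
  proof (rule lborel_pair.Fubini_integrable)
    show "integrable lborel (\<lambda>x. LINT y|lborel. norm (case (x, y) of (x, y) \<Rightarrow> D x *\<^sub>R G y))"
      using Dint by (auto intro!: integrable_mult_left)
    show "AE x in lborel. integrable lborel (\<lambda>y. case (x, y) of (x, y) \<Rightarrow> D x *\<^sub>R G y)"
      using Gint by auto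
  qed (auto simp: split_beta)
  have DGi: "integrable (lborel \<Otimes>\<^sub>M lborel) (\<lambda>(x, y). (if y \<le> x then 1 else 0) *\<^sub>R (D x *\<^sub>R G y))"
    by (rule Bochner_Integration.integrable_bound[OF DG]) (auto simp: split_beta)
  have "(HINT x. deriv \<psi> x *\<^sub>R V x) =
      (LINT x|lborel. D x *\<^sub>R V 0 + (LINT y|lborel. (if y \<le> x then 1 else 0) *\<^sub>R (D x *\<^sub>R G y)))"
    unfolding set_lebesgue_integral_def
  proof (rule Bochner_Integration.integral_cong[OF refl])
    fix x :: real
    have "(LINT y|lborel. (if y \<le> x then 1 else 0) *\<^sub>R (D x *\<^sub>R G y)) = D x *\<^sub>R (LINT y:{0..x}|lborel. g y)"
    proof (cases "x \<in> {0..T}")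
      case True
      have "(LINT y|lborel. (if y \<le> x then 1 else 0) *\<^sub>R (D x *\<^sub>R G y)) = (LINT y|lborel. D x *\<^sub>R (indicator {0..x} y *\<^sub>R g y))"
        by (rule Bochner_Integration.integral_cong) (use True in \<open>auto simp: G_def split: split_indicator\<close>)
      also have "\<dots> = D x *\<^sub>R (LINT y:{0..x}|lborel. g y)"
        unfolding set_lebesgue_integral_def by (rule integral_scaleR_right)
      finally show ?thesis .
    qed (auto simp: D_def)
    thus "indicat_real {0<..} x *\<^sub>R deriv \<psi> x *\<^sub>R V x =
         D x *\<^sub>R V 0 + (LINT y|lborel. (if y \<le> x then 1 else 0) *\<^sub>R (D x *\<^sub>R G y))"
      using V[of x] d\<psi>[of x] ab T by (auto simp: D_def scaleR_add_right split: split_indicator)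
  qed
  also have "\<dots> = (LINT x|lborel. D x) *\<^sub>R V 0 +
      (LINT x|lborel. (LINT y|lborel. (if y \<le> x then 1 else 0) *\<^sub>R (D x *\<^sub>R G y)))"
    using lborel_pair.integrable_fst[OF DGi] Dint
    by (subst Bochner_Integration.integral_add) (auto intro!: integrable_scaleR_left)
  also have "(LINT x|lborel. D x) = 0"
    using FTC[of 0 T] T \<psi>a by (simp add: D_def set_lebesgue_integral_def T_def)
  also have "(LINT x|lborel. (LINT y|lborel. (if y \<le> x then 1 else 0) *\<^sub>R (D x *\<^sub>R G y))) =
     (LINT y|lborel. (LINT x|lborel. (if y \<le> x then 1 else 0) *\<^sub>R (D x *\<^sub>R G y)))"
    using lborel_pair.Fubini_integral[OF DGi] by simp
  also have "\<dots> = (LINT y|lborel. - (indicator {0<..} y *\<^sub>R (\<psi> y *\<^sub>R g y)))"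
  proof (rule Bochner_Integration.integral_cong[OF refl])
    fix y :: real
    show "(LINT x|lborel. (if y \<le> x then 1 else 0) *\<^sub>R (D x *\<^sub>R G y)) = - (indicator {0<..} y *\<^sub>R (\<psi> y *\<^sub>R g y))"
    proof (cases "y \<in> {0..T}")
      case True
      have "(LINT x|lborel. (if y \<le> x then 1 else 0) *\<^sub>R (D x *\<^sub>R G y)) =
           (LINT x|lborel. (indicator {y..T} x *\<^sub>R deriv \<psi> x) *\<^sub>R g y)"
        by (rule Bochner_Integration.integral_cong) (use True in \<open>auto simp: G_def D_def split: split_indicator\<close>)
      also have "\<dots> = (LINT x:{y..T}|lborel. deriv \<psi> x) *\<^sub>R g y"
        unfolding set_lebesgue_integral_def
        using borel_integrable_atLeastAtMost'[OF continuous_on_subset[OF cd], of y T]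
        by (intro integral_scaleR_left) (auto simp: set_integrable_def)
      also have "\<dots> = - (\<psi> y *\<^sub>R g y)" using FTC[of y T] True \<psi>a by (simp add: T_def)
      finally show ?thesis using True \<psi>a by (auto split: split_indicator)
    next
      case False
      thus ?thesis using ab3[of y] ab T by (auto simp: G_def)
    qed
  qed
  finally show ?thesis by (simp add: set_lebesgue_integral_def)
qed

text \<open>
  A test function of mean zero is the derivative of a test function. Hence the integral of \<open>w\<close> against any test
  function depends on the mean of that function only, as it does for a constant.
\<close>

lemma du_Bois_Reymond_halfline:
  fixes w :: "real \<Rightarrow> complex"
  assumes w: "loc_int w"
    and zero: "\<And>\<psi>. test_function {0<..} \<psi> \<Longrightarrow> (HINT x. deriv \<psi> x *\<^sub>R w x) = 0"
  shows "\<exists>c. AE x in lborel. 0 < x \<longrightarrow> w x = c"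
proof -
  define \<eta> where "\<eta> = bump 1 2 1"
  have \<eta>: "smooth \<eta>" "\<And>x. x \<notin> {1<..<2} \<Longrightarrow> \<eta> x = 0" "\<And>x. 0 \<le> \<eta> x"
    unfolding \<eta>_def using bump_smooth bump_eq_0 bump_bounds by auto
  have \<eta>pos: "\<eta> x > 0" if "x \<in> {1<..<2}" for x
    using that by (auto simp: \<eta>_def bump_def flat_exp_def)
  have cont: "continuous_on A f" if "smooth f" for f :: "real \<Rightarrow> real" and A
    by (intro continuous_at_imp_continuous_on ballI smooth_isCont that)
  have bm: "f \<in> borel_measurable borel" if "smooth f" for f :: "real \<Rightarrow> real"
    by (intro borel_measurable_continuous_onI cont that)
  have fin: "integrable lborel f" if "smooth f" "\<And>x. x \<notin> {a..b} \<Longrightarrow> f x = 0" for f :: "real \<Rightarrow> real" and a b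
  proof -
    have "integrable lborel (\<lambda>x. indicator {a..b} x *\<^sub>R f x)"
      using borel_integrable_atLeastAtMost'[OF cont[OF that(1)], of a b] by (simp add: set_integrable_def)
    also have "(\<lambda>x. indicator {a..b} x *\<^sub>R f x) = f" using that(2) by (auto simp: fun_eq_iff split: split_indicator)
    finally show ?thesis .
  qed
  note fw = smooth_mult_loc_int[OF w]
  define I where "I = (LINT x|lborel. \<eta> x)"
  have \<eta>int: "integrable lborel \<eta>" by (rule fin[of _ 1 2]) (use \<eta> in auto)
  have "I \<noteq> 0"
  proof
    assume "I = 0"
    hence "AE x in lborel. \<eta> x = 0"
      using integral_nonneg_eq_0_iff_AE[OF \<eta>int] \<eta>(3) by (auto simp: I_def)
    hence "AE x in lborel. x \<notin> {1<..<2::real}" by eventually_elim (use \<eta>pos in force)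
    moreover have "{1<..<2::real} \<in> sets lborel" by simp
    ultimately have "emeasure lborel {1<..<2::real} = 0"
      by (subst (asm) AE_iff_measurable[where N = "{1<..<2::real}"]) auto
    thus False by simp
  qed
  define c where "c = (1 / I) *\<^sub>R (HINT x. \<eta> x *\<^sub>R w x)"
  have "(HINT x. \<rho> x *\<^sub>R (w x - c)) = 0" if \<rho>: "test_function {0<..} \<rho>" for \<rho>
  proof -
    obtain a b where ab: "0 < a" "a < b" "\<And>x. x \<notin> {a..b} \<Longrightarrow> \<rho> x = 0" and sm: "smooth \<rho>"
      using \<rho> unfolding test_function_iff_halfline by blast
    define J where "J = (LINT x|lborel. \<rho> x)"
    (* Subtracting a multiple of the fixed bump makes the mean zero, and then the
       antiderivative is again compactly supported. *)
    define \<xi> where "\<xi> = (\<lambda>x. \<rho> x + (- J / I) * \<eta> x)"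
    have sm\<xi>: "smooth \<xi>" unfolding \<xi>_def by (intro smooth_linear_combination sm \<eta>)
    obtain F where F: "\<And>x. (F has_real_derivative \<xi> x) (at x)"
      using einterval_antiderivative[of "-\<infinity>" "\<infinity>" \<xi>] smooth_isCont[OF sm\<xi>]
      by (auto simp: has_real_derivative_iff_has_vector_derivative)
    define a' b' where "a' = min a 1" and "b' = max b 2"
    have ab': "0 < a'" "a' < b'" using ab by (auto simp: a'_def b'_def)
    have "\<xi> x = 0" if "x \<notin> {a'..b'}" for x
    proof -
      have "x \<notin> {a..b}" "x \<notin> {1<..<2}" using that by (auto simp: a'_def b'_def)
      thus ?thesis using ab(3) \<eta>(2) by (simp add: \<xi>_def)
    qed
    note ab' = ab' this
    have \<rho>int: "integrable lborel \<rho>" by (rule fin[of _ a b]) (use ab sm in auto)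
    have "(LINT x|lborel. \<xi> x) = J - J / I * I"
      unfolding \<xi>_def J_def I_def using \<rho>int \<eta>int by simp
    hence \<xi>0: "(LINT x|lborel. \<xi> x) = 0" using \<open>I \<noteq> 0\<close> by simp
    define \<psi> where "\<psi> = (\<lambda>x. F x - F (a' / 2))"
    have d\<psi>: "(\<psi> has_real_derivative \<xi> x) (at x)" for x
      unfolding \<psi>_def by (auto intro!: derivative_eq_intros F)
    have \<psi>l: "\<psi> x = 0" if "x < a'" for x
    proof -
      have "F x = F (a' / 2)"
      proof (rule DERIV_isconst3[where a = "min x (a'/2) - 1" and b = a' and f = F])
        fix y assume "y \<in> {min x (a'/2) - 1<..<a'}"
        thus "(F has_real_derivative 0) (at y)" using F[of y] ab'(3)[of y] by simp
      qed (use that ab' in auto)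
      thus ?thesis by (simp add: \<psi>_def)
    qed
    have \<psi>r: "\<psi> x = 0" if "x > b'" for x
    proof -
      have "(LINT y:{a'/2..x}|lborel. \<xi> y) = F x - F (a'/2)"
        unfolding set_lebesgue_integral_def using that ab'
        by (intro integral_FTC_atLeastAtMost cont sm\<xi>)
           (auto simp: has_real_derivative_iff_has_vector_derivative[symmetric] intro!: has_field_derivative_at_within[OF F])
      moreover have "(LINT y:{a'/2..x}|lborel. \<xi> y) = (LINT y|lborel. \<xi> y)"
        unfolding set_lebesgue_integral_def
        by (rule Bochner_Integration.integral_cong) (use that ab' in \<open>auto split: split_indicator\<close>)
      ultimately show ?thesis using \<xi>0 by (simp add: \<psi>_def)
    qed
    have "test_function {0<..} \<psi>"
      unfolding test_function_iff_halfline
      using smooth_antiderivative[OF sm\<xi> d\<psi>] ab'(1,2) \<psi>l \<psi>r by (metis atLeastAtMost_iff not_le)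
    hence "0 = (HINT x. \<xi> x *\<^sub>R w x)"
      using zero[of \<psi>] DERIV_imp_deriv[OF d\<psi>] by simp
    also have "\<dots> = (LINT x|lborel. indicator {0<..} x *\<^sub>R \<rho> x *\<^sub>R w x + (- J / I) *\<^sub>R (indicator {0<..} x *\<^sub>R \<eta> x *\<^sub>R w x))"
      unfolding set_lebesgue_integral_def \<xi>_def
      by (rule Bochner_Integration.integral_cong) (auto simp: algebra_simps split: split_indicator)
    also have "\<dots> = (HINT x. \<rho> x *\<^sub>R w x) - J *\<^sub>R c"
    proof -
      have "integrable lborel (\<lambda>x. indicator {0<..} x *\<^sub>R \<rho> x *\<^sub>R w x)"
        using fw[OF sm ab(3) ab(1)] by blast
      moreover have i: "integrable lborel (\<lambda>x. indicator {0<..} x *\<^sub>R \<eta> x *\<^sub>R w x)"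
        by (rule fw[of \<eta> 1 2]) (use \<eta> in auto)
      ultimately show ?thesis
        unfolding c_def set_lebesgue_integral_def
        by (subst Bochner_Integration.integral_add[OF _ integrable_scaleR_right[OF i]],
            blast, subst integral_scaleR_right) simp
    qed
    also have "J *\<^sub>R c = (LINT x|lborel. \<rho> x *\<^sub>R c)"
      unfolding J_def using \<rho>int by simp
    also have "(HINT x. \<rho> x *\<^sub>R w x) - (LINT x|lborel. \<rho> x *\<^sub>R c) =
       (LINT x|lborel. indicator {0<..} x *\<^sub>R \<rho> x *\<^sub>R w x - \<rho> x *\<^sub>R c)"
      unfolding set_lebesgue_integral_def
      by (rule Bochner_Integration.integral_diff[symmetric])
         (use fw[OF sm ab(3) ab(1)] \<rho>int in blast, use \<rho>int in simp)
    also have "\<dots> = (HINT x. \<rho> x *\<^sub>R (w x - c))"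
      unfolding set_lebesgue_integral_def
      by (rule Bochner_Integration.integral_cong) (use ab in \<open>auto simp: algebra_simps split: split_indicator\<close>)
    finally show ?thesis by simp
  qed
  moreover have "loc_int (\<lambda>x. w x - c)"
    using w borel_integrable_atLeastAtMost'[OF continuous_on_const, of _ _ c]
    unfolding loc_int_def by (auto intro!: set_integral_diff)
  ultimately have "AE x in lborel. 0 < x \<longrightarrow> w x - c = 0"
    by (intro fundamental_lemma_halfline)
  thus ?thesis by (auto intro!: exI[of _ c])
qed

section \<open>Representatives of Sobolev functions on the half-line\<close>

text \<open>
  The continuous representative of a Sobolev function, together with its weak derivative. It is absolutely
  continuous up to the origin, so that \<open>v 0\<close> is the trace.
\<close>

definition H1_rep :: "(real \<Rightarrow> complex) \<Rightarrow> (real \<Rightarrow> complex) \<Rightarrow> bool" where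
  "H1_rep v g \<longleftrightarrow> L2_on {0<..} v \<and> L2_on {0<..} g \<and>
     (\<forall>x\<ge>0. v x = v 0 + (LINT y:{0..x}|lborel. g y))"

text \<open>
  On bounded sets \<open>\<bar>g\<bar> \<le> 1 + \<bar>g\<bar>\<^sup>2\<close> gives integrability.
\<close>

lemma L2_on_loc_int:
  assumes "L2_on {0<..} g"
  shows "loc_int g"
  unfolding loc_int_def
proof
  fix T :: real
  have m: "set_borel_measurable lborel {0<..T} g"
    by (rule set_borel_measurable_subset[of _ "{0<..}"]) (use assms in \<open>auto simp: L2_on_def\<close>)
  have "set_integrable lborel {0<..T} (\<lambda>x. 1 + (norm (g x))\<^sup>2)"
  proof (rule set_integral_add(1))
    show "set_integrable lborel {0<..T} (\<lambda>x. 1::real)"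
      by (rule set_integrable_subset[OF borel_integrable_atLeastAtMost'[of 0 T]]) auto
    show "set_integrable lborel {0<..T} (\<lambda>x. (norm (g x))\<^sup>2)"
      by (rule set_integrable_subset[of _ "{0<..}"]) (use assms in \<open>auto simp: L2_on_def\<close>)
  qed
  hence "set_integrable lborel {0<..T} g"
  proof (rule set_integrable_bound[OF _ m], intro AE_I2 impI)
    fix x :: real
    have "norm (g x) \<le> 1 + (norm (g x))\<^sup>2"
    proof -
      have "2 * norm (g x) \<le> 1 + (norm (g x))\<^sup>2"
        using zero_le_power2[of "norm (g x) - 1"] unfolding power2_eq_square by (simp add: algebra_simps)
      thus ?thesis using norm_ge_zero[of "g x"] by linarith
    qed
    thus "norm (g x) \<le> norm (1 + (norm (g x))\<^sup>2)" by simp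
  qed
  thus "set_integrable lborel {0..T} g" by (simp add: set_integrable_Icc_iff_Ioc)
qed

lemma L2_on_cong_AE:
  assumes "L2_on A f" "set_borel_measurable lborel A g" "AE x in lborel. x \<in> A \<longrightarrow> f x = g x"
  shows "L2_on A g"
proof -
  have "(\<lambda>x. indicator A x *\<^sub>R g x) \<in> borel_measurable lborel" using assms(2) by (simp add: set_borel_measurable_def)
  hence "(\<lambda>x. (norm (indicat_real A x *\<^sub>R g x))\<^sup>2) \<in> borel_measurable lborel" by measurable
  also have "(\<lambda>x. (norm (indicat_real A x *\<^sub>R g x))\<^sup>2) = (\<lambda>x. indicator A x *\<^sub>R (norm (g x))\<^sup>2)"
    by (auto simp: fun_eq_iff split: split_indicator)
  finally have m: "set_borel_measurable lborel A (\<lambda>x. (norm (g x))\<^sup>2)" by (simp add: set_borel_measurable_def)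
  have "set_integrable lborel A (\<lambda>x. (norm (f x))\<^sup>2)" using assms(1) by (simp add: L2_on_def)
  moreover have "AE x in lborel. x \<in> A \<longrightarrow> norm ((norm (g x))\<^sup>2) \<le> norm ((norm (f x))\<^sup>2)"
    using assms(3) by eventually_elim simp
  ultimately have "set_integrable lborel A (\<lambda>x. (norm (g x))\<^sup>2)"
    using set_integrable_bound[OF _ m] by blast
  thus ?thesis using assms(2) by (simp add: L2_on_def)
qed

lemma continuous_on_atLeast_0I:
  fixes v :: "real \<Rightarrow> 'a :: topological_space"
  assumes "\<And>T. continuous_on {0..T} v"
  shows "continuous_on {0..} v"
  unfolding continuous_on_eq_continuous_within
proof
  fix x :: real assume x: "x \<in> {0..}"
  have "at x within {0..} = at x within {0..x+1}"
    by (rule at_within_nhd[of x "{x-1<..<x+1}"]) auto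
  thus "continuous (at x within {0..}) v"
    using bspec[OF assms[of "x+1", unfolded continuous_on_eq_continuous_within], of x] x
    by (simp add: continuous_within)
qed

lemma loc_int_indefinite_integral_continuous:
  assumes g: "loc_int g"
  shows "continuous_on {0..} (\<lambda>x. LINT y:{0..x}|lborel. g y)"
proof (rule continuous_on_atLeast_0I)
  fix T :: real
  have i: "set_integrable lborel {0..x} g" for x using g by (simp add: loc_int_def)
  have "continuous_on {0..T} (\<lambda>x. integral {0..x} g)"
    by (rule indefinite_integral_continuous_1[OF set_borel_integral_eq_integral(1)[OF i]])
  thus "continuous_on {0..T} (\<lambda>x. LINT y:{0..x}|lborel. g y)"
    by (simp add: set_borel_integral_eq_integral(2)[OF i])
qed

lemma H1_rep_continuous:
  assumes "H1_rep v g"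
  shows "continuous_on {0..} v"
proof (rule continuous_on_eq)
  show "continuous_on {0..} (\<lambda>x. v 0 + (LINT y:{0..x}|lborel. g y))"
    using assms unfolding H1_rep_def
    by (intro continuous_intros loc_int_indefinite_integral_continuous L2_on_loc_int) blast
  show "v 0 + (LINT y:{0..x}|lborel. g y) = v x" if "x \<in> {0..}" for x
    using assms that unfolding H1_rep_def by (metis atLeast_iff)
qed

lemma H1_rep_increment:
  assumes "H1_rep v g" "0 \<le> s" "s \<le> t"
  shows "v t - v s = (LINT y:{s..t}|lborel. g y)"
proof -
  have g: "loc_int g" using assms(1) L2_on_loc_int unfolding H1_rep_def by blast
  have "(LINT y:{0..t}|lborel. g y) = (LINT y:{0..s}|lborel. g y) + (LINT y:{s..t}|lborel. g y)"
    by (rule set_integral_Icc_combine) (use loc_intD[OF _ g] assms in auto)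
  moreover have "v s = v 0 + (LINT y:{0..s}|lborel. g y)" "v t = v 0 + (LINT y:{0..t}|lborel. g y)"
    using assms order_trans unfolding H1_rep_def by blast+
  ultimately show ?thesis by (metis add_diff_cancel_left' add_diff_cancel_left)
qed

lemma set_borel_measurable_scaleR_smooth:
  assumes "set_borel_measurable lborel A (u :: real \<Rightarrow> complex)" "smooth f"
  shows "(\<lambda>x. indicator A x *\<^sub>R (f x *\<^sub>R u x)) \<in> borel_measurable lborel"
proof -
  have "f \<in> borel_measurable borel"
    by (intro borel_measurable_continuous_onI continuous_at_imp_continuous_on ballI smooth_isCont assms)
  hence "f \<in> borel_measurable lborel" by simp
  hence "(\<lambda>x. f x *\<^sub>R (indicator A x *\<^sub>R u x)) \<in> borel_measurable lborel"
    by (rule borel_measurable_scaleR)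
       (use assms(1)[unfolded set_borel_measurable_def] in simp_all)
  thus ?thesis by (simp add: mult.commute)
qed

lemma set_integral_cong_AE_smooth:
  assumes "set_borel_measurable lborel A (u :: real \<Rightarrow> complex)" "set_borel_measurable lborel A v" "smooth f"
    and "AE x in lborel. x \<in> A \<longrightarrow> u x = v x"
  shows "(LINT x:A|lborel. f x *\<^sub>R u x) = (LINT x:A|lborel. f x *\<^sub>R v x)"
  unfolding set_lebesgue_integral_def
proof (rule integral_cong_AE)
  show "AE x in lborel. indicat_real A x *\<^sub>R f x *\<^sub>R u x = indicat_real A x *\<^sub>R f x *\<^sub>R v x"
    using assms(4) by eventually_elim (auto split: split_indicator)
qed (use set_borel_measurable_scaleR_smooth assms in blast)+

lemma is_weak_deriv_cong_AE:
  assumes "set_borel_measurable lborel A u" "set_borel_measurable lborel A v"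
    and "AE x in lborel. x \<in> A \<longrightarrow> u x = v x" and "is_weak_deriv A u g"
  shows "is_weak_deriv A v g"
  unfolding is_weak_deriv_def
proof (intro allI impI)
  fix \<psi> assume t: "test_function A \<psi>"
  hence "smooth \<psi>" by (simp add: test_function_def smooth_def)
  hence "(LINT x:A|lborel. deriv \<psi> x *\<^sub>R u x) = (LINT x:A|lborel. deriv \<psi> x *\<^sub>R v x)"
    by (intro set_integral_cong_AE_smooth smooth_deriv assms)
  thus "(LINT x:A|lborel. deriv \<psi> x *\<^sub>R v x) = - (LINT x:A|lborel. \<psi> x *\<^sub>R g x)"
    using assms(4) t by (simp add: is_weak_deriv_def)
qed

lemma H1_rep_is_weak_deriv:
  assumes "H1_rep v g"
  shows "is_weak_deriv {0<..} v g"
  unfolding is_weak_deriv_def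
proof (intro allI impI)
  fix \<psi> assume "test_function {0<..} \<psi>"
  thus "(HINT x. deriv \<psi> x *\<^sub>R v x) = - (HINT x. \<psi> x *\<^sub>R g x)"
    using assms unfolding H1_rep_def
    by (intro integration_by_parts_halfline L2_on_loc_int) blast+
qed

lemma weak_deriv_unique_AE:
  assumes "L2_on {0<..} g" "L2_on {0<..} h" "is_weak_deriv {0<..} u g" "is_weak_deriv {0<..} u h"
  shows "AE x in lborel. 0 < x \<longrightarrow> g x = h x"
proof -
  have l: "loc_int g" "loc_int h" using assms by (auto intro: L2_on_loc_int)
  have "AE x in lborel. 0 < x \<longrightarrow> g x - h x = 0"
  proof (rule fundamental_lemma_halfline)
    show "loc_int (\<lambda>x. g x - h x)" using l by (auto simp: loc_int_def)
    fix \<psi> assume t: "test_function {0<..} \<psi>"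
    then obtain a b where "0 < a" "a < b" "smooth \<psi>" "\<And>x. x \<notin> {a..b} \<Longrightarrow> \<psi> x = 0"
      using test_function_support by metis
    hence "set_integrable lborel {0<..} (\<lambda>x. \<psi> x *\<^sub>R g x)" "set_integrable lborel {0<..} (\<lambda>x. \<psi> x *\<^sub>R h x)"
      using smooth_mult_loc_int l unfolding set_integrable_def by blast+
    hence "(HINT x. \<psi> x *\<^sub>R g x - \<psi> x *\<^sub>R h x) =
       (HINT x. \<psi> x *\<^sub>R g x) - (HINT x. \<psi> x *\<^sub>R h x)"
      by (rule set_integral_diff)
    moreover have "(HINT x. \<psi> x *\<^sub>R g x) = (HINT x. \<psi> x *\<^sub>R h x)"
      using assms(3)[unfolded is_weak_deriv_def, rule_format, OF t]
        assms(4)[unfolded is_weak_deriv_def, rule_format, OF t] by simp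
    ultimately show "(HINT x. \<psi> x *\<^sub>R (g x - h x)) = 0"
      by (simp add: scaleR_diff_right)
  qed
  thus ?thesis by simp
qed

text \<open>
  The difference between \<open>u\<close> and the indefinite integral of its weak derivative has weak derivative zero.
\<close>

lemma H1_on_halfline_imp_rep:
  assumes "H1_on {0<..} u"
  obtains v g where "H1_rep v g" "AE x in lborel. 0 < x \<longrightarrow> u x = v x"
proof -
  obtain g where u: "L2_on {0<..} u" and g: "L2_on {0<..} g" and ug: "is_weak_deriv {0<..} u g"
    using assms unfolding H1_on_def by blast
  have lu: "loc_int u" and lg: "loc_int g" using u g by (auto intro: L2_on_loc_int)
  define V where "V = (\<lambda>x. LINT y:{0..x}|lborel. g y)"
  have V0: "V 0 = 0"
    unfolding V_def set_integral_Icc_eq_Ioc by (simp add: set_lebesgue_integral_def)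
  have cV: "continuous_on {0..} V" unfolding V_def by (rule loc_int_indefinite_integral_continuous[OF lg])
  have lV: "loc_int V"
    unfolding loc_int_def by (intro allI borel_integrable_atLeastAtMost' continuous_on_subset[OF cV]) auto
  have "\<exists>c. AE x in lborel. 0 < x \<longrightarrow> u x - V x = c"
  proof (rule du_Bois_Reymond_halfline)
    show "loc_int (\<lambda>x. u x - V x)" using lu lV by (auto simp: loc_int_def)
    fix \<psi> assume t: "test_function {0<..} \<psi>"
    then obtain a b where "0 < a" "a < b" "smooth (deriv \<psi>)" "\<And>x. x \<notin> {a..b} \<Longrightarrow> deriv \<psi> x = 0"
      using test_function_support smooth_deriv by metis
    hence "set_integrable lborel {0<..} (\<lambda>x. deriv \<psi> x *\<^sub>R u x)" "set_integrable lborel {0<..} (\<lambda>x. deriv \<psi> x *\<^sub>R V x)"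
      using smooth_mult_loc_int lu lV unfolding set_integrable_def by blast+
    hence "(HINT x. deriv \<psi> x *\<^sub>R u x - deriv \<psi> x *\<^sub>R V x) =
       (HINT x. deriv \<psi> x *\<^sub>R u x) - (HINT x. deriv \<psi> x *\<^sub>R V x)"
      by (rule set_integral_diff)
    moreover have "(HINT x. deriv \<psi> x *\<^sub>R u x) = - (HINT x. \<psi> x *\<^sub>R g x)"
      using ug t unfolding is_weak_deriv_def by blast
    moreover have "(HINT x. deriv \<psi> x *\<^sub>R V x) = - (HINT x. \<psi> x *\<^sub>R g x)"
      by (rule integration_by_parts_halfline[OF lg _ t]) (use V0 in \<open>simp add: V_def\<close>)
    ultimately show "(HINT x. deriv \<psi> x *\<^sub>R (u x - V x)) = 0"
      by (simp add: scaleR_diff_right)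
  qed
  then obtain c where c: "AE x in lborel. 0 < x \<longrightarrow> u x - V x = c" by blast
  define v where "v = (\<lambda>x. c + V x)"
  have AEv: "AE x in lborel. 0 < x \<longrightarrow> u x = v x"
    using c by eventually_elim (auto simp: v_def)
  have vm: "set_borel_measurable lborel {0<..} v"
    unfolding v_def by (intro continuous_on_imp_set_measurable continuous_intros cV)
  have "L2_on {0<..} v" using L2_on_cong_AE[OF u vm] AEv by simp
  moreover have "v x = v 0 + (LINT y:{0..x}|lborel. g y)" if "0 \<le> x" for x
    using that V0 by (simp add: v_def V_def)
  ultimately have "H1_rep v g" using g unfolding H1_rep_def by blast
  thus ?thesis using AEv that by blast
qed

lemma continuous_AE_eq_imp_eq:
  fixes v w :: "real \<Rightarrow> 'a :: real_normed_vector"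
  assumes "continuous_on A v" "continuous_on A w" "open A" "AE x in lborel. x \<in> A \<longrightarrow> v x = w x" "x \<in> A"
  shows "v x = w x"
proof (rule ccontr)
  assume ne: "v x \<noteq> w x"
  have "open ((\<lambda>x. v x - w x) -` (- {0}) \<inter> A)"
    using continuous_on_diff[OF assms(1,2)] unfolding continuous_on_open_vimage[OF assms(3)] by blast
  hence "open {x \<in> A. v x \<noteq> w x}" by (simp add: vimage_def Int_def conj_commute)
  moreover have "x \<in> {x \<in> A. v x \<noteq> w x}" using ne assms(5) by simp
  ultimately obtain e where e: "e > 0" "ball x e \<subseteq> {x \<in> A. v x \<noteq> w x}" by (meson openE)
  have "AE y in lborel. y \<notin> ball x e" using assms(4) by eventually_elim (use e in auto)
  hence "emeasure lborel (ball x e) = 0"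
    by (subst (asm) AE_iff_measurable[where N = "ball x e"]) auto
  moreover have "ball x e = {x - e<..<x + e}" by (auto simp: dist_real_def)
  ultimately show False using e by simp
qed

text \<open>
  The limit at the origin does not depend on the representative: two continuous functions that agree almost
  everywhere on an open set agree on it.
\<close>

lemma trace0_halfline:
  assumes "H1_rep v g" "AE x in lborel. 0 < x \<longrightarrow> u x = v x"
  shows "trace0 {0<..} u = v 0"
  unfolding trace0_def
proof (rule the_equality)
  have cv: "continuous_on {0..} v" using assms H1_rep_continuous by blast
  have cv': "continuous_on {0<..} v" by (rule continuous_on_subset[OF cv]) auto
  have "(v \<longlongrightarrow> v 0) (at 0 within {0..})" using cv by (simp add: continuous_on)
  hence tv: "(v \<longlongrightarrow> v 0) (at 0 within {0<..})" by (rule tendsto_within_subset) auto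
  show "\<exists>va. continuous_on {0<..} va \<and> (AE x in lborel. x \<in> {0<..} \<longrightarrow> va x = u x) \<and> (va \<longlongrightarrow> v 0) (at 0 within {0<..})"
    using cv' tv assms(2) by (intro exI[of _ v]) (auto elim!: eventually_mono)
  fix l assume "\<exists>va. continuous_on {0<..} va \<and> (AE x in lborel. x \<in> {0<..} \<longrightarrow> va x = u x) \<and> (va \<longlongrightarrow> l) (at 0 within {0<..})"
  then obtain w where w: "continuous_on {0<..} w" "AE x in lborel. x \<in> {0<..} \<longrightarrow> w x = u x"
    "(w \<longlongrightarrow> l) (at 0 within {0<..})" by blast
  have "AE x in lborel. x \<in> {0<..} \<longrightarrow> w x = v x" using w(2) assms(2) by eventually_elim auto
  hence eq: "w x = v x" if "x \<in> {0<..}" for x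
    using continuous_AE_eq_imp_eq[OF w(1) cv' open_greaterThan] that by blast
  have "eventually (\<lambda>x. w x = v x) (at 0 within {0<..})"
    using eq by (auto simp: eventually_at_filter)
  hence "(v \<longlongrightarrow> l) (at 0 within {0<..})" using w(3) by (rule Lim_transform_eventually[rotated])
  thus "l = v 0" using tv by (intro tendsto_unique[of "at 0 within {0<..}"]) auto
qed

lemma H1_rep_weak_deriv:
  assumes "H1_rep v g" "AE x in lborel. 0 < x \<longrightarrow> u x = v x" "set_borel_measurable lborel {0<..} u"
  shows "H1_on {0<..} u" "L2_on {0<..} (weak_deriv {0<..} u)" "is_weak_deriv {0<..} u (weak_deriv {0<..} u)"
    "AE x in lborel. 0 < x \<longrightarrow> weak_deriv {0<..} u x = g x"
proof -
  have v: "L2_on {0<..} v" and g: "L2_on {0<..} g" using assms(1) unfolding H1_rep_def by blast+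
  have vu: "AE x in lborel. x \<in> {0<..} \<longrightarrow> v x = u x" using assms(2) by eventually_elim auto
  have ug: "is_weak_deriv {0<..} u g"
    by (rule is_weak_deriv_cong_AE[OF _ assms(3) vu H1_rep_is_weak_deriv[OF assms(1)]])
       (use v in \<open>simp add: L2_on_def\<close>)
  show "H1_on {0<..} u" using L2_on_cong_AE[OF v assms(3) vu] g ug by (auto simp: H1_on_def)
  have wd: "L2_on {0<..} (weak_deriv {0<..} u) \<and> is_weak_deriv {0<..} u (weak_deriv {0<..} u)"
    unfolding weak_deriv_def by (rule someI[of _ g]) (use g ug in blast)
  thus "L2_on {0<..} (weak_deriv {0<..} u)" "is_weak_deriv {0<..} u (weak_deriv {0<..} u)" by auto
  show "AE x in lborel. 0 < x \<longrightarrow> weak_deriv {0<..} u x = g x"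
    by (rule weak_deriv_unique_AE) (use wd g ug in auto)
qed

section \<open>Moduli of Sobolev functions\<close>

text \<open>
  The estimate \<open>\<bar>(\<Phi> r)'\<bar> \<le> \<bar>\<phi> r\<bar> k\<close> for a curve \<open>r\<close> whose speed is bounded by \<open>k\<close>, in integrated form. No derivative
  of \<open>r\<close> enters: on short intervals the mean value theorem for \<open>\<Phi>\<close> gives the estimate up to a small error, and
  these estimates add up along a subdivision.
\<close>

lemma chain_rule_bound:
  fixes r k \<Phi> \<phi> :: "real \<Rightarrow> real"
  assumes ab: "a \<le> b"
    and r: "continuous_on {a..b} r" "\<And>x. x \<in> {a..b} \<Longrightarrow> r x \<in> {lo..hi}"
    and k: "set_integrable lborel {a..b} k" "\<And>x. 0 \<le> k x"
    and rk: "\<And>s t. a \<le> s \<Longrightarrow> s \<le> t \<Longrightarrow> t \<le> b \<Longrightarrow> \<bar>r t - r s\<bar> \<le> (LINT x:{s..t}|lborel. k x)"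
    and \<Phi>: "\<And>s. s \<in> {lo..hi} \<Longrightarrow> (\<Phi> has_real_derivative \<phi> s) (at s within {lo..hi})"
    and \<phi>: "continuous_on {lo..hi} \<phi>"
  shows "set_integrable lborel {a..b} (\<lambda>x. \<bar>\<phi> (r x)\<bar> * k x)"
    and "\<bar>\<Phi> (r b) - \<Phi> (r a)\<bar> \<le> (LINT x:{a..b}|lborel. \<bar>\<phi> (r x)\<bar> * k x)"
proof -
  have c\<phi>: "continuous_on {a..b} (\<lambda>x. \<phi> (r x))"
    by (rule continuous_on_compose2[OF \<phi> r(1)]) (use r(2) in auto)
  obtain C where C: "\<And>x. x \<in> {a..b} \<Longrightarrow> \<bar>\<phi> (r x)\<bar> \<le> C"
    using compact_imp_bounded[OF compact_continuous_image[OF c\<phi>]]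
    unfolding bounded_real by (metis compact_Icc imageI)
  show int: "set_integrable lborel {a..b} (\<lambda>x. \<bar>\<phi> (r x)\<bar> * k x)"
  proof (rule set_integrable_bound)
    show "set_integrable lborel {a..b} (\<lambda>x. C * k x)" using k(1) by simp
    have "(\<lambda>x. (indicator {a..b} x *\<^sub>R \<bar>\<phi> (r x)\<bar>) * (indicator {a..b} x *\<^sub>R k x)) \<in> borel_measurable lborel"
    proof (rule borel_measurable_times)
      have "continuous_on {a..b} (\<lambda>x. \<bar>\<phi> (r x)\<bar>)" by (intro continuous_intros c\<phi>)
      from borel_integrable_atLeastAtMost'[OF this]
      show "(\<lambda>x. indicator {a..b} x *\<^sub>R \<bar>\<phi> (r x)\<bar>) \<in> borel_measurable lborel"
        unfolding set_integrable_def by (rule borel_measurable_integrable)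
      show "(\<lambda>x. indicator {a..b} x *\<^sub>R k x) \<in> borel_measurable lborel"
        using k(1) unfolding set_integrable_def by (rule borel_measurable_integrable)
    qed
    also have "(\<lambda>x. (indicator {a..b} x *\<^sub>R \<bar>\<phi> (r x)\<bar>) * (indicator {a..b} x *\<^sub>R k x)) =
        (\<lambda>x. indicator {a..b} x *\<^sub>R (\<bar>\<phi> (r x)\<bar> * k x))" by (auto simp: fun_eq_iff split: split_indicator)
    finally show "set_borel_measurable lborel {a..b} (\<lambda>x. \<bar>\<phi> (r x)\<bar> * k x)"
      by (simp add: set_borel_measurable_def)
    show "AE x in lborel. x \<in> {a..b} \<longrightarrow> norm (\<bar>\<phi> (r x)\<bar> * k x) \<le> norm (C * k x)"
      using C k(2) by (intro AE_I2) (force simp: abs_mult intro!: mult_right_mono)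
  qed
  have main: "\<bar>\<Phi> (r b) - \<Phi> (r a)\<bar> \<le> (LINT x:{a..b}|lborel. (\<bar>\<phi> (r x)\<bar> + \<epsilon>) * k x)" if \<epsilon>: "\<epsilon> > 0" for \<epsilon>
  proof -
    define q where "q = (\<lambda>x. (\<bar>\<phi> (r x)\<bar> + \<epsilon>) * k x)"
    have qint: "set_integrable lborel {a..b} q"
      unfolding q_def using set_integral_add(1)[OF int set_integrable_mult_right[of \<epsilon>, OF k(1)]] by (simp add: algebra_simps)
    define P where "P s t \<longleftrightarrow> (a \<le> s \<longrightarrow> t \<le> b \<longrightarrow> s \<le> t \<longrightarrow> \<bar>\<Phi> (r t) - \<Phi> (r s)\<bar> \<le> (LINT x:{s..t}|lborel. q x))" for s t
    have "P a b"
    proof (rule Bolzano[OF ab])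
      fix s t u assume st: "P s t" "P t u" "s \<le> t" "t \<le> u"
      show "P s u"
        unfolding P_def
      proof (intro impI)
        assume su: "a \<le> s" "u \<le> b"
        have "(LINT x:{s..u}|lborel. q x) = (LINT x:{s..t}|lborel. q x) + (LINT x:{t..u}|lborel. q x)"
          by (rule set_integral_Icc_combine) (use st su in \<open>auto intro!: set_integrable_subset[OF qint]\<close>)
        thus "\<bar>\<Phi> (r u) - \<Phi> (r s)\<bar> \<le> (LINT x:{s..u}|lborel. q x)"
          using st su by (auto simp: abs_le_iff P_def)
      qed
    next
      fix x assume "a \<le> x" "x \<le> b"
      hence x: "x \<in> {a..b}" by auto
      (* Near x the factor varies by less than half of epsilon, both along the curve and on
         the segment of values between its end points. *)
      define c where "c = \<bar>\<phi> (r x)\<bar>"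
      obtain d1 where d1: "d1 > 0" "\<And>\<xi>. \<xi> \<in> {lo..hi} \<Longrightarrow> dist \<xi> (r x) < d1 \<Longrightarrow> dist (\<phi> \<xi>) (\<phi> (r x)) < \<epsilon> / 2"
        using \<phi> r(2)[OF x] \<epsilon> unfolding continuous_on_iff by (metis half_gt_zero)
      obtain d where d: "d > 0" "\<And>y. y \<in> {a..b} \<Longrightarrow> dist y x < d \<Longrightarrow> dist (r y) (r x) < d1"
        using r(1) x d1(1) unfolding continuous_on_iff by metis
      have "\<bar>\<Phi> (r t) - \<Phi> (r s)\<bar> \<le> (LINT x:{s..t}|lborel. q x)"
        if st: "s \<le> x" "x \<le> t" "t - s < d" "a \<le> s" "t \<le> b" for s t
      proof -
        have near: "dist (r y) (r x) < d1" "r y \<in> {lo..hi}" if "y \<in> {s..t}" for y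
          using that st d(2)[of y] r(2)[of y] by (auto simp: dist_real_def)
        have e: "s \<in> {s..t}" "t \<in> {s..t}" using st by auto
        define S where "S = {min (r s) (r t)..max (r s) (r t)}"
        have S: "\<xi> \<in> {lo..hi}" "\<bar>\<phi> \<xi>\<bar> \<le> c + \<epsilon> / 2" if "\<xi> \<in> S" for \<xi>
        proof -
          show 1: "\<xi> \<in> {lo..hi}" using near(2)[OF e(1)] near(2)[OF e(2)] that by (auto simp: S_def)
          have "dist \<xi> (r x) < d1" using near(1)[OF e(1)] near(1)[OF e(2)] that
            by (auto simp: S_def dist_real_def)
          from d1(2)[OF 1 this] show "\<bar>\<phi> \<xi>\<bar> \<le> c + \<epsilon> / 2" unfolding c_def dist_real_def by linarith
        qed
        have i: "set_integrable lborel {s..t} k" "set_integrable lborel {s..t} q"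
          using st by (auto intro!: set_integrable_subset[OF k(1)] set_integrable_subset[OF qint])
        have "norm (\<Phi> (r t) - \<Phi> (r s)) \<le> (c + \<epsilon> / 2) * norm (r t - r s)"
        proof (rule field_differentiable_bound[where S = S])
          fix \<xi> assume "\<xi> \<in> S"
          show "norm (\<phi> \<xi>) \<le> c + \<epsilon> / 2" using S(2)[OF \<open>\<xi> \<in> S\<close>] by simp
          have "S \<subseteq> {lo..hi}" using S(1) by blast
          thus "(\<Phi> has_field_derivative \<phi> \<xi>) (at \<xi> within S)"
            by (rule DERIV_subset[OF \<Phi>[OF S(1)[OF \<open>\<xi> \<in> S\<close>]]])
        qed (auto simp: S_def)
        also have "\<dots> \<le> (c + \<epsilon> / 2) * (LINT x:{s..t}|lborel. k x)"
          using rk[of s t] st \<epsilon> by (intro mult_left_mono) (auto simp: c_def)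
        also have "\<dots> = (LINT x:{s..t}|lborel. (c + \<epsilon> / 2) * k x)" by simp
        also have "\<dots> \<le> (LINT x:{s..t}|lborel. q x)"
        proof (rule set_integral_mono)
          fix y assume y: "y \<in> {s..t}"
          have "dist (\<phi> (r y)) (\<phi> (r x)) < \<epsilon> / 2" using near[OF y] by (intro d1)
          hence "c + \<epsilon> / 2 \<le> \<bar>\<phi> (r y)\<bar> + \<epsilon>" unfolding c_def dist_real_def by linarith
          thus "(c + \<epsilon> / 2) * k y \<le> q y" unfolding q_def by (intro mult_right_mono k)
        qed (use i in auto)
        finally show ?thesis by simp
      qed
      thus "\<exists>d>0. \<forall>s t. s \<le> x \<and> x \<le> t \<and> t - s < d \<longrightarrow> P s t" using d(1) unfolding P_def by blast
    qed
    thus ?thesis using ab by (simp add: q_def P_def)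
  qed
  have eq: "(LINT x:{a..b}|lborel. (\<bar>\<phi> (r x)\<bar> + \<epsilon>) * k x) = (LINT x:{a..b}|lborel. \<bar>\<phi> (r x)\<bar> * k x) + \<epsilon> * (LINT x:{a..b}|lborel. k x)" for \<epsilon>
    using set_integral_add(2)[OF int set_integrable_mult_right[of \<epsilon>, OF k(1)]] by (simp add: distrib_right)
  have K0: "0 \<le> (LINT x:{a..b}|lborel. k x)" using rk[of a b] ab by auto
  show "\<bar>\<Phi> (r b) - \<Phi> (r a)\<bar> \<le> (LINT x:{a..b}|lborel. \<bar>\<phi> (r x)\<bar> * k x)"
  proof (rule field_le_epsilon)
    fix e :: real assume e: "e > 0"
    let ?K = "LINT x:{a..b}|lborel. k x"
    have "\<bar>\<Phi> (r b) - \<Phi> (r a)\<bar> \<le> (LINT x:{a..b}|lborel. \<bar>\<phi> (r x)\<bar> * k x) + e / (?K + 1) * ?K"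
      using main[of "e / (?K + 1)"] eq[of "e / (?K + 1)"] e K0 by simp
    also have "e / (?K + 1) * ?K \<le> e" using e K0 by (simp add: field_simps)
    finally show "\<bar>\<Phi> (r b) - \<Phi> (r a)\<bar> \<le> (LINT x:{a..b}|lborel. \<bar>\<phi> (r x)\<bar> * k x) + e" by simp
  qed
qed

text \<open>
  What the modulus \<open>r\<close> of a Sobolev function and the modulus \<open>k\<close> of its weak derivative satisfy. The lower
  bounds for the action are proved for such pairs, so that they also apply to multiples \<open>t r\<close>, \<open>t k\<close>.
\<close>

definition profile :: "(real \<Rightarrow> real) \<Rightarrow> (real \<Rightarrow> real) \<Rightarrow> bool" where
  "profile r k \<longleftrightarrow> continuous_on {0..} r \<and> (\<forall>x\<ge>0. 0 \<le> r x) \<and> (\<forall>x. 0 \<le> k x) \<and>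
     set_borel_measurable lborel {0<..} k \<and>
     set_integrable lborel {0<..} (\<lambda>x. (r x)\<^sup>2) \<and> set_integrable lborel {0<..} (\<lambda>x. (k x)\<^sup>2) \<and>
     (\<forall>T. set_integrable lborel {0..T} k) \<and>
     (\<forall>s t. 0 \<le> s \<longrightarrow> s \<le> t \<longrightarrow> \<bar>r t - r s\<bar> \<le> (LINT x:{s..t}|lborel. k x))"

lemma profile_set_integrable_mult:
  assumes pr: "profile r k" and h: "continuous_on {0..} h" "\<And>x. 0 \<le> x \<Longrightarrow> \<bar>h x\<bar> \<le> C * r x"
  shows "set_integrable lborel {0<..} (\<lambda>x. h x * k x)" "set_integrable lborel {0<..} (\<lambda>x. (h x)\<^sup>2)"
proof -
  have ri: "set_integrable lborel {0<..} (\<lambda>x. C\<^sup>2 * (r x)\<^sup>2)" "set_integrable lborel {0<..} (\<lambda>x. (k x)\<^sup>2)"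
    and km: "set_borel_measurable lborel {0<..} k"
    using pr by (auto simp: profile_def)
  have hm: "set_borel_measurable lborel {0<..} h" by (rule continuous_on_imp_set_measurable[OF h(1)])
  have hC: "(h x)\<^sup>2 \<le> C\<^sup>2 * (r x)\<^sup>2" if "0 \<le> x" for x
    using power_mono[OF h(2)[OF that] abs_ge_zero, of 2] by (simp add: power_mult_distrib)
  have "(\<lambda>x. (indicator {0<..} x *\<^sub>R h x) * (indicator {0<..} x *\<^sub>R k x)) \<in> borel_measurable lborel"
    by (rule borel_measurable_times) (use hm km in \<open>auto simp: set_borel_measurable_def\<close>)
  also have "(\<lambda>x. (indicator {0<..} x *\<^sub>R h x) * (indicator {0<..} x *\<^sub>R k x)) = (\<lambda>x. indicator {0<..} x *\<^sub>R (h x * k x))"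
    by (auto simp: fun_eq_iff split: split_indicator)
  finally have m: "set_borel_measurable lborel {0<..} (\<lambda>x. h x * k x)" by (simp add: set_borel_measurable_def)
  show "set_integrable lborel {0<..} (\<lambda>x. h x * k x)"
  proof (rule set_integrable_bound[OF set_integral_add(1)[OF ri] m], intro AE_I2 impI)
    fix x :: real assume "x \<in> {0<..}"
    hence "(h x)\<^sup>2 \<le> C\<^sup>2 * (r x)\<^sup>2" using hC by simp
    moreover have "2 * \<bar>h x * k x\<bar> \<le> (h x)\<^sup>2 + (k x)\<^sup>2"
      using sum_squares_bound[of "\<bar>h x\<bar>" "\<bar>k x\<bar>"] by (simp add: abs_mult)
    moreover have "0 \<le> \<bar>h x * k x\<bar>" by simp
    ultimately have "\<bar>h x * k x\<bar> \<le> C\<^sup>2 * (r x)\<^sup>2 + (k x)\<^sup>2" by linarith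
    thus "norm (h x * k x) \<le> norm (C\<^sup>2 * (r x)\<^sup>2 + (k x)\<^sup>2)" by simp
  qed
  have m2: "set_borel_measurable lborel {0<..} (\<lambda>x. (h x)\<^sup>2)"
    by (rule continuous_on_imp_set_measurable) (intro continuous_intros h)
  show "set_integrable lborel {0<..} (\<lambda>x. (h x)\<^sup>2)"
    by (rule set_integrable_bound[OF ri(1) m2]) (use hC in \<open>auto intro!: AE_I2\<close>)
qed

lemma profile_local_integral_le:
  fixes h :: "real \<Rightarrow> real"
  assumes "set_integrable lborel {0<..} h" "\<And>x. 0 < x \<Longrightarrow> 0 \<le> h x" "0 \<le> a"
  shows "(LINT x:{a..b}|lborel. h x) \<le> (HINT x. h x)"
  unfolding set_integral_Icc_eq_Ioc
  by (rule set_integral_mono_set[OF assms(1)]) (use assms in auto)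

lemma tail_integral_tendsto_0:
  fixes h :: "real \<Rightarrow> real"
  assumes "set_integrable lborel {0<..} h"
  shows "((\<lambda>x. LINT y:{x<..}|lborel. h y) \<longlongrightarrow> 0) at_top"
proof -
  have "((\<lambda>y. LINT x|lborel. indicator {..y} x *\<^sub>R (indicator {0<..} x *\<^sub>R h x)) \<longlongrightarrow> (LINT x|lborel. indicator {0<..} x *\<^sub>R h x)) at_top"
    by (rule tendsto_integral_at_top) (use assms in \<open>auto simp: set_integrable_def\<close>)
  hence "((\<lambda>y. (LINT x|lborel. indicator {0<..} x *\<^sub>R h x) - (LINT x|lborel. indicator {..y} x *\<^sub>R (indicator {0<..} x *\<^sub>R h x))) \<longlongrightarrow>
     (LINT x|lborel. indicator {0<..} x *\<^sub>R h x) - (LINT x|lborel. indicator {0<..} x *\<^sub>R h x)) at_top"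
    by (intro tendsto_intros)
  moreover have "eventually (\<lambda>y. (LINT x|lborel. indicator {0<..} x *\<^sub>R h x) - (LINT x|lborel. indicator {..y} x *\<^sub>R (indicator {0<..} x *\<^sub>R h x))
      = (LINT x:{y<..}|lborel. h x)) at_top"
    using eventually_ge_at_top[of 0]
  proof eventually_elim
    case (elim y)
    have "(LINT x:{0<..y} \<union> {y<..}|lborel. h x) = (LINT x:{0<..y}|lborel. h x) + (LINT x:{y<..}|lborel. h x)"
      by (rule set_integral_Un) (use elim in \<open>auto intro!: set_integrable_subset[OF assms]\<close>)
    moreover have "{0<..y} \<union> {y<..} = {0<..}" using elim by auto
    moreover have "(LINT x|lborel. indicator {..y} x *\<^sub>R (indicator {0<..} x *\<^sub>R h x)) = (LINT x:{0<..y}|lborel. h x)"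
      unfolding set_lebesgue_integral_def
      by (rule Bochner_Integration.integral_cong) (auto split: split_indicator)
    ultimately show ?case by (simp add: set_lebesgue_integral_def)
  qed
  ultimately show ?thesis by (simp add: filterlim_cong)
qed

text \<open>
  The square of \<open>r\<close> has derivative at most \<open>2 * r * k\<close>, which is integrable, and \<open>r\<close> comes arbitrarily close to 0
  far out. So the square at \<open>x\<close> is bounded by the integral of \<open>2 * r * k\<close> beyond \<open>x\<close>.
\<close>

lemma profile_tendsto_0:
  assumes pr: "profile r k"
  shows "(r \<longlongrightarrow> 0) at_top"
proof -
  have cont: "continuous_on {0..} r" and r0: "\<And>x. 0 \<le> x \<Longrightarrow> 0 \<le> r x" and k0: "\<And>x. 0 \<le> k x"
    and r2: "set_integrable lborel {0<..} (\<lambda>x. (r x)\<^sup>2)" and kT: "\<And>T. set_integrable lborel {0..T} k"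
    and rk: "\<And>s t. 0 \<le> s \<Longrightarrow> s \<le> t \<Longrightarrow> \<bar>r t - r s\<bar> \<le> (LINT x:{s..t}|lborel. k x)"
    using pr by (auto simp: profile_def)
  have i: "set_integrable lborel {0<..} (\<lambda>x. (2 * r x) * k x)"
    by (rule profile_set_integrable_mult[OF pr, of _ 2]) (use r0 in \<open>auto intro!: continuous_intros cont\<close>)
  have bound: "(r x)\<^sup>2 \<le> (LINT y:{x<..}|lborel. (2 * r y) * k y)" if x: "x \<ge> 0" for x
  proof (rule field_le_epsilon)
    fix e :: real assume e: "e > 0"
    (* A square integrable function cannot stay above a positive level. *)
    have "\<exists>y\<ge>x. (r y)\<^sup>2 < e"
    proof (rule ccontr)
      assume n: "\<not> (\<exists>y\<ge>x. (r y)\<^sup>2 < e)"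
      obtain N :: nat where N: "(HINT x. (r x)\<^sup>2) < real N * e" using e reals_Archimedean3 by blast
      have "real N * e = (LINT y:{x..x + real N}|lborel. e)"
        by (simp add: set_lebesgue_integral_def)
      also have "\<dots> \<le> (LINT y:{x..x + real N}|lborel. (r y)\<^sup>2)"
      proof (rule set_integral_mono)
        show "set_integrable lborel {x..x + real N} (\<lambda>y. e)" by (intro borel_integrable_atLeastAtMost' continuous_intros)
        show "set_integrable lborel {x..x + real N} (\<lambda>y. (r y)\<^sup>2)"
          by (intro borel_integrable_atLeastAtMost' continuous_intros continuous_on_subset[OF cont]) (use x in auto)
      qed (use n in \<open>auto simp: not_less\<close>)
      also have "\<dots> \<le> (HINT x. (r x)\<^sup>2)"
        by (rule profile_local_integral_le[OF r2]) (use x in auto)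
      finally show False using N by simp
    qed
    then obtain y where y: "y \<ge> x" "(r y)\<^sup>2 < e" by blast
    have cxy: "continuous_on {x..y} r" using continuous_on_subset[OF cont] x by auto
    obtain hi where hi: "\<And>z. z \<in> {x..y} \<Longrightarrow> r z \<le> hi"
      using compact_imp_bounded[OF compact_continuous_image[OF cxy]] unfolding bounded_real
      by (metis compact_Icc imageI abs_le_D1)
    have "\<bar>(r y)\<^sup>2 - (r x)\<^sup>2\<bar> \<le> (LINT z:{x..y}|lborel. \<bar>2 * r z\<bar> * k z)"
    proof (rule chain_rule_bound(2)[where lo = 0 and hi = hi])
      show "set_integrable lborel {x..y} k" by (rule set_integrable_subset[OF kT[of y]]) (use x in auto)
    qed (use x y hi r0 k0 rk cxy in \<open>auto intro!: derivative_eq_intros continuous_intros\<close>)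
    also have "\<dots> = (LINT z:{x..y}|lborel. (2 * r z) * k z)"
      by (rule set_lebesgue_integral_cong) (use r0 x in auto)
    also have "\<dots> \<le> (LINT z:{x<..}|lborel. (2 * r z) * k z)"
      unfolding set_integral_Icc_eq_Ioc
      by (rule set_integral_mono_set) (use x r0 k0 in \<open>auto intro!: set_integrable_subset[OF i]\<close>)
    finally show "(r x)\<^sup>2 \<le> (LINT y:{x<..}|lborel. (2 * r y) * k y) + e" using y by linarith
  qed
  have "((\<lambda>x. (r x)\<^sup>2) \<longlongrightarrow> 0) at_top"
  proof (rule tendsto_sandwich[OF _ _ tendsto_const tail_integral_tendsto_0[OF i]])
    show "eventually (\<lambda>x. (r x)\<^sup>2 \<le> (LINT y:{x<..}|lborel. (2 * r y) * k y)) at_top"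
      using eventually_ge_at_top[of 0] by eventually_elim (rule bound)
  qed auto
  hence "((\<lambda>x. sqrt ((r x)\<^sup>2)) \<longlongrightarrow> sqrt 0) at_top" by (rule tendsto_real_sqrt)
  thus ?thesis by (simp add: tendsto_rabs_zero_iff)
qed

lemma profile_attains_sup:
  assumes pr: "profile r k"
  obtains x0 where "0 \<le> x0" "\<And>x. 0 \<le> x \<Longrightarrow> r x \<le> r x0"
proof (cases "\<exists>x1\<ge>0. r x1 > 0")
  case True
  have cont: "continuous_on {0..} r" using pr by (auto simp: profile_def)
  from True obtain x1 where x1: "x1 \<ge> 0" "r x1 > 0" by blast
  have "eventually (\<lambda>x. r x < r x1) at_top" using profile_tendsto_0[OF pr] x1 by (intro order_tendstoD)
  then obtain T where T: "\<And>x. x \<ge> T \<Longrightarrow> r x < r x1" by (auto simp: eventually_at_top_linorder)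
  have "continuous_on {0..max T x1} r" by (rule continuous_on_subset[OF cont]) auto
  then obtain x0 where x0: "x0 \<in> {0..max T x1}" "\<And>x. x \<in> {0..max T x1} \<Longrightarrow> r x \<le> r x0"
    using continuous_attains_sup[of "{0..max T x1}" r] x1 by fastforce
  have "r x \<le> r x0" if "0 \<le> x" for x
  proof (cases "x \<le> max T x1")
    case True thus ?thesis using x0 that by auto
  next
    case False
    hence "r x < r x1" using T by auto
    also have "r x1 \<le> r x0" using x0 x1 by auto
    finally show ?thesis by simp
  qed
  thus ?thesis using x0 that by auto
next
  case False
  hence "r x \<le> r 0" if "0 \<le> x" for x
    using pr that by (auto simp: profile_def not_less intro: order_trans[of _ 0])
  thus ?thesis using that[of 0] by auto
qed

text \<open>
  The integral of \<open>f r * k\<close> dominates the variation of \<open>F r\<close>: once on the way from the origin to a point \<open>x0\<close>, and once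
  more on the way from \<open>x0\<close> to infinity, where \<open>r\<close> tends to 0.
\<close>

lemma calibration_bounds:
  assumes pr: "profile r k" and M: "\<And>x. 0 \<le> x \<Longrightarrow> r x \<le> M"
    and F: "\<And>s. s \<in> {0..M} \<Longrightarrow> (F has_real_derivative f s) (at s within {0..M})"
    and f: "continuous_on {0..M} f" "\<And>s. s \<in> {0..M} \<Longrightarrow> 0 \<le> f s" "\<And>s. s \<in> {0..M} \<Longrightarrow> f s \<le> C * s"
  shows "set_integrable lborel {0<..} (\<lambda>x. f (r x) * k x)" "set_integrable lborel {0<..} (\<lambda>x. (f (r x))\<^sup>2)"
    and "\<And>x0. 0 \<le> x0 \<Longrightarrow> (F (r x0) - F (r 0)) + (F (r x0) - F 0) \<le> (HINT x. f (r x) * k x)"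
proof -
  have cont: "continuous_on {0..} r" and r0: "\<And>x. 0 \<le> x \<Longrightarrow> 0 \<le> r x" and k0: "\<And>x. 0 \<le> k x"
    and kT: "\<And>T. set_integrable lborel {0..T} k"
    and rk: "\<And>s t. 0 \<le> s \<Longrightarrow> s \<le> t \<Longrightarrow> \<bar>r t - r s\<bar> \<le> (LINT x:{s..t}|lborel. k x)"
    using pr by (auto simp: profile_def)
  have cf: "continuous_on {0..} (\<lambda>x. f (r x))"
    by (rule continuous_on_compose2[OF f(1) cont]) (use r0 M in auto)
  have i: "set_integrable lborel {0<..} (\<lambda>x. f (r x) * k x)" and i2: "set_integrable lborel {0<..} (\<lambda>x. (f (r x))\<^sup>2)"
    by (rule profile_set_integrable_mult[OF pr cf, of C], use f r0 M in force)+
  show "set_integrable lborel {0<..} (\<lambda>x. f (r x) * k x)" "set_integrable lborel {0<..} (\<lambda>x. (f (r x))\<^sup>2)"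
    by (fact i, fact i2)
  have step: "\<bar>F (r y) - F (r x)\<bar> \<le> (LINT z:{x..y}|lborel. f (r z) * k z)" if "0 \<le> x" "x \<le> y" for x y
  proof -
    have "\<bar>F (r y) - F (r x)\<bar> \<le> (LINT z:{x..y}|lborel. \<bar>f (r z)\<bar> * k z)"
    proof (rule chain_rule_bound(2)[where lo = 0 and hi = M])
      show "set_integrable lborel {x..y} k" by (rule set_integrable_subset[OF kT[of y]]) (use that in auto)
    qed (use that r0 M k0 rk F f continuous_on_subset[OF cont] in auto)
    also have "\<dots> = (LINT z:{x..y}|lborel. f (r z) * k z)"
      by (rule set_lebesgue_integral_cong) (use r0 M f that in auto)
    finally show ?thesis .
  qed
  have nn: "0 \<le> f (r x) * k x" if "0 < x" for x using f r0 M k0 that by auto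
  have "0 \<le> M" using r0[of 0] M[of 0] by simp
  have cF: "continuous_on {0..M} F"
    using F unfolding continuous_on_eq_continuous_within by (blast intro: DERIV_continuous)
  have rM: "eventually (\<lambda>x. r x \<in> {0..M}) at_top"
    using eventually_ge_at_top[of 0] by eventually_elim (use r0 M in auto)
  have lim: "((\<lambda>T. F (r T)) \<longlongrightarrow> F 0) at_top"
  proof (rule continuous_on_tendsto_compose[OF cF profile_tendsto_0[OF pr]])
  qed (use \<open>0 \<le> M\<close> rM in auto)
  show "(F (r x0) - F (r 0)) + (F (r x0) - F 0) \<le> (HINT x. f (r x) * k x)" if x0: "0 \<le> x0" for x0
  proof (rule tendsto_upperbound)
    show "((\<lambda>T. (F (r x0) - F (r 0)) + (F (r x0) - F (r T))) \<longlongrightarrow> (F (r x0) - F (r 0)) + (F (r x0) - F 0)) at_top"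
      by (intro tendsto_intros lim)
    show "eventually (\<lambda>T. (F (r x0) - F (r 0)) + (F (r x0) - F (r T)) \<le> (HINT x. f (r x) * k x)) at_top"
      using eventually_ge_at_top[of x0]
    proof eventually_elim
      case (elim T)
      have "set_integrable lborel {0..T} (\<lambda>x. f (r x) * k x)"
        unfolding set_integrable_Icc_iff_Ioc by (rule set_integrable_subset[OF i]) auto
      hence "(LINT x:{0..T}|lborel. f (r x) * k x) = (LINT x:{0..x0}|lborel. f (r x) * k x) + (LINT x:{x0..T}|lborel. f (r x) * k x)"
        by (rule set_integral_Icc_combine) (use x0 elim in auto)
      moreover have "(LINT x:{0..T}|lborel. f (r x) * k x) \<le> (HINT x. f (r x) * k x)"
        by (rule profile_local_integral_le[OF i nn]) auto
      ultimately show ?case using step[of 0 x0] step[of x0 T] x0 elim by linarith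
    qed
  qed simp
qed

lemma completed_square_integral:
  assumes pr: "profile r k"
    and "set_integrable lborel {0<..} (\<lambda>x. f (r x) * k x)" "set_integrable lborel {0<..} (\<lambda>x. (f (r x))\<^sup>2)"
  shows "set_integrable lborel {0<..} (\<lambda>x. (k x - f (r x))\<^sup>2)"
    and "(HINT x. (k x)\<^sup>2) + (HINT x. (f (r x))\<^sup>2) =
       2 * (HINT x. f (r x) * k x) + (HINT x. (k x - f (r x))\<^sup>2)"
proof -
  have k: "set_integrable lborel {0<..} (\<lambda>x. (k x)\<^sup>2)" using pr by (simp add: profile_def)
  have eq: "(\<lambda>x. (k x - f (r x))\<^sup>2) = (\<lambda>x. ((k x)\<^sup>2 + (f (r x))\<^sup>2) - 2 * (f (r x) * k x))"
    by (auto simp: fun_eq_iff power2_eq_square algebra_simps)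
  have i: "set_integrable lborel {0<..} (\<lambda>x. (k x)\<^sup>2 + (f (r x))\<^sup>2)" "set_integrable lborel {0<..} (\<lambda>x. 2 * (f (r x) * k x))"
    using k assms by (auto intro: set_integral_add)
  show "set_integrable lborel {0<..} (\<lambda>x. (k x - f (r x))\<^sup>2)" unfolding eq by (rule set_integral_diff(1)[OF i])
  show "(HINT x. (k x)\<^sup>2) + (HINT x. (f (r x))\<^sup>2) =
       2 * (HINT x. f (r x) * k x) + (HINT x. (k x - f (r x))\<^sup>2)"
    unfolding eq set_integral_diff(2)[OF i] set_integral_add(2)[OF k assms(3)] by simp
qed

lemma profile_powr_integrable:
  assumes pr: "profile r k" and q: "q \<ge> 2"
  shows "set_integrable lborel {0<..} (\<lambda>x. r x powr q)"
proof -
  obtain x0 where x0: "0 \<le> x0" "\<And>x. 0 \<le> x \<Longrightarrow> r x \<le> r x0" using profile_attains_sup[OF pr] by metis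
  have cont: "continuous_on {0..} r" and r0: "\<And>x. 0 \<le> x \<Longrightarrow> 0 \<le> r x"
    and r2: "set_integrable lborel {0<..} (\<lambda>x. r x0 powr (q - 2) * (r x)\<^sup>2)"
    using pr by (auto simp: profile_def)
  have "continuous_on {0..} (\<lambda>x. r x powr q)"
    using q r0 by (intro continuous_on_powr' cont continuous_intros) auto
  hence m: "set_borel_measurable lborel {0<..} (\<lambda>x. r x powr q)" by (rule continuous_on_imp_set_measurable)
  show ?thesis
  proof (rule set_integrable_bound[OF r2 m], intro AE_I2 impI)
    fix x :: real assume "x \<in> {0<..}"
    hence x: "0 \<le> r x" "r x \<le> r x0" using r0 x0 by auto
    have "r x powr q = r x powr (q - 2) * (r x)\<^sup>2"
      by (cases "r x = 0") (use x in \<open>auto simp: powr_diff powr_numeral\<close>)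
    also have "\<dots> \<le> r x0 powr (q - 2) * (r x)\<^sup>2"
      using x q by (intro mult_right_mono powr_mono2) auto
    finally show "norm (r x powr q) \<le> norm (r x0 powr (q - 2) * (r x)\<^sup>2)" by simp
  qed
qed

text \<open>
  The reverse triangle inequality transfers the bound on increments from \<open>v\<close> to its modulus.
\<close>

lemma H1_rep_profile:
  assumes "H1_rep v g"
  shows "profile (\<lambda>x. norm (v x)) (\<lambda>x. norm (g x))"
proof -
  have v: "L2_on {0<..} v" and g: "L2_on {0<..} g" using assms unfolding H1_rep_def by blast+
  have gT: "set_integrable lborel {0..T} g" for T using L2_on_loc_int[OF g] by (simp add: loc_int_def)
  have nT: "set_integrable lborel {a..b} (\<lambda>x. norm (g x))" if "0 \<le> a" for a b
    using loc_intD[OF that L2_on_loc_int[OF g]] integrable_norm unfolding set_integrable_def by fastforce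
  have m: "set_borel_measurable lborel {0<..} (\<lambda>x. norm (g x))"
  proof -
    have "(\<lambda>x. indicator {0<..} x *\<^sub>R g x) \<in> borel_measurable lborel"
      using g by (simp add: L2_on_def set_borel_measurable_def)
    hence "(\<lambda>x. norm (indicator {0<..} x *\<^sub>R g x)) \<in> borel_measurable lborel" by measurable
    thus ?thesis by (simp add: set_borel_measurable_def)
  qed
  have "\<bar>norm (v t) - norm (v s)\<bar> \<le> (LINT x:{s..t}|lborel. norm (g x))" if "0 \<le> s" "s \<le> t" for s t
  proof -
    have "\<bar>norm (v t) - norm (v s)\<bar> \<le> norm (v t - v s)" by (rule norm_triangle_ineq3)
    also have "\<dots> \<le> (LINT x:{s..t}|lborel. norm (g x))"
      unfolding H1_rep_increment[OF assms that]
      by (rule set_integral_norm_bound) (rule loc_intD[OF that(1) L2_on_loc_int[OF g]])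
    finally show ?thesis .
  qed
  thus ?thesis
    unfolding profile_def using v g nT[of 0] m H1_rep_continuous[OF assms]
    by (auto simp: L2_on_def intro!: continuous_intros)
qed

section \<open>Both half-lines\<close>

lemma AE_lborel_reflect:
  fixes P :: "real \<Rightarrow> bool"
  assumes "AE x in lborel. P x"
  shows "AE x in lborel. P (- x)"
proof -
  obtain N where N: "N \<in> null_sets lborel" "{x. \<not> P x} \<subseteq> N"
    using assms unfolding eventually_ae_filter by auto
  have "AE x in lborel. (- x) \<notin> N"
    using AE_borel_affine[of "-1" "\<lambda>x. x \<notin> N" 0] AE_not_in[OF N(1)] N(1) by (auto simp: null_sets_def)
  thus ?thesis by eventually_elim (use N(2) in auto)
qed

lemma set_borel_measurable_reflect:
  assumes "set_borel_measurable lborel A (f :: real \<Rightarrow> 'a :: real_normed_vector)"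
  shows "set_borel_measurable lborel {x. - x \<in> A} (\<lambda>x. f (- x))"
proof -
  have "(\<lambda>x. indicator A x *\<^sub>R f x) \<in> borel_measurable borel"
    using assms by (simp add: set_borel_measurable_def)
  from measurable_compose[OF borel_measurable_uminus[OF measurable_ident] this]
  have "(\<lambda>x. indicator A (- x) *\<^sub>R f (- x)) \<in> borel_measurable borel" by simp
  also have "(\<lambda>x. indicator A (- x) *\<^sub>R f (- x)) = (\<lambda>x. indicator {x. - x \<in> A} x *\<^sub>R f (- x))"
    by (auto simp: fun_eq_iff split: split_indicator)
  finally show ?thesis by (simp add: set_borel_measurable_def)
qed

lemma set_integrable_reflect:
  fixes f :: "real \<Rightarrow> 'a :: {banach, second_countable_topology}"
  assumes "set_integrable lborel A f"
  shows "set_integrable lborel {x. - x \<in> A} (\<lambda>x. f (- x))"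
proof -
  have "integrable lborel (\<lambda>x. indicator A (0 + (- 1) * x) *\<^sub>R f (0 + (- 1) * x))"
    using assms unfolding set_integrable_def by (intro lborel_integrable_real_affine) auto
  also have "(\<lambda>x. indicator A (0 + (- 1) * x) *\<^sub>R f (0 + (- 1) * x)) = (\<lambda>x. indicator {x. - x \<in> A} x *\<^sub>R f (- x))"
    by (auto simp: fun_eq_iff split: split_indicator)
  finally show ?thesis by (simp add: set_integrable_def)
qed

lemma L2_on_reflect:
  assumes "L2_on A f" shows "L2_on {x. - x \<in> A} (\<lambda>x. f (- x))"
  using assms set_borel_measurable_reflect set_integrable_reflect[of A "\<lambda>x. (norm (f x))\<^sup>2"]
  unfolding L2_on_def by blast

lemma test_function_reflect:
  assumes "test_function A \<psi>" shows "test_function {x. - x \<in> A} (\<lambda>x. \<psi> (- x))"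
proof -
  obtain K where K: "compact K" "K \<subseteq> A" "\<And>x. x \<notin> K \<Longrightarrow> \<psi> x = 0" and sm: "smooth \<psi>"
    using assms unfolding test_function_def smooth_def by blast
  have "compact (uminus ` K)" using K(1) by (rule compact_negations)
  moreover have "uminus ` K \<subseteq> {x. - x \<in> A}" using K(2) by auto
  moreover have "\<psi> (- x) = 0" if "x \<notin> uminus ` K" for x
    using that K(3)[of "- x"] by (metis image_eqI minus_minus)
  ultimately show ?thesis using smooth_reflect[OF sm] unfolding test_function_def smooth_def by blast
qed

lemma is_weak_deriv_reflect:
  assumes "is_weak_deriv A u g"
  shows "is_weak_deriv {x. - x \<in> A} (\<lambda>x. u (- x)) (\<lambda>x. - g (- x))"
  unfolding is_weak_deriv_def
proof (intro allI impI)
  fix \<psi> assume t: "test_function {x. - x \<in> A} \<psi>"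
  define \<rho> where "\<rho> = (\<lambda>x. \<psi> (- x))"
  have t\<rho>: "test_function A \<rho>" using test_function_reflect[OF t] by (simp add: \<rho>_def)
  have d: "deriv \<rho> x = - deriv \<psi> (- x)" for x
  proof -
    have "(\<psi> has_real_derivative deriv \<psi> (- x)) (at (- x))"
      using t by (intro smooth_has_derivative) (simp add: test_function_def smooth_def)
    hence "(\<rho> has_real_derivative deriv \<psi> (- x) * - 1) (at x)"
      unfolding \<rho>_def by (rule DERIV_chain2[where g = uminus]) (auto intro!: derivative_eq_intros)
    thus ?thesis by (simp add: DERIV_imp_deriv)
  qed
  have "(LINT x:{x. - x \<in> A}|lborel. deriv \<psi> x *\<^sub>R u (- x)) = (LINT x:A|lborel. deriv \<psi> (- x) *\<^sub>R u x)"
    using set_integral_reflect[of A "\<lambda>x. deriv \<psi> (- x) *\<^sub>R u x"] by simp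
  also have "\<dots> = (LINT x:A|lborel. - (deriv \<rho> x *\<^sub>R u x))" by (simp add: d)
  also have "\<dots> = - (LINT x:A|lborel. deriv \<rho> x *\<^sub>R u x)"
    unfolding set_lebesgue_integral_def by (subst integral_minus[symmetric]) simp
  also have "\<dots> = (LINT x:A|lborel. \<rho> x *\<^sub>R g x)"
    using assms t\<rho> by (simp add: is_weak_deriv_def)
  also have "\<dots> = (LINT x:{x. - x \<in> A}|lborel. \<psi> x *\<^sub>R g (- x))"
    using set_integral_reflect[of A "\<lambda>x. \<rho> x *\<^sub>R g x"] by (simp add: \<rho>_def)
  also have "\<dots> = - (LINT x:{x. - x \<in> A}|lborel. \<psi> x *\<^sub>R (- g (- x)))"
    unfolding set_lebesgue_integral_def by (subst integral_minus[symmetric]) simp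
  finally show "(LINT x:{x. - x \<in> A}|lborel. deriv \<psi> x *\<^sub>R u (- x)) = - (LINT x:{x. - x \<in> A}|lborel. \<psi> x *\<^sub>R (- g (- x)))" .
qed

lemma L2_on_uminus: "L2_on A f \<Longrightarrow> L2_on A (\<lambda>x. - f x)"
  unfolding L2_on_def set_borel_measurable_def by simp

lemma H1_on_reflect:
  assumes "H1_on A u" shows "H1_on {x. - x \<in> A} (\<lambda>x. u (- x))"
  using assms L2_on_reflect is_weak_deriv_reflect L2_on_uminus unfolding H1_on_def by blast

lemma reflect_halflines: "{x::real. - x \<in> {..<0}} = {0<..}" "{x::real. - x \<in> {0<..}} = {..<0}"
  by auto

lemma trace0_reflect_aux:
  fixes u :: "real \<Rightarrow> complex"
  assumes "continuous_on A v" "AE x in lborel. x \<in> A \<longrightarrow> v x = u x" "(v \<longlongrightarrow> l) (at 0 within A)"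
  shows "continuous_on {x. - x \<in> A} (\<lambda>x. v (- x))" "AE x in lborel. x \<in> {x. - x \<in> A} \<longrightarrow> v (- x) = u (- x)"
    "((\<lambda>x. v (- x)) \<longlongrightarrow> l) (at 0 within {x. - x \<in> A})"
proof -
  show "continuous_on {x. - x \<in> A} (\<lambda>x. v (- x))"
    by (rule continuous_on_compose2[OF assms(1)]) (auto intro!: continuous_intros)
  show "AE x in lborel. x \<in> {x. - x \<in> A} \<longrightarrow> v (- x) = u (- x)" using AE_lborel_reflect[OF assms(2)] by simp
  have "filterlim uminus (at 0 within A) (at 0 within {x. - x \<in> A})"
    unfolding filterlim_at using tendsto_minus[OF tendsto_ident_at, of 0 "{x. - x \<in> A}"]
    by (auto simp: eventually_at_filter)
  from filterlim_compose[OF assms(3) this] show "((\<lambda>x. v (- x)) \<longlongrightarrow> l) (at 0 within {x. - x \<in> A})" .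
qed

lemma trace0_reflect: "trace0 {..<0} u = trace0 {0<..} (\<lambda>x. u (- x))"
proof -
  have "(\<exists>v. continuous_on {..<0} v \<and> (AE x in lborel. x \<in> {..<0} \<longrightarrow> v x = u x) \<and> (v \<longlongrightarrow> l) (at 0 within {..<0})) \<longleftrightarrow>
    (\<exists>v. continuous_on {0<..} v \<and> (AE x in lborel. x \<in> {0<..} \<longrightarrow> v x = u (- x)) \<and> (v \<longlongrightarrow> l) (at 0 within {0<..}))" (is "?L = ?R") for l
  proof
    assume ?L
    thus ?R using trace0_reflect_aux[of "{..<0}" _ u l, unfolded reflect_halflines] by blast
  next
    assume ?R
    thus ?L using trace0_reflect_aux[of "{0<..}" _ "\<lambda>x. u (- x)" l, unfolded reflect_halflines minus_minus] by blast
  qed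
  thus ?thesis unfolding trace0_def by simp
qed

text \<open>
  Representatives of \<open>u\<close> on the two half-lines, the left one reflected to the right half-line. The measurability
  of \<open>u\<close> makes the correspondence with \<open>H1_split\<close> exact.
\<close>

definition split_rep :: "(real \<Rightarrow> complex) \<Rightarrow> (real \<Rightarrow> complex) \<Rightarrow> (real \<Rightarrow> complex) \<Rightarrow> (real \<Rightarrow> complex) \<Rightarrow> (real \<Rightarrow> complex) \<Rightarrow> bool" where
  "split_rep u vl gl vr gr \<longleftrightarrow> set_borel_measurable lborel {..<0} u \<and> set_borel_measurable lborel {0<..} u \<and>
     H1_rep vl gl \<and> H1_rep vr gr \<and>
     (AE x in lborel. 0 < x \<longrightarrow> u (- x) = vl x) \<and> (AE x in lborel. 0 < x \<longrightarrow> u x = vr x)"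

lemma H1_split_imp_split_rep:
  assumes "u \<in> H1_split"
  obtains vl gl vr gr where "split_rep u vl gl vr gr"
proof -
  have u: "H1_on {..<0} u" "H1_on {0<..} u" using assms by (auto simp: H1_split_def)
  have "H1_on {0<..} (\<lambda>x. u (- x))" using H1_on_reflect[OF u(1)] unfolding reflect_halflines .
  then obtain vl gl where "H1_rep vl gl" "AE x in lborel. 0 < x \<longrightarrow> u (- x) = vl x"
    by (rule H1_on_halfline_imp_rep)
  moreover obtain vr gr where "H1_rep vr gr" "AE x in lborel. 0 < x \<longrightarrow> u x = vr x"
    using u(2) by (rule H1_on_halfline_imp_rep)
  ultimately show ?thesis using u that[of vl gl vr gr] unfolding split_rep_def H1_on_def L2_on_def by blast
qed

lemma set_borel_measurable_norm_compose:
  assumes "set_borel_measurable lborel A (u :: real \<Rightarrow> complex)" "A \<in> sets borel" and h: "(h :: real \<Rightarrow> real) \<in> borel_measurable borel"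
  shows "set_borel_measurable lborel A (\<lambda>x. h (norm (u x)))"
proof -
  have "(\<lambda>x. indicator A x *\<^sub>R u x) \<in> borel_measurable lborel" using assms by (simp add: set_borel_measurable_def)
  hence "(\<lambda>x. h (norm (indicator A x *\<^sub>R u x))) \<in> borel_measurable lborel"
    by (rule measurable_compose[OF measurable_compose[OF _ borel_measurable_norm] h])
  hence "(\<lambda>x. indicator A x * h (norm (indicator A x *\<^sub>R u x))) \<in> borel_measurable lborel"
    by (rule borel_measurable_times[rotated]) (use assms(2) in simp)
  also have "(\<lambda>x. indicator A x * h (norm (indicator A x *\<^sub>R u x))) = (\<lambda>x. indicator A x *\<^sub>R h (norm (u x)))"
    by (auto simp: fun_eq_iff split: split_indicator)
  finally show ?thesis by (simp add: set_borel_measurable_def)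
qed

lemma set_integral_norm_cong_AE:
  assumes "set_borel_measurable lborel A (u :: real \<Rightarrow> complex)" "set_borel_measurable lborel A v"
    "AE x in lborel. x \<in> A \<longrightarrow> u x = v x"
    and A: "A \<in> sets borel" and h: "(h :: real \<Rightarrow> real) \<in> borel_measurable borel"
  shows "(LINT x:A|lborel. h (norm (u x))) = (LINT x:A|lborel. h (norm (v x)))"
    and "set_integrable lborel A (\<lambda>x. h (norm (u x))) \<longleftrightarrow> set_integrable lborel A (\<lambda>x. h (norm (v x)))"
proof -
  note m = set_borel_measurable_norm_compose[OF _ A h, THEN set_borel_measurable_def[THEN meta_eq_to_obj_eq, THEN iffD1]]
  have ae: "AE x in lborel. indicat_real A x *\<^sub>R h (norm (u x)) = indicat_real A x *\<^sub>R h (norm (v x))"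
    using assms(3) by eventually_elim (auto split: split_indicator)
  show "(LINT x:A|lborel. h (norm (u x))) = (LINT x:A|lborel. h (norm (v x)))"
    unfolding set_lebesgue_integral_def by (rule integral_cong_AE[OF m[OF assms(1)] m[OF assms(2)] ae])
  show "set_integrable lborel A (\<lambda>x. h (norm (u x))) \<longleftrightarrow> set_integrable lborel A (\<lambda>x. h (norm (v x)))"
    unfolding set_integrable_def by (rule integrable_cong_AE[OF m[OF assms(1)] m[OF assms(2)] ae])
qed

lemma split_rep_H1_split:
  assumes "split_rep u vl gl vr gr"
  shows "u \<in> H1_split"
proof -
  have rep: "H1_rep vl gl" "H1_rep vr gr" and AE: "AE x in lborel. 0 < x \<longrightarrow> u (- x) = vl x" "AE x in lborel. 0 < x \<longrightarrow> u x = vr x"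
    and m: "set_borel_measurable lborel {..<0} u" "set_borel_measurable lborel {0<..} u"
    using assms unfolding split_rep_def by blast+
  have 1: "H1_on {0<..} u" by (rule H1_rep_weak_deriv(1)[OF rep(2) AE(2) m(2)])
  have "set_borel_measurable lborel {0<..} (\<lambda>x. u (- x))"
    using set_borel_measurable_reflect[OF m(1)] unfolding reflect_halflines .
  hence "H1_on {0<..} (\<lambda>x. u (- x))" by (rule H1_rep_weak_deriv(1)[OF rep(1) AE(1)])
  hence "H1_on {..<0} u" using H1_on_reflect[of "{0<..}" "\<lambda>x. u (- x)"] unfolding reflect_halflines by simp
  with 1 show ?thesis by (simp add: H1_split_def)
qed

text \<open>
  The weak derivative inside \<open>Qf\<close> is an arbitrary choice, but almost everywhere it is the integrand of the
  representative.
\<close>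

lemma split_rep_Qf:
  assumes sr: "split_rep u vl gl vr gr"
  shows "Qf \<beta> u = (HINT x. (norm (gl x))\<^sup>2) + (HINT x. (norm (gr x))\<^sup>2)
           + 1 / \<beta> * (norm (vr 0 - vl 0))\<^sup>2"
proof -
  have rep: "H1_rep vl gl" "H1_rep vr gr" and AE: "AE x in lborel. 0 < x \<longrightarrow> u (- x) = vl x" "AE x in lborel. 0 < x \<longrightarrow> u x = vr x"
    and m: "set_borel_measurable lborel {..<0} u" "set_borel_measurable lborel {0<..} u"
    using sr unfolding split_rep_def by blast+
  have g: "L2_on {0<..} gl" "L2_on {0<..} gr" using rep unfolding H1_rep_def by blast+
  have mr: "set_borel_measurable lborel {0<..} (\<lambda>x. u (- x))"
    using set_borel_measurable_reflect[OF m(1)] unfolding reflect_halflines .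
  define w where "w = weak_deriv {0<..} u"
  have w: "L2_on {0<..} w" "AE x in lborel. 0 < x \<longrightarrow> w x = gr x"
    using H1_rep_weak_deriv[OF rep(2) AE(2) m(2)] unfolding w_def by blast+
  have R: "(HINT x. (norm (w x))\<^sup>2) = (HINT x. (norm (gr x))\<^sup>2)"
    by (rule set_integral_norm_cong_AE(1)[where h = "\<lambda>s. s\<^sup>2"]) (use w g in \<open>auto simp: L2_on_def\<close>)
  define z where "z = weak_deriv {..<0} u"
  have "H1_on {..<0} u" using split_rep_H1_split[OF sr] by (simp add: H1_split_def)
  hence z: "L2_on {..<0} z" "is_weak_deriv {..<0} u z"
    unfolding z_def weak_deriv_def H1_on_def using someI_ex[of "\<lambda>g. L2_on {..<0} g \<and> is_weak_deriv {..<0} u g"] by auto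
  have z': "L2_on {0<..} (\<lambda>x. - z (- x))" "is_weak_deriv {0<..} (\<lambda>x. u (- x)) (\<lambda>x. - z (- x))"
    using L2_on_uminus[OF L2_on_reflect[OF z(1)]] is_weak_deriv_reflect[OF z(2)]
    unfolding reflect_halflines by blast+
  note wl = H1_rep_weak_deriv[OF rep(1) AE(1) mr]
  have "AE x in lborel. 0 < x \<longrightarrow> - z (- x) = weak_deriv {0<..} (\<lambda>x. u (- x)) x"
    by (rule weak_deriv_unique_AE[OF z'(1) wl(2) z'(2) wl(3)])
  hence zl: "AE x in lborel. 0 < x \<longrightarrow> - z (- x) = gl x" using wl(4) by eventually_elim auto
  have "(LINT x:{..<0}|lborel. (norm (z x))\<^sup>2) = (HINT x. (norm (- z (- x)))\<^sup>2)"
    by (subst set_integral_reflect, unfold reflect_halflines) simp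
  also have "\<dots> = (HINT x. (norm (gl x))\<^sup>2)"
    by (rule set_integral_norm_cong_AE(1)[where h = "\<lambda>s. s\<^sup>2"]) (use z' zl g in \<open>auto simp: L2_on_def\<close>)
  finally have L: "(LINT x:{..<0}|lborel. (norm (z x))\<^sup>2) = (HINT x. (norm (gl x))\<^sup>2)" .
  have "trace0 {0<..} u = vr 0" by (rule trace0_halfline[OF rep(2) AE(2)])
  moreover have "trace0 {..<0} u = vl 0" unfolding trace0_reflect by (rule trace0_halfline[OF rep(1) AE(1)])
  ultimately show ?thesis using L R by (simp add: Qf_def w_def z_def)
qed

lemma split_rep_norm_Lp_pow:
  assumes sr: "split_rep u vl gl vr gr" and q: "q \<ge> 2"
  shows "norm_Lp_pow q u = (HINT x. norm (vl x) powr q) + (HINT x. norm (vr x) powr q)"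
proof -
  have rep: "H1_rep vl gl" "H1_rep vr gr" and AE: "AE x in lborel. 0 < x \<longrightarrow> u (- x) = vl x" "AE x in lborel. 0 < x \<longrightarrow> u x = vr x"
    and m: "set_borel_measurable lborel {..<0} u" "set_borel_measurable lborel {0<..} u"
    using sr unfolding split_rep_def by blast+
  have mr: "set_borel_measurable lborel {0<..} (\<lambda>x. u (- x))"
    using set_borel_measurable_reflect[OF m(1)] unfolding reflect_halflines .
  have v: "set_borel_measurable lborel {0<..} vl" "set_borel_measurable lborel {0<..} vr"
    using rep unfolding H1_rep_def L2_on_def by blast+
  have iv: "set_integrable lborel {0<..} (\<lambda>x. norm (vl x) powr q)" "set_integrable lborel {0<..} (\<lambda>x. norm (vr x) powr q)"
    using profile_powr_integrable[OF H1_rep_profile q] rep by auto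
  have h: "(\<lambda>s. s powr q) \<in> borel_measurable borel" by measurable
  note R = set_integral_norm_cong_AE[OF m(2) v(2) _ _ h, simplified, OF AE(2)]
  note L = set_integral_norm_cong_AE[OF mr v(1) _ _ h, simplified, OF AE(1)]
  have iR: "set_integrable lborel {0<..} (\<lambda>x. norm (u x) powr q)" using R(2) iv by simp
  have iL: "set_integrable lborel {..<0} (\<lambda>x. norm (u x) powr q)"
    using L(2) iv set_integrable_reflect[of "{0<..}" "\<lambda>x. norm (u (- x)) powr q"]
    unfolding reflect_halflines by simp
  let ?f = "\<lambda>x. norm (u x) powr q"
  have "norm_Lp_pow q u = (LINT x|lborel. indicator {..<0} x *\<^sub>R ?f x + indicator {0<..} x *\<^sub>R ?f x)"
    unfolding norm_Lp_pow_def
  proof (rule integral_cong_AE)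
    have eq: "?f = (\<lambda>x. (indicator {..<0} x *\<^sub>R ?f x + indicator {0<..} x *\<^sub>R ?f x) + indicator {0} x *\<^sub>R ?f 0)"
      by (auto simp: fun_eq_iff split: split_indicator)
    have ms: "(\<lambda>x. indicator {..<0} x *\<^sub>R ?f x + indicator {0<..} x *\<^sub>R ?f x) \<in> borel_measurable lborel"
      using iL iR unfolding set_integrable_def by (intro borel_measurable_integrable Bochner_Integration.integrable_add)
    thus "(\<lambda>x. indicator {..<0} x *\<^sub>R ?f x + indicator {0<..} x *\<^sub>R ?f x) \<in> borel_measurable lborel" .
    show "?f \<in> borel_measurable lborel"
      by (subst eq, rule borel_measurable_add[OF ms]) auto
    have "AE x in lborel. x \<noteq> (0::real)" by (rule AE_lborel_singleton)
    thus "AE x in lborel. ?f x = indicator {..<0} x *\<^sub>R ?f x + indicator {0<..} x *\<^sub>R ?f x"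
      by eventually_elim (auto split: split_indicator)
  qed
  also have "\<dots> = (LINT x:{..<0}|lborel. ?f x) + (HINT x. ?f x)"
    using iL iR unfolding set_integrable_def set_lebesgue_integral_def by simp
  also have "(LINT x:{..<0}|lborel. ?f x) = (HINT x. norm (u (- x)) powr q)"
    by (subst set_integral_reflect, unfold reflect_halflines) simp
  finally show ?thesis using L(1) R(1) by simp
qed

section \<open>Exponentially decaying functions\<close>

lemma set_integrable_exp_decay:
  fixes c :: real
  assumes "c > 0"
  shows "set_integrable lborel {0<..} (\<lambda>x. exp (- c * x))" "(HINT x. exp (- c * x)) = 1 / c"
proof -
  have lim: "((\<lambda>x. - exp (- c * x) / c) \<longlongrightarrow> - 0 / c) at_top"
  proof (intro tendsto_intros)
    have "filterlim (\<lambda>x. c * x) at_top at_top"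
      using assms by (intro filterlim_tendsto_pos_mult_at_top[OF tendsto_const _ filterlim_ident]) auto
    hence "filterlim (\<lambda>x. - (c * x)) at_bot at_top" by (simp add: filterlim_uminus_at_top)
    thus "((\<lambda>x. exp (- c * x)) \<longlongrightarrow> 0) at_top"
      using filterlim_compose[OF exp_at_bot] by simp
  qed (use assms in auto)
  have d: "((\<lambda>x. - exp (- c * x) / c) has_real_derivative exp (- c * x)) (at x)" for x
    using assms by (auto intro!: derivative_eq_intros)
  have z: "((\<lambda>x. - exp (- c * x) / c) \<longlongrightarrow> - exp (- c * 0) / c) (at_right 0)"
    by (intro tendsto_intros) (use assms in auto)
  have e: "einterval 0 \<infinity> = {0::real<..}" by (auto simp: einterval_def)
  note FTC = interval_integral_FTC_nonneg[of 0 \<infinity> "\<lambda>x. - exp (- c * x) / c" "\<lambda>x. exp (- c * x)" "- 1 / c" 0]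
  have A: "(((\<lambda>x. - exp (- c * x) / c) \<circ> real_of_ereal) \<longlongrightarrow> - 1 / c) (at_right 0)"
    using z by (simp add: zero_ereal_def ereal_tendsto_simps)
  have B: "(((\<lambda>x. - exp (- c * x) / c) \<circ> real_of_ereal) \<longlongrightarrow> 0) (at_left \<infinity>)"
    using lim by (simp add: ereal_tendsto_simps)
  show "set_integrable lborel {0<..} (\<lambda>x. exp (- c * x))"
    using FTC(1)[OF _ d _ _ A B] by (simp add: e)
  show "(HINT x. exp (- c * x)) = 1 / c"
    using FTC(2)[OF _ d _ _ A B] by (simp add: interval_lebesgue_integral_def e)
qed

lemma exp_decay_set_integrable:
  fixes w :: "real \<Rightarrow> real"
  assumes "c > 0" "continuous_on {0..} w" "\<And>x. 0 \<le> x \<Longrightarrow> \<bar>w x\<bar> \<le> C * exp (- c * x)"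
  shows "set_integrable lborel {0<..} w"
proof (rule set_integrable_bound)
  show "set_integrable lborel {0<..} (\<lambda>x. C * exp (- c * x))"
    using set_integrable_exp_decay(1)[OF assms(1)] by simp
  show "set_borel_measurable lborel {0<..} w" by (rule continuous_on_imp_set_measurable[OF assms(2)])
  show "AE x in lborel. x \<in> {0<..} \<longrightarrow> norm (w x) \<le> norm (C * exp (- c * x))"
  proof (intro AE_I2 impI)
    fix x :: real assume "x \<in> {0<..}"
    hence "\<bar>w x\<bar> \<le> C * exp (- c * x)" using assms(3) by simp
    also have "\<dots> \<le> \<bar>C * exp (- c * x)\<bar>" by (rule abs_ge_self)
    finally show "norm (w x) \<le> norm (C * exp (- c * x))" by simp
  qed
qed

lemma FTC_halfline:
  fixes W w :: "real \<Rightarrow> real"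
  assumes d: "\<And>x. 0 \<le> x \<Longrightarrow> (W has_real_derivative w x) (at x within {0..})"
    and c: "continuous_on {0..} w" and i: "set_integrable lborel {0<..} w" and l: "(W \<longlongrightarrow> L) at_top"
  shows "(HINT x. w x) = L - W 0"
proof -
  have "((\<lambda>y. LINT x|lborel. indicator {..y} x *\<^sub>R (indicator {0<..} x *\<^sub>R w x)) \<longlongrightarrow> (LINT x|lborel. indicator {0<..} x *\<^sub>R w x)) at_top"
    by (rule tendsto_integral_at_top) (use i in \<open>auto simp: set_integrable_def\<close>)
  moreover have "eventually (\<lambda>y. (LINT x|lborel. indicator {..y} x *\<^sub>R (indicator {0<..} x *\<^sub>R w x)) = W y - W 0) at_top"
    using eventually_ge_at_top[of 0]
  proof eventually_elim
    case (elim y)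
    have "(LINT x|lborel. indicator {..y} x *\<^sub>R (indicator {0<..} x *\<^sub>R w x)) = (LINT x:{0<..y}|lborel. w x)"
      unfolding set_lebesgue_integral_def
      by (rule Bochner_Integration.integral_cong) (auto split: split_indicator)
    also have "\<dots> = (LINT x:{0..y}|lborel. w x)" by (simp add: set_integral_Icc_eq_Ioc)
    also have "\<dots> = W y - W 0"
      unfolding set_lebesgue_integral_def
    proof (rule integral_FTC_atLeastAtMost[OF elim])
      show "(W has_vector_derivative w x) (at x within {0..y})" if "0 \<le> x" "x \<le> y" for x
        using DERIV_subset[OF d[OF that(1)], of "{0..y}"] by (auto simp: has_real_derivative_iff_has_vector_derivative)
    qed (use continuous_on_subset[OF c] in auto)
    finally show ?case .
  qed
  ultimately have "((\<lambda>y. W y - W 0) \<longlongrightarrow> (HINT x. w x)) at_top"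
    unfolding set_lebesgue_integral_def by (rule Lim_transform_eventually)
  moreover have "((\<lambda>y. W y - W 0) \<longlongrightarrow> L - W 0) at_top" by (intro tendsto_intros l)
  ultimately show ?thesis by (intro tendsto_unique) auto
qed

lemma exp_decay_H1_rep:
  fixes v g :: "real \<Rightarrow> real"
  assumes c: "c > 0" and d: "\<And>x. 0 \<le> x \<Longrightarrow> (v has_real_derivative g x) (at x within {0..})" and cg: "continuous_on {0..} g"
    and bv: "\<And>x. 0 \<le> x \<Longrightarrow> \<bar>v x\<bar> \<le> C * exp (- c * x)" and bg: "\<And>x. 0 \<le> x \<Longrightarrow> \<bar>g x\<bar> \<le> C * exp (- c * x)"
  shows "H1_rep (\<lambda>x. complex_of_real (v x)) (\<lambda>x. complex_of_real (g x))"
proof -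
  have cv: "continuous_on {0..} v"
    using d unfolding continuous_on_eq_continuous_within by (auto intro: DERIV_continuous)
  have L2: "L2_on {0<..} (\<lambda>x. complex_of_real (w x))" if cw: "continuous_on {0..} w" and bw: "\<And>x. 0 \<le> x \<Longrightarrow> \<bar>w x\<bar> \<le> C * exp (- c * x)" for w
  proof -
    have "set_integrable lborel {0<..} (\<lambda>x. (w x)\<^sup>2)"
    proof (rule exp_decay_set_integrable[of "2 * c" _ "C\<^sup>2"])
      show "\<bar>(w x)\<^sup>2\<bar> \<le> C\<^sup>2 * exp (- (2 * c) * x)" if "0 \<le> x" for x
      proof -
        have "\<bar>w x\<bar>\<^sup>2 \<le> (C * exp (- c * x))\<^sup>2" using bw[OF that] by (intro power_mono) auto
        thus ?thesis by (simp add: power_mult_distrib exp_double[symmetric] mult.assoc)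
      qed
    qed (use c cw in \<open>auto intro!: continuous_intros\<close>)
    moreover have "set_borel_measurable lborel {0<..} (\<lambda>x. complex_of_real (w x))"
      by (rule continuous_on_imp_set_measurable) (intro continuous_intros cw)
    ultimately show ?thesis by (simp add: L2_on_def)
  qed
  have "complex_of_real (v x) = complex_of_real (v 0) + (LINT y:{0..x}|lborel. complex_of_real (g y))" if "0 \<le> x" for x
  proof -
    have "(LINT y:{0..x}|lborel. g y) = v x - v 0"
      unfolding set_lebesgue_integral_def
    proof (rule integral_FTC_atLeastAtMost[OF that])
      show "(v has_vector_derivative g y) (at y within {0..x})" if "0 \<le> y" "y \<le> x" for y
        using DERIV_subset[OF d[OF that(1)], of "{0..x}"] by (auto simp: has_real_derivative_iff_has_vector_derivative)
    qed (use continuous_on_subset[OF cg] in auto)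
    thus ?thesis by (simp add: set_integral_complex_of_real)
  qed
  with L2[OF cv bv] L2[OF cg bg] show ?thesis unfolding H1_rep_def by blast
qed

section \<open>The soliton\<close>

locale nls_params =
  fixes p \<omega> :: real
  assumes p: "2 < p" and \<omega>: "0 < \<omega>"
begin

text \<open>
  \<open>peak\<close> is the maximum of the soliton and the positive zero of \<open>\<omega> * s\<^sup>2 - 2 / p * s powr p\<close>. On \<open>[0, peak]\<close>, \<open>slope\<close>
  is the square root of this expression. The maximum with 0 and the absolute value make \<open>slope\<close> continuous on
  the whole line, so that its antiderivative \<open>cost\<close> is differentiable at 0 and at \<open>peak\<close> from both sides.
  \<open>dsol\<close> is the derivative of the soliton.
\<close>

definition rate :: real where "rate = (p - 2) / 2 * sqrt \<omega>"
definition peak :: real where "peak = (\<omega> * p / 2) powr (1 / (p - 2))"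
definition slope :: "real \<Rightarrow> real" where
  "slope s = sqrt \<omega> * s * sqrt (max 0 (1 - (\<bar>s\<bar> / peak) powr (p - 2)))"
definition cost :: "real \<Rightarrow> real" where
  "cost = (SOME F. F 0 = 0 \<and> (\<forall>s. (F has_real_derivative slope s) (at s)))"
abbreviation \<phi> :: "real \<Rightarrow> real" where "\<phi> \<equiv> soliton p \<omega>"
definition dsol :: "real \<Rightarrow> real" where "dsol x = - sqrt \<omega> * tanh (rate * x) * \<phi> x"

lemma rate_pos: "0 < rate" using p \<omega> by (simp add: rate_def)
lemma peak_pos: "0 < peak" using p \<omega> by (simp add: peak_def)
lemma peak_powr: "peak powr (p - 2) = \<omega> * p / 2"
  using p \<omega> by (simp add: peak_def powr_powr)

lemma slope_continuous: "continuous_on A slope"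
  unfolding slope_def using p peak_pos
  by (intro continuous_intros continuous_on_powr') auto

lemma slope_0 [simp]: "slope 0 = 0" by (simp add: slope_def)

lemma slope_nonneg: "0 \<le> s \<Longrightarrow> 0 \<le> slope s" using \<omega> by (simp add: slope_def)

lemma slope_le: "0 \<le> s \<Longrightarrow> slope s \<le> sqrt \<omega> * s"
  unfolding slope_def using \<omega>
  by (intro mult_left_le) auto

lemma ratio_powr_le_1: "0 \<le> s \<Longrightarrow> s \<le> peak \<Longrightarrow> (s / peak) powr (p - 2) \<le> 1"
  using powr_mono2[of "p - 2" "s / peak" 1] p peak_pos by simp

lemma ratio_powr_less_1: "0 \<le> s \<Longrightarrow> s < peak \<Longrightarrow> (s / peak) powr (p - 2) < 1"
  using powr_less_mono2[of "p - 2" "s / peak" 1] p peak_pos by simp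

lemma slope_eq: "0 \<le> s \<Longrightarrow> s \<le> peak \<Longrightarrow> slope s = sqrt \<omega> * s * sqrt (1 - (s / peak) powr (p - 2))"
  using ratio_powr_le_1[of s] by (simp add: slope_def max_def)

lemma slope_pos: "0 < s \<Longrightarrow> s < peak \<Longrightarrow> 0 < slope s"
  using ratio_powr_less_1[of s] \<omega> by (simp add: slope_eq)

lemma slope_peak: "slope peak = 0" using peak_pos by (simp add: slope_eq)

text \<open>
  One half of the right-hand side is the potential energy in the action.
\<close>

lemma slope_squared:
  assumes "0 \<le> s" "s \<le> peak"
  shows "(slope s)\<^sup>2 = \<omega> * s\<^sup>2 - 2 / p * s powr p"
proof (cases "s = 0")
  case False
  hence s: "s > 0" using assms by simp
  have "(slope s)\<^sup>2 = \<omega> * s\<^sup>2 * (1 - (s / peak) powr (p - 2))"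
    using slope_eq[OF assms] ratio_powr_le_1[OF assms] \<omega> by (simp add: power_mult_distrib)
  also have "(s / peak) powr (p - 2) = s powr (p - 2) / (\<omega> * p / 2)"
    by (simp only: powr_divide peak_powr)
  also have "s powr (p - 2) = s powr p / s\<^sup>2"
    using s by (simp add: powr_diff powr_numeral)
  finally have "(slope s)\<^sup>2 = \<omega> * s\<^sup>2 * (1 - s powr p / s\<^sup>2 / (\<omega> * p / 2))" .
  moreover have "\<omega> * x * (1 - P / x / (\<omega> * p / 2)) = \<omega> * x - 2 / p * P" if "x \<noteq> 0" for x P :: real
    using that p \<omega> by (simp add: field_simps)
  ultimately show ?thesis using s by simp
qed (use p in simp)

lemma cost_exists: "\<exists>F. F 0 = 0 \<and> (\<forall>s. (F has_real_derivative slope s) (at s))"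
proof -
  have "isCont slope s" for s using slope_continuous[of UNIV] by (simp add: continuous_on_eq_continuous_at)
  then obtain F where F: "\<And>s. (F has_real_derivative slope s) (at s)"
    using einterval_antiderivative[of "-\<infinity>" "\<infinity>" slope] by (auto simp: has_real_derivative_iff_has_vector_derivative)
  hence "((\<lambda>s. F s - F 0) has_real_derivative slope s) (at s)" for s
    by (auto intro!: derivative_eq_intros)
  thus ?thesis by (intro exI[of _ "\<lambda>s. F s - F 0"]) auto
qed

lemma cost_0 [simp]: "cost 0 = 0" and cost_deriv: "(cost has_real_derivative slope s) (at s within A)"
proof -
  have "cost 0 = 0 \<and> (\<forall>s. (cost has_real_derivative slope s) (at s))"
    unfolding cost_def by (rule someI_ex[OF cost_exists])
  thus "cost 0 = 0" "(cost has_real_derivative slope s) (at s within A)"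
    by (auto intro: has_field_derivative_at_within)
qed

lemma cost_strict_mono:
  assumes "0 \<le> s" "s < t" "t \<le> peak"
  shows "cost s < cost t"
proof (rule DERIV_pos_imp_increasing_open[OF assms(2)])
  fix x assume "s < x" "x < t"
  thus "\<exists>y. (cost has_real_derivative y) (at x) \<and> 0 < y"
    using cost_deriv[of x UNIV] slope_pos[of x] assms by auto
next
  show "continuous_on {s..t} cost"
    by (intro continuous_at_imp_continuous_on ballI DERIV_isCont[OF cost_deriv])
qed

lemma soliton_eq: "\<phi> x = peak * cosh (rate * x) powr (- 2 / (p - 2))"
proof -
  have c: "cosh (rate * x) > 0" by (rule cosh_real_pos)
  have "\<phi> x = (\<omega> * p / 2 / (cosh (rate * x))\<^sup>2) powr (1 / (p - 2))"
    by (simp add: soliton_def rate_def)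
  also have "\<dots> = peak * ((cosh (rate * x))\<^sup>2) powr (- (1 / (p - 2)))"
    unfolding peak_def powr_minus_divide using p \<omega> by (subst powr_divide) auto
  also have "((cosh (rate * x))\<^sup>2) powr (- (1 / (p - 2))) = cosh (rate * x) powr (- 2 / (p - 2))"
  proof -
    have "(cosh (rate * x))\<^sup>2 = cosh (rate * x) powr 2" using c by (simp add: powr_numeral)
    hence "((cosh (rate * x))\<^sup>2) powr (- (1 / (p - 2))) = cosh (rate * x) powr (2 * - (1 / (p - 2)))"
      by (simp only: powr_powr)
    thus ?thesis by simp
  qed
  finally show ?thesis .
qed

lemma soliton_pos: "0 < \<phi> x"
  using peak_pos cosh_real_pos[of "rate * x"] by (simp add: soliton_eq)

lemma soliton_le_peak: "\<phi> x \<le> peak"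
proof -
  have "cosh (rate * x) powr (- 2 / (p - 2)) \<le> 1 powr (- 2 / (p - 2))"
    using p cosh_real_ge_1[of "rate * x"] by (intro powr_mono2') auto
  thus ?thesis using peak_pos by (simp add: soliton_eq)
qed

lemma soliton_0: "\<phi> 0 = peak" by (simp add: soliton_eq)

lemma soliton_even: "\<phi> (- x) = \<phi> x" by (simp add: soliton_eq)

lemma soliton_ratio: "(\<phi> x / peak) powr (p - 2) = 1 - (tanh (rate * x))\<^sup>2"
proof -
  have c: "cosh (rate * x) > 0" by (rule cosh_real_pos)
  have "(\<phi> x / peak) powr (p - 2) = cosh (rate * x) powr (- 2)"
  proof -
    have "(\<phi> x / peak) powr (p - 2) = cosh (rate * x) powr ((- 2 / (p - 2)) * (p - 2))"
      using peak_pos by (simp only: soliton_eq powr_powr[symmetric]) simp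
    also have "(- 2 / (p - 2)) * (p - 2) = - 2" using p by (simp add: field_simps)
    finally show ?thesis .
  qed
  also have "\<dots> = 1 / (cosh (rate * x))\<^sup>2" using c by (simp add: powr_minus powr_numeral divide_inverse)
  also have "\<dots> = 1 - (tanh (rate * x))\<^sup>2"
  proof -
    have "(cosh (rate * x))\<^sup>2 \<noteq> 0" using c by simp
    moreover have "(cosh (rate * x))\<^sup>2 = (sinh (rate * x))\<^sup>2 + 1" by (rule cosh_square_eq)
    moreover have "1 / C = 1 - S / C" if "C = S + 1" "C \<noteq> 0" for C S :: real
      using that by (simp add: field_simps)
    ultimately show ?thesis unfolding tanh_def power_divide by blast
  qed
  finally show ?thesis .
qed

lemma soliton_tanh: "\<phi> x = peak * (1 - (tanh (rate * x))\<^sup>2) powr (1 / (p - 2))"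
proof -
  have "((\<phi> x / peak) powr (p - 2)) powr (1 / (p - 2)) = \<phi> x / peak"
    using soliton_pos[of x] peak_pos p by (simp add: powr_powr)
  thus ?thesis using peak_pos by (simp add: soliton_ratio field_simps)
qed

lemma slope_soliton: "slope (\<phi> x) = sqrt \<omega> * \<bar>tanh (rate * x)\<bar> * \<phi> x"
  using slope_eq[of "\<phi> x"] soliton_pos[of x] soliton_le_peak[of x] by (simp add: soliton_ratio)

lemma slope_soliton_sq: "(slope (\<phi> x))\<^sup>2 = (dsol x)\<^sup>2"
  by (simp add: slope_soliton dsol_def power_mult_distrib)

lemma dsol_right: "0 \<le> x \<Longrightarrow> dsol x = - slope (\<phi> x)"
  using rate_pos by (simp add: slope_soliton dsol_def)

lemma dsol_left: "x \<le> 0 \<Longrightarrow> dsol x = slope (\<phi> x)"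
  using rate_pos by (simp add: slope_soliton dsol_def mult_nonneg_nonpos)

lemma soliton_deriv: "(\<phi> has_real_derivative dsol x) (at x within A)"
proof -
  have c: "cosh (rate * x) > 0" by (rule cosh_real_pos)
  have "((\<lambda>x. peak * cosh (rate * x) powr (- 2 / (p - 2))) has_real_derivative
      peak * ((- 2 / (p - 2)) * cosh (rate * x) powr (- 2 / (p - 2) - 1) * (sinh (rate * x) * rate))) (at x)"
    using c by (auto intro!: derivative_eq_intros)
  moreover have "peak * ((- 2 / (p - 2)) * cosh (rate * x) powr (- 2 / (p - 2) - 1) * (sinh (rate * x) * rate)) = dsol x"
  proof -
    have "cosh (rate * x) powr (- 2 / (p - 2) - 1) = cosh (rate * x) powr (- 2 / (p - 2)) / cosh (rate * x)"
      using c by (simp add: powr_diff)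
    moreover have "(- 2 / (p - 2)) * rate = - sqrt \<omega>" using p by (simp add: rate_def)
    moreover have "P * (e * (B / c) * (S * r)) = (e * r) * (S / c) * (P * B)" for P e B c S r :: real
      by (simp add: mult_ac)
    ultimately have "peak * ((- 2 / (p - 2)) * cosh (rate * x) powr (- 2 / (p - 2) - 1) * (sinh (rate * x) * rate))
       = - sqrt \<omega> * (sinh (rate * x) / cosh (rate * x)) * (peak * cosh (rate * x) powr (- 2 / (p - 2)))"
      by metis
    thus ?thesis by (simp add: dsol_def soliton_eq tanh_def)
  qed
  moreover have "\<phi> = (\<lambda>x. peak * cosh (rate * x) powr (- 2 / (p - 2)))" by (simp add: fun_eq_iff soliton_eq)
  ultimately show ?thesis by (metis has_field_derivative_at_within)
qed

lemma soliton_continuous: "continuous_on A \<phi>"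
  by (intro continuous_at_imp_continuous_on ballI DERIV_isCont[OF soliton_deriv])

lemma dsol_continuous: "continuous_on A dsol"
proof -
  have "cosh (rate * x) \<noteq> 0" for x using cosh_real_pos[of "rate * x"] by simp
  thus ?thesis unfolding dsol_def by (intro continuous_intros soliton_continuous) auto
qed

lemma soliton_strict_antimono:
  assumes "0 \<le> x" "x < y"
  shows "\<phi> y < \<phi> x"
proof (rule DERIV_neg_imp_decreasing_open[OF assms(2)])
  fix z assume "x < z" "z < y"
  thus "\<exists>d. (\<phi> has_real_derivative d) (at z) \<and> d < 0"
    using soliton_deriv[of z UNIV] assms rate_pos \<omega> soliton_pos[of z]
    by (intro exI[of _ "dsol z"]) (auto simp: dsol_def mult_pos_pos)
qed (rule soliton_continuous)

lemma soliton_exp_bound: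
  "\<phi> x \<le> peak * 2 powr (2 / (p - 2)) * exp (- sqrt \<omega> * \<bar>x\<bar>)"
proof -
  have "exp \<bar>rate * x\<bar> / 2 \<le> cosh (rate * x)"
    unfolding cosh_def by (cases "rate * x \<ge> 0") auto
  hence "cosh (rate * x) powr (- 2 / (p - 2)) \<le> (exp \<bar>rate * x\<bar> / 2) powr (- 2 / (p - 2))"
    using p by (intro powr_mono2') auto
  also have "\<dots> = 2 powr (2 / (p - 2)) * exp (- sqrt \<omega> * \<bar>x\<bar>)"
  proof -
    have "(exp \<bar>rate * x\<bar>) powr (- 2 / (p - 2)) = exp (\<bar>rate * x\<bar> * (- 2 / (p - 2)))"
      by (simp add: powr_def)
    also have "\<bar>rate * x\<bar> * (- 2 / (p - 2)) = - sqrt \<omega> * \<bar>x\<bar>"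
      using p \<omega> by (simp add: abs_mult rate_def)
    finally show ?thesis by (simp add: powr_divide powr_minus field_simps)
  qed
  finally show ?thesis using peak_pos by (simp add: soliton_eq)
qed

lemma abs_dsol_le: "\<bar>dsol x\<bar> \<le> sqrt \<omega> * \<phi> x"
proof -
  have "\<bar>tanh (rate * x)\<bar> \<le> 1" using tanh_real_bounds[of "rate * x"] by auto
  hence "sqrt \<omega> * \<phi> x * \<bar>tanh (rate * x)\<bar> \<le> sqrt \<omega> * \<phi> x"
    using \<omega> soliton_pos[of x] by (intro mult_left_le) auto
  thus ?thesis using \<omega> soliton_pos[of x] by (simp add: dsol_def abs_mult mult_ac)
qed

definition decay_const :: "real \<Rightarrow> real" where
  "decay_const a = peak * 2 powr (2 / (p - 2)) * exp (sqrt \<omega> * \<bar>a\<bar>)"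

lemma shifted_soliton_bound:
  assumes "0 \<le> x" shows "\<phi> (x + a) \<le> decay_const a * exp (- sqrt \<omega> * x)"
proof -
  have "sqrt \<omega> * x \<le> sqrt \<omega> * (\<bar>a\<bar> + \<bar>x + a\<bar>)" using assms \<omega> by (intro mult_left_mono) auto
  hence "exp (- sqrt \<omega> * \<bar>x + a\<bar>) \<le> exp (sqrt \<omega> * \<bar>a\<bar>) * exp (- sqrt \<omega> * x)"
    unfolding exp_add[symmetric] by (simp add: algebra_simps)
  thus ?thesis using soliton_exp_bound[of "x + a"] peak_pos
    by (auto simp: decay_const_def mult.assoc intro!: order_trans[OF soliton_exp_bound] mult_left_mono)
qed

lemma soliton_tendsto_0: "((\<lambda>x. \<phi> (x + a)) \<longlongrightarrow> 0) at_top"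
proof (rule tendsto_sandwich[OF _ _ tendsto_const])
  have "filterlim (\<lambda>x. sqrt \<omega> * x) at_top at_top"
    using \<omega> by (intro filterlim_tendsto_pos_mult_at_top[OF tendsto_const _ filterlim_ident]) auto
  hence "filterlim (\<lambda>x. - (sqrt \<omega> * x)) at_bot at_top" by (simp add: filterlim_uminus_at_top)
  hence "((\<lambda>x. exp (- sqrt \<omega> * x)) \<longlongrightarrow> 0) at_top" using filterlim_compose[OF exp_at_bot] by simp
  thus "((\<lambda>x. decay_const a * exp (- sqrt \<omega> * x)) \<longlongrightarrow> 0) at_top" by (rule tendsto_mult_right_zero)
  show "eventually (\<lambda>x. \<phi> (x + a) \<le> decay_const a * exp (- sqrt \<omega> * x)) at_top"
    using eventually_ge_at_top[of 0] by eventually_elim (rule shifted_soliton_bound)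
qed (auto intro!: always_eventually less_imp_le soliton_pos)

lemma shifted_soliton_deriv: "((\<lambda>x. \<phi> (x + a)) has_real_derivative dsol (x + a)) (at x within A)"
proof -
  have "((\<lambda>x. x + a) has_real_derivative 1) (at x within A)" by (auto intro!: derivative_eq_intros)
  from DERIV_chain2[where f = \<phi> and g = "\<lambda>x. x + a", OF soliton_deriv this] show ?thesis by simp
qed

lemma shifted_continuous: "continuous_on A (\<lambda>x. \<phi> (x + a))" "continuous_on A (\<lambda>x. dsol (x + a))"
  by (auto intro!: continuous_on_compose2[OF soliton_continuous[of UNIV]] continuous_on_compose2[OF dsol_continuous[of UNIV]] continuous_intros)

lemma shifted_soliton_H1_rep: "H1_rep (\<lambda>x. complex_of_real (\<phi> (x + a))) (\<lambda>x. complex_of_real (dsol (x + a)))"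
proof (rule exp_decay_H1_rep[where c = "sqrt \<omega>" and C = "max 1 (sqrt \<omega>) * decay_const a"])
  have dc: "0 \<le> decay_const a" using peak_pos by (simp add: decay_const_def)
  fix x :: real assume x: "0 \<le> x"
  have "\<phi> (x + a) \<le> 1 * (decay_const a * exp (- sqrt \<omega> * x))" using shifted_soliton_bound[OF x] by simp
  also have "\<dots> \<le> max 1 (sqrt \<omega>) * (decay_const a * exp (- sqrt \<omega> * x))" using dc by (intro mult_right_mono) auto
  finally show "\<bar>\<phi> (x + a)\<bar> \<le> max 1 (sqrt \<omega>) * decay_const a * exp (- sqrt \<omega> * x)"
    using soliton_pos[of "x + a"] by (simp add: mult.assoc)
  have "\<bar>dsol (x + a)\<bar> \<le> sqrt \<omega> * \<phi> (x + a)" by (rule abs_dsol_le)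
  also have "\<dots> \<le> sqrt \<omega> * (decay_const a * exp (- sqrt \<omega> * x))" using shifted_soliton_bound[OF x] \<omega> by (intro mult_left_mono) auto
  also have "\<dots> \<le> max 1 (sqrt \<omega>) * (decay_const a * exp (- sqrt \<omega> * x))" using dc by (intro mult_right_mono) auto
  finally show "\<bar>dsol (x + a)\<bar> \<le> max 1 (sqrt \<omega>) * decay_const a * exp (- sqrt \<omega> * x)" by (simp add: mult.assoc)
qed (use \<omega> shifted_soliton_deriv shifted_continuous in auto)

lemma shifted_soliton_profile: "profile (\<lambda>x. \<phi> (x + a)) (\<lambda>x. \<bar>dsol (x + a)\<bar>)"
  using H1_rep_profile[OF shifted_soliton_H1_rep[of a]] soliton_pos by (simp add: less_imp_le)


lemma shifted_set_integrable:
  "set_integrable lborel {0<..} (\<lambda>x. (dsol (x + a))\<^sup>2)"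
  "set_integrable lborel {0<..} (\<lambda>x. (\<phi> (x + a))\<^sup>2)"
  "2 \<le> q \<Longrightarrow> set_integrable lborel {0<..} (\<lambda>x. \<phi> (x + a) powr q)"
  using shifted_soliton_profile[of a] profile_powr_integrable[OF shifted_soliton_profile[of a]]
  by (auto simp: profile_def)

lemma cost_soliton_tendsto_0: "((\<lambda>x. cost (\<phi> (x + a))) \<longlongrightarrow> 0) at_top"
proof -
  have "isCont cost 0" by (rule DERIV_isCont[OF cost_deriv])
  from isCont_tendsto_compose[OF this soliton_tendsto_0[of a]] show ?thesis by simp
qed

lemma cost_soliton_deriv:
  "((\<lambda>x. cost (\<phi> (x + a))) has_real_derivative slope (\<phi> (x + a)) * dsol (x + a)) (at x within A)"
  by (rule DERIV_chain2[where f = cost and g = "\<lambda>x. \<phi> (x + a)", OF cost_deriv shifted_soliton_deriv])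

text \<open>
  On the decreasing part of the soliton \<open>\<phi>'\<^sup>2 = - f \<phi> * \<phi>'\<close>, so \<open>- cost \<phi>\<close> is an antiderivative of \<open>\<phi>'\<^sup>2\<close>.
\<close>

lemma soliton_tail_energy:
  assumes "0 \<le> a"
  shows "(HINT x. (dsol (x + a))\<^sup>2) = cost (\<phi> a)"
proof -
  have "(HINT x. (dsol (x + a))\<^sup>2) = 0 - (- cost (\<phi> (0 + a)))"
  proof (rule FTC_halfline)
    show "((\<lambda>x. - cost (\<phi> (x + a))) has_real_derivative (dsol (x + a))\<^sup>2) (at x within {0..})" if "0 \<le> x" for x
      using DERIV_minus[OF cost_soliton_deriv[of a x "{0..}"]] dsol_right[of "x + a"] that assms
      by (simp add: power2_eq_square)
    show "((\<lambda>x. - cost (\<phi> (x + a))) \<longlongrightarrow> 0) at_top"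
      using tendsto_minus[OF cost_soliton_tendsto_0[of a]] by simp
  qed (auto intro!: shifted_set_integrable continuous_intros shifted_continuous)
  thus ?thesis by simp
qed

lemma set_integral_translate:
  fixes h :: "real \<Rightarrow> 'a :: {banach, second_countable_topology}"
  shows "(LINT x:{c<..}|lborel. h x) = (HINT x. h (x + c))"
  unfolding set_lebesgue_integral_def
  by (subst lborel_integral_real_affine[where c = 1 and t = c])
     (auto intro!: Bochner_Integration.integral_cong simp: add.commute split: split_indicator)

text \<open>
  The translate climbs from \<open>\<phi> a\<close> to the peak and then descends to 0. The two parts cost \<open>cost peak - cost (\<phi> a)\<close>
  and \<open>cost peak\<close>.
\<close>

lemma soliton_peak_energy:
  assumes "0 \<le> a"
  shows "(HINT x. (dsol (x + - a))\<^sup>2) = 2 * cost peak - cost (\<phi> a)"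
proof -
  have i: "set_integrable lborel {0<..} (\<lambda>x. (dsol (x + - a))\<^sup>2)" by (rule shifted_set_integrable)
  have "(LINT x:{0<..a} \<union> {a<..}|lborel. (dsol (x + - a))\<^sup>2)
      = (LINT x:{0<..a}|lborel. (dsol (x + - a))\<^sup>2) + (LINT x:{a<..}|lborel. (dsol (x + - a))\<^sup>2)"
    by (rule set_integral_Un) (force, (rule set_integrable_subset[OF i]; use assms in auto)+)
  moreover have "{0<..a} \<union> {a<..} = {0<..}" using assms by auto
  moreover have "(LINT x:{a<..}|lborel. (dsol (x + - a))\<^sup>2) = cost peak"
    using soliton_tail_energy[of 0] by (subst set_integral_translate) (simp add: soliton_0)
  moreover have "(LINT x:{0<..a}|lborel. (dsol (x + - a))\<^sup>2) = cost peak - cost (\<phi> a)"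
  proof -
    have "(LINT x:{0..a}|lborel. (dsol (x + - a))\<^sup>2) = cost (\<phi> (a + - a)) - cost (\<phi> (0 + - a))"
      unfolding set_lebesgue_integral_def
    proof (rule integral_FTC_atLeastAtMost[OF assms])
      show "((\<lambda>x. cost (\<phi> (x + - a))) has_vector_derivative (dsol (x + - a))\<^sup>2) (at x within {0..a})" if "0 \<le> x" "x \<le> a" for x
        using cost_soliton_deriv[of "- a" x "{0..a}"] dsol_left[of "x + - a"] that
        by (simp add: has_real_derivative_iff_has_vector_derivative power2_eq_square)
    qed (intro continuous_intros shifted_continuous)
    thus ?thesis using soliton_even[of a] by (simp add: set_integral_Icc_eq_Ioc soliton_0)
  qed
  ultimately show ?thesis by simp
qed

lemma dsol_deriv: "(dsol has_real_derivative \<omega> * \<phi> x - \<phi> x * (\<phi> x) powr (p - 2)) (at x within A)"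
proof -
  have c: "cosh (rate * x) \<noteq> 0" using cosh_real_pos[of "rate * x"] by simp
  let ?t = "tanh (rate * x)"
  have t: "((\<lambda>x. tanh (rate * x)) has_real_derivative (1 - ?t\<^sup>2) * rate) (at x within A)"
    using c by (auto intro!: derivative_eq_intros)
  have "(dsol has_real_derivative - sqrt \<omega> * ((1 - ?t\<^sup>2) * rate * \<phi> x + ?t * dsol x)) (at x within A)"
    unfolding dsol_def[abs_def] mult.assoc
    by (rule DERIV_cong[OF DERIV_cmult[OF DERIV_mult[OF t soliton_deriv]]]) (simp add: dsol_def algebra_simps)
  moreover have "- sqrt \<omega> * ((1 - ?t\<^sup>2) * rate * \<phi> x + ?t * dsol x) = \<omega> * \<phi> x - \<phi> x * (\<phi> x) powr (p - 2)"
  proof -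
    have "(\<phi> x) powr (p - 2) = (1 - ?t\<^sup>2) * (\<omega> * p / 2)"
    proof -
      have "(\<phi> x) powr (p - 2) / (\<omega> * p / 2) = 1 - ?t\<^sup>2"
        using soliton_ratio[of x] by (simp only: powr_divide peak_powr)
      moreover have "\<omega> * p / 2 \<noteq> 0" using \<omega> p by simp
      ultimately show ?thesis by (metis nonzero_eq_divide_eq)
    qed
    moreover have "sqrt \<omega> * rate = \<omega> * (p - 2) / 2" using \<omega> by (simp add: rate_def)
    moreover have "sqrt \<omega> * sqrt \<omega> = \<omega>" using \<omega> by simp
    moreover have "- s * ((1 - t\<^sup>2) * r * f + t * (- s * t * f)) = w * f - f * ((1 - t\<^sup>2) * (w * p / 2))"
      if "s * r = w * (p - 2) / 2" "s * s = w" for s t r f w :: real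
    proof -
      have "- s * ((1 - t\<^sup>2) * r * f + t * (- s * t * f)) = - (s * r) * (1 - t\<^sup>2) * f + (s * s) * t\<^sup>2 * f"
        by (simp add: power2_eq_square algebra_simps)
      thus ?thesis unfolding that by (simp add: field_simps power2_eq_square)
    qed
    ultimately show ?thesis by (simp only: dsol_def)
  qed
  ultimately show ?thesis by simp
qed

text \<open>
  The equation \<open>\<phi>'' = \<omega> \<phi> - \<phi> powr (p - 1)\<close>, multiplied by \<open>\<phi>\<close>: the integrand on the left is the derivative of \<open>\<phi> \<phi>'\<close>.
\<close>

lemma soliton_nehari_identity:
  "(HINT x. (dsol (x + a))\<^sup>2) + \<omega> * (HINT x. (\<phi> (x + a))\<^sup>2)
     - (HINT x. \<phi> (x + a) powr p) = - (\<phi> a * dsol a)"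
proof -
  have i: "set_integrable lborel {0<..} (\<lambda>x. (dsol (x + a))\<^sup>2)"
    "set_integrable lborel {0<..} (\<lambda>x. \<omega> * (\<phi> (x + a))\<^sup>2)"
    "set_integrable lborel {0<..} (\<lambda>x. \<phi> (x + a) powr p)"
    using shifted_set_integrable p by auto
  note i12 = set_integral_add(1)[OF i(1,2)]
  have "(HINT x. (dsol (x + a))\<^sup>2 + \<omega> * (\<phi> (x + a))\<^sup>2 - \<phi> (x + a) powr p) = 0 - \<phi> (0 + a) * dsol (0 + a)"
  proof (rule FTC_halfline)
    fix x :: real
    have d: "((\<lambda>x. dsol (x + a)) has_real_derivative \<omega> * \<phi> (x + a) - \<phi> (x + a) * (\<phi> (x + a)) powr (p - 2)) (at x within {0..})"
    proof -
      have "((\<lambda>x. x + a) has_real_derivative 1) (at x within {0..})" by (auto intro!: derivative_eq_intros)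
      from DERIV_chain2[where f = dsol and g = "\<lambda>x. x + a", OF dsol_deriv this] show ?thesis by simp
    qed
    have pw: "\<phi> (x + a) powr p = (\<phi> (x + a))\<^sup>2 * \<phi> (x + a) powr (p - 2)"
      using soliton_pos[of "x + a"] by (simp add: powr_diff powr_numeral)
    show "((\<lambda>x. \<phi> (x + a) * dsol (x + a)) has_real_derivative (dsol (x + a))\<^sup>2 + \<omega> * (\<phi> (x + a))\<^sup>2 - \<phi> (x + a) powr p) (at x within {0..})"
      by (rule DERIV_cong[OF DERIV_mult[OF shifted_soliton_deriv d]], unfold pw) (simp add: power2_eq_square algebra_simps)
  next
    show "continuous_on {0..} (\<lambda>x. (dsol (x + a))\<^sup>2 + \<omega> * (\<phi> (x + a))\<^sup>2 - \<phi> (x + a) powr p)"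
      using soliton_pos by (intro continuous_intros shifted_continuous) (auto simp: less_imp_neq[symmetric])
    show "set_integrable lborel {0<..} (\<lambda>x. (dsol (x + a))\<^sup>2 + \<omega> * (\<phi> (x + a))\<^sup>2 - \<phi> (x + a) powr p)"
      by (rule set_integral_diff(1)[OF i12 i(3)])
    show "((\<lambda>x. \<phi> (x + a) * dsol (x + a)) \<longlongrightarrow> 0) at_top"
    proof (rule tendsto_rabs_zero_cancel, rule tendsto_sandwich[OF _ _ tendsto_const])
      show "((\<lambda>x. sqrt \<omega> * (\<phi> (x + a) * \<phi> (x + a))) \<longlongrightarrow> 0) at_top"
        by (intro tendsto_mult_right_zero tendsto_mult_zero soliton_tendsto_0)
      show "eventually (\<lambda>x. \<bar>\<phi> (x + a) * dsol (x + a)\<bar> \<le> sqrt \<omega> * (\<phi> (x + a) * \<phi> (x + a))) at_top"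
      proof (intro always_eventually allI)
        fix x
        have "\<phi> (x + a) * \<bar>dsol (x + a)\<bar> \<le> \<phi> (x + a) * (sqrt \<omega> * \<phi> (x + a))"
          using soliton_pos[of "x + a"] abs_dsol_le by (intro mult_left_mono) auto
        thus "\<bar>\<phi> (x + a) * dsol (x + a)\<bar> \<le> sqrt \<omega> * (\<phi> (x + a) * \<phi> (x + a))"
          using soliton_pos[of "x + a"] by (simp add: abs_mult mult_ac)
      qed
    qed auto
  qed
  thus ?thesis unfolding set_integral_diff(2)[OF i12 i(3)] set_integral_add(2)[OF i(1,2)] by simp
qed

section \<open>The reduced problem for the traces\<close>

text \<open>
  The least action, for functions of height \<open>peak\<close>, when the traces have moduli \<open>a\<close> and \<open>b\<close> and the peak lies on the
  side of \<open>a\<close>.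
\<close>

definition jump_cost :: "real \<Rightarrow> real \<Rightarrow> real \<Rightarrow> real" where
  "jump_cost \<beta> a b = 2 * cost peak - cost a + cost b + (a - b)\<^sup>2 / (2 * \<beta>)"

lemma slope_unimodal:
  obtains s where "0 < s" "s < peak" "\<And>x y. 0 \<le> x \<Longrightarrow> x < y \<Longrightarrow> y \<le> s \<Longrightarrow> slope x < slope y"
    "\<And>x y. s \<le> x \<Longrightarrow> x < y \<Longrightarrow> y \<le> peak \<Longrightarrow> slope y < slope x"
proof -
  (* The square of the slope has derivative \<open>2 * x * (\<omega> - x powr (p - 2))\<close>. *)
  define s where "s = \<omega> powr (1 / (p - 2))"
  have s: "0 < s" "s < peak"
    using p \<omega> powr_less_mono2[of "1 / (p - 2)" \<omega> "\<omega> * p / 2"] by (auto simp: s_def peak_def)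
  have sp: "s powr (p - 2) = \<omega>" using p \<omega> by (simp add: s_def powr_powr)
  define e where "e = (\<lambda>x. \<omega> * x\<^sup>2 - 2 / p * x powr p)"
  have e: "e x = (slope x)\<^sup>2" if "0 \<le> x" "x \<le> peak" for x using slope_squared that by (simp add: e_def)
  have de: "(e has_real_derivative 2 * x * (\<omega> - x powr (p - 2))) (at x)" if "x > 0" for x
  proof -
    have "(e has_real_derivative \<omega> * (2 * x) - 2 / p * (p * x powr (p - 1))) (at x)"
      unfolding e_def using that by (auto intro!: derivative_eq_intros)
    moreover have "x powr (p - 1) = x * x powr (p - 2)"
      using powr_add[of x 1 "p - 2"] that by simp
    ultimately show ?thesis using p by (simp add: algebra_simps)
  qed
  have ce: "continuous_on {x..y} e" if "0 \<le> x" for x y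
    unfolding e_def using that p by (intro continuous_intros continuous_on_powr') auto
  have up: "e x < e y" if "0 \<le> x" "x < y" "y \<le> s" for x y
  proof (rule DERIV_pos_imp_increasing_open[OF that(2)])
    fix z assume "x < z" "z < y"
    moreover have "z powr (p - 2) < s powr (p - 2)" using that p \<open>x < z\<close> \<open>z < y\<close> by (intro powr_less_mono2) auto
    ultimately show "\<exists>y. (e has_real_derivative y) (at z) \<and> 0 < y" using de[of z] that sp
      by (intro exI[of _ "2 * z * (\<omega> - z powr (p - 2))"]) auto
  qed (use ce that in auto)
  have down: "e y < e x" if "s \<le> x" "x < y" for x y
  proof (rule DERIV_neg_imp_decreasing_open[OF that(2)])
    fix z assume "x < z" "z < y"
    moreover have "s powr (p - 2) < z powr (p - 2)" using that p s \<open>x < z\<close> by (intro powr_less_mono2) auto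
    ultimately show "\<exists>y. (e has_real_derivative y) (at z) \<and> y < 0" using de[of z] that sp s
      by (intro exI[of _ "2 * z * (\<omega> - z powr (p - 2))"]) (auto simp: mult_pos_neg)
  qed (use ce that s in auto)
  show ?thesis
  proof (rule that[OF s])
    show "slope x < slope y" if "0 \<le> x" "x < y" "y \<le> s" for x y
      using up[OF that] that s slope_nonneg[of y] e[of x] e[of y] by (auto intro: power2_less_imp_less)
    show "slope y < slope x" if "s \<le> x" "x < y" "y \<le> peak" for x y
      using down[OF that(1,2)] that s slope_nonneg[of x] e[of x] e[of y] by (auto intro: power2_less_imp_less)
  qed
qed

lemma critical_point_unique:
  assumes \<beta>: "0 < \<beta>"
    and "0 \<le> b" "b < a" "a \<le> peak" "slope a = (a - b) / \<beta>" "slope b = (a - b) / \<beta>"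
    and "0 \<le> b'" "b' < a'" "a' \<le> peak" "slope a' = (a' - b') / \<beta>" "slope b' = (a' - b') / \<beta>"
  shows "a = a' \<and> b = b'"
proof -
  obtain s where s: "0 < s" "s < peak" and up: "\<And>x y. 0 \<le> x \<Longrightarrow> x < y \<Longrightarrow> y \<le> s \<Longrightarrow> slope x < slope y"
    and down: "\<And>x y. s \<le> x \<Longrightarrow> x < y \<Longrightarrow> y \<le> peak \<Longrightarrow> slope y < slope x"
    using slope_unimodal by metis
  have br: "b < s \<and> s < a" if "0 \<le> b" "b < a" "a \<le> peak" "slope a = slope b" for a b
    using up[of b a] down[of b a] that by (cases "a \<le> s"; cases "s \<le> b") auto
  have ab: "b < s" "s < a" "b' < s" "s < a'" using br[of b a] br[of b' a'] assms by auto
  (* A higher level of the slope brings the two points of that level closer together, whereas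
     the equation asks for a distance proportional to the level. *)
  have no: "\<not> slope a < slope a'" if "b < s" "s < a" "b' < s" "s < a'" "0 \<le> b" "0 \<le> b'" "a \<le> peak" "a' \<le> peak"
    "slope a = (a - b) / \<beta>" "slope b = (a - b) / \<beta>" "slope a' = (a' - b') / \<beta>" "slope b' = (a' - b') / \<beta>" for a b a' b'
  proof
    assume lt: "slope a < slope a'"
    have "a' < a" using down[of a a'] that lt linorder_less_linear[of a a'] by auto
    moreover have "b < b'" using up[of b' b] that lt linorder_less_linear[of b b'] by auto
    moreover have "(a - b) / \<beta> < (a' - b') / \<beta>" using lt that by simp
    hence "a - b < a' - b'" using \<beta> by (simp add: divide_less_cancel)
    ultimately show False by linarith
  qed
  have "slope a = slope a'"
    using no[of b a b' a'] no[of b' a' b a] ab assms by (meson linorder_less_linear)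
  moreover hence "slope b = slope b'" using assms by simp
  ultimately show ?thesis
    using down[of a a'] down[of a' a] up[of b b'] up[of b' b] ab assms
    by (metis less_irrefl less_imp_le linorder_less_linear)
qed

lemma jump_cost_partial:
  assumes "0 < \<beta>"
  shows "((\<lambda>x. jump_cost \<beta> x b) has_real_derivative - slope a + (a - b) / \<beta>) (at a)"
  "((\<lambda>x. jump_cost \<beta> a x) has_real_derivative slope b - (a - b) / \<beta>) (at b)"
  unfolding jump_cost_def using assms by (auto intro!: derivative_eq_intros cost_deriv simp: field_simps)

text \<open>
  The minimum is below the value \<open>2 * cost peak\<close> of the diagonal, which forces \<open>b < a\<close>. At \<open>a = peak\<close> the cost still
  grows in \<open>a\<close> and at \<open>b = 0\<close> it falls in \<open>b\<close>, because the slope vanishes there while the jump term does not.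
  So the minimum is a critical point.
\<close>

lemma jump_cost_minimum_interior:
  assumes \<beta>: "0 < \<beta>" and a: "0 \<le> a" "a \<le> peak" and b: "0 \<le> b" "b \<le> peak"
    and min: "\<And>x y. 0 \<le> x \<Longrightarrow> x \<le> peak \<Longrightarrow> 0 \<le> y \<Longrightarrow> y \<le> peak \<Longrightarrow> jump_cost \<beta> a b \<le> jump_cost \<beta> x y"
  shows "0 < b" "b < a" "a < peak" "slope a = (a - b) / \<beta>" "slope b = (a - b) / \<beta>"
proof -
  have lt: "jump_cost \<beta> a b < 2 * cost peak"
  proof -
    (* On the diagonal the cost is constantly \<open>2 * cost peak\<close>, and it drops as soon as the
       first argument grows. *)
    let ?c = "peak / 2"
    have "- slope ?c + (?c - ?c) / \<beta> < 0" using slope_pos[of ?c] peak_pos by simp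
    from DERIV_neg_dec_right[OF jump_cost_partial(1)[OF \<beta>] this]
    obtain d where d: "d > 0" "\<And>h. 0 < h \<Longrightarrow> h < d \<Longrightarrow> jump_cost \<beta> (?c + h) ?c < jump_cost \<beta> ?c ?c" by blast
    define h where "h = min (d / 2) ?c"
    have h: "0 < h" "h < d" "h \<le> ?c" using d peak_pos by (auto simp: h_def)
    have "jump_cost \<beta> a b \<le> jump_cost \<beta> (?c + h) ?c" by (rule min) (use h peak_pos in auto)
    also have "\<dots> < jump_cost \<beta> ?c ?c" using d h by blast
    finally show ?thesis by (simp add: jump_cost_def)
  qed
  have "cost b < cost a"
  proof -
    have "0 \<le> (a - b)\<^sup>2 / (2 * \<beta>)" using \<beta> by simp
    thus ?thesis using lt by (simp add: jump_cost_def)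
  qed
  thus ba: "b < a" using cost_strict_mono[of a b] a b linorder_less_linear[of a b] by auto
  show am: "a < peak"
  proof (rule ccontr)
    assume "\<not> a < peak"
    hence a1: "a = peak" using a by simp
    have "- slope a + (a - b) / \<beta> > 0" using a1 slope_peak ba \<beta> by simp
    from DERIV_pos_inc_left[OF jump_cost_partial(1)[OF \<beta>] this]
    obtain d where d: "d > 0" "\<And>h. 0 < h \<Longrightarrow> h < d \<Longrightarrow> jump_cost \<beta> (a - h) b < jump_cost \<beta> a b" by blast
    define h where "h = min (d / 2) peak"
    have h: "0 < h" "h < d" "h \<le> peak" using d peak_pos by (auto simp: h_def)
    have "jump_cost \<beta> a b \<le> jump_cost \<beta> (a - h) b" by (rule min) (use h a a1 b in auto)
    thus False using d(2)[OF h(1,2)] by linarith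
  qed
  show b0: "0 < b"
  proof (rule ccontr)
    assume "\<not> 0 < b"
    hence b1: "b = 0" using b by simp
    have "slope b - (a - b) / \<beta> < 0" using b1 ba \<beta> by simp
    from DERIV_neg_dec_right[OF jump_cost_partial(2)[OF \<beta>] this]
    obtain d where d: "d > 0" "\<And>h. 0 < h \<Longrightarrow> h < d \<Longrightarrow> jump_cost \<beta> a (b + h) < jump_cost \<beta> a b" by blast
    define h where "h = min (d / 2) peak"
    have h: "0 < h" "h < d" "h \<le> peak" using d peak_pos by (auto simp: h_def)
    have "jump_cost \<beta> a b \<le> jump_cost \<beta> a (b + h)" by (rule min) (use h a b1 in auto)
    thus False using d(2)[OF h(1,2)] by linarith
  qed
  have "- slope a + (a - b) / \<beta> = 0"
    by (rule DERIV_local_min[OF jump_cost_partial(1)[OF \<beta>], of "min a (peak - a)"]) (use ba b0 am b in \<open>auto intro!: min\<close>)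
  thus "slope a = (a - b) / \<beta>" by simp
  have "slope b - (a - b) / \<beta> = 0"
    by (rule DERIV_local_min[OF jump_cost_partial(2)[OF \<beta>], of "min b (peak - b)"]) (use ba b0 am a in \<open>auto intro!: min\<close>)
  thus "slope b = (a - b) / \<beta>" by simp
qed

lemma jump_cost_unique_minimum:
  assumes \<beta>: "0 < \<beta>"
  obtains a b where "0 < b" "b < a" "a < peak" "slope a = (a - b) / \<beta>" "slope b = (a - b) / \<beta>"
    "\<forall>x\<in>{0..peak}. \<forall>y\<in>{0..peak}. jump_cost \<beta> a b \<le> jump_cost \<beta> x y \<and>
      (jump_cost \<beta> x y \<le> jump_cost \<beta> a b \<longrightarrow> x = a \<and> y = b)"
proof -
  have cc: "continuous_on A cost" for A
    by (intro continuous_at_imp_continuous_on ballI DERIV_isCont[OF cost_deriv])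
  have c1: "continuous_on ({0..peak} \<times> {0..peak}) (\<lambda>z. jump_cost \<beta> (fst z) (snd z))"
    unfolding jump_cost_def using \<beta>
    by (intro continuous_intros continuous_on_compose2[OF cc[of UNIV]]) auto
  have c2: "compact ({0..peak} \<times> {0..peak})" by (intro compact_Times compact_Icc)
  have c3: "{0..peak} \<times> {0..peak} \<noteq> {}" using peak_pos by auto
  obtain z where z: "z \<in> {0..peak} \<times> {0..peak}"
    "\<And>w. w \<in> {0..peak} \<times> {0..peak} \<Longrightarrow> jump_cost \<beta> (fst z) (snd z) \<le> jump_cost \<beta> (fst w) (snd w)"
    using continuous_attains_inf[OF c2 c3 c1] by blast
  obtain a b where ab: "z = (a, b)" by (cases z)
  have r: "0 \<le> a" "a \<le> peak" "0 \<le> b" "b \<le> peak" using z(1) ab by auto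
  have min: "jump_cost \<beta> a b \<le> jump_cost \<beta> x y" if "0 \<le> x" "x \<le> peak" "0 \<le> y" "y \<le> peak" for x y
    using z(2)[of "(x, y)"] ab that by simp
  note int = jump_cost_minimum_interior[OF \<beta> r min]
  have uniq: "x = a \<and> y = b" if xy: "0 \<le> x" "x \<le> peak" "0 \<le> y" "y \<le> peak" "jump_cost \<beta> x y \<le> jump_cost \<beta> a b" for x y
  proof -
    have "jump_cost \<beta> x y \<le> jump_cost \<beta> x' y'" if "0 \<le> x'" "x' \<le> peak" "0 \<le> y'" "y' \<le> peak" for x' y'
      using min[OF that] xy(5) by linarith
    note int' = jump_cost_minimum_interior[OF \<beta> xy(1-4) this]
    show ?thesis
      by (rule critical_point_unique[OF \<beta>]) (use int int' in auto)
  qed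
  show ?thesis by (rule that[OF int]) (use min uniq in auto)
qed

section \<open>Curves with the speed of the soliton\<close>

lemma soliton_surj:
  assumes "0 < s" "s \<le> peak"
  obtains y where "0 \<le> y" "\<phi> y = s"
proof -
  have "eventually (\<lambda>x. \<phi> (x + 0) < s) at_top" using soliton_tendsto_0[of 0] assms by (intro order_tendstoD)
  hence "eventually (\<lambda>x. \<phi> x < s \<and> 0 \<le> x) at_top" using eventually_ge_at_top[of 0] by eventually_elim simp
  then obtain T where T: "\<phi> T < s" "0 \<le> T"
    using eventually_happens by (metis (no_types, lifting) trivial_limit_at_top_linorder)
  have "\<exists>y\<ge>0. y \<le> T \<and> \<phi> y = s"
    by (rule IVT2') (use T assms soliton_0 soliton_continuous in auto)
  thus ?thesis using that by blast
qed

text \<open>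
  The inverse of the soliton on its decreasing half: the distance from the peak at which the value \<open>s\<close> is reached.
\<close>

definition depth :: "real \<Rightarrow> real" where
  "depth s = arcosh ((peak / s) powr ((p - 2) / 2)) / rate"

lemma depth_soliton: "depth (\<phi> x) = \<bar>x\<bar>"
proof -
  have c: "cosh (rate * x) > 0" by (rule cosh_real_pos)
  have "peak / \<phi> x = cosh (rate * x) powr (2 / (p - 2))"
    using peak_pos by (simp add: soliton_eq powr_minus field_simps)
  hence "(peak / \<phi> x) powr ((p - 2) / 2) = cosh (rate * x) powr ((2 / (p - 2)) * ((p - 2) / 2))"
    by (simp only: powr_powr)
  also have "(2 / (p - 2)) * ((p - 2) / 2) = 1" using p by (simp add: field_simps)
  also have "cosh (rate * x) powr 1 = cosh (rate * \<bar>x\<bar>)" using c rate_pos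
    by (cases "x \<ge> 0") auto
  finally have "depth (\<phi> x) = arcosh (cosh (rate * \<bar>x\<bar>)) / rate" unfolding depth_def by simp
  also have "arcosh (cosh (rate * \<bar>x\<bar>)) = rate * \<bar>x\<bar>" using rate_pos by (intro arcosh_cosh_real) auto
  finally show ?thesis using rate_pos by simp
qed

lemma soliton_depth: "0 < s \<Longrightarrow> s \<le> peak \<Longrightarrow> \<phi> (depth s) = s \<and> 0 \<le> depth s"
  by (metis soliton_surj depth_soliton abs_of_nonneg)

lemma depth_continuous: "continuous_on {0<..peak} depth"
proof -
  have "1 \<le> (peak / s) powr ((p - 2) / 2)" if "s \<in> {0<..peak}" for s
    using that p by (intro ge_one_powr_ge_zero) auto
  thus ?thesis unfolding depth_def using rate_pos peak_pos p
    by (intro continuous_intros continuous_on_powr') auto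
qed

lemma depth_deriv:
  assumes "0 < s" "s < peak"
  shows "(depth has_real_derivative - 1 / slope s) (at s)"
proof -
  let ?Y = "(peak / s) powr ((p - 2) / 2)"
  have Y: "1 < ?Y" using assms p by (intro gr_one_powr) auto
  have dq: "((\<lambda>s. peak / s) has_real_derivative - peak / s\<^sup>2) (at s)"
    using assms by (auto intro!: derivative_eq_intros simp: power2_eq_square)
  have "((\<lambda>s. (peak / s) powr ((p - 2) / 2)) has_real_derivative ((p - 2) / 2) * (peak / s) powr ((p - 2) / 2 - 1) * (- peak / s\<^sup>2)) (at s)"
    using assms peak_pos DERIV_chain2[OF has_real_derivative_powr[of "peak / s" "(p - 2) / 2"] dq] by simp
  moreover have "((p - 2) / 2) * (peak / s) powr ((p - 2) / 2 - 1) * (- peak / s\<^sup>2) = - ((p - 2) / 2) * ?Y / s"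
  proof -
    have "(peak / s) powr ((p - 2) / 2 - 1) = ?Y / (peak / s)"
      using assms peak_pos by (simp only: powr_diff) simp
    moreover have "h * (Y / (M / s)) * (- M / s\<^sup>2) = - h * Y / s" if "M > 0" "s > 0" for h Y M s :: real
      using that by (simp add: power2_eq_square field_simps)
    ultimately show ?thesis using assms peak_pos by (simp only:)
  qed
  ultimately have dY: "((\<lambda>s. (peak / s) powr ((p - 2) / 2)) has_real_derivative - ((p - 2) / 2) * ?Y / s) (at s)"
    by simp
  have "((\<lambda>s. arcosh ((peak / s) powr ((p - 2) / 2))) has_real_derivative (1 / sqrt (?Y\<^sup>2 - 1)) * (- ((p - 2) / 2) * ?Y / s)) (at s)"
    by (rule DERIV_chain2[where f = arcosh and g = "\<lambda>s. (peak / s) powr ((p - 2) / 2)",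
          OF arcosh_real_has_field_derivative[OF Y] dY])
  hence "(depth has_real_derivative (1 / sqrt (?Y\<^sup>2 - 1)) * (- ((p - 2) / 2) * ?Y / s) / rate) (at s)"
    unfolding depth_def[abs_def] by (rule DERIV_cdivide)
  moreover have "(1 / sqrt (?Y\<^sup>2 - 1)) * (- ((p - 2) / 2) * ?Y / s) / rate = - 1 / slope s"
  proof -
    have Y2: "(s / peak) powr (p - 2) = 1 / ?Y\<^sup>2"
    proof -
      have "?Y\<^sup>2 = ?Y powr 2" using Y by (simp add: powr_numeral)
      also have "\<dots> = (peak / s) powr ((p - 2) / 2 * 2)" by (simp only: powr_powr)
      also have "(p - 2) / 2 * 2 = p - 2" by simp
      finally show ?thesis using assms peak_pos by (simp add: powr_divide)
    qed
    have "1 - 1 / Y\<^sup>2 = (Y\<^sup>2 - 1) / Y\<^sup>2" if "1 < Y" for Y :: real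
      using that by (simp add: field_simps)
    hence "1 - 1 / ?Y\<^sup>2 = (?Y\<^sup>2 - 1) / ?Y\<^sup>2" using Y by blast
    hence "sqrt (1 - 1 / ?Y\<^sup>2) = sqrt ((?Y\<^sup>2 - 1) / ?Y\<^sup>2)" by (rule arg_cong)
    also have "\<dots> = sqrt (?Y\<^sup>2 - 1) / ?Y" using Y by (simp add: real_sqrt_divide)
    finally have "slope s = sqrt \<omega> * s * (sqrt (?Y\<^sup>2 - 1) / ?Y)"
      using slope_eq[of s] assms by (simp add: Y2)
    moreover have "1 / R * (- h * Y / s) / (h * w) = - 1 / (w * s * (R / Y))"
      if "h > 0" "w > 0" "R > 0" "Y > 0" "s > 0" for h R Y s w :: real
      using that by (simp add: field_simps)
    moreover have "sqrt (?Y\<^sup>2 - 1) > 0" using Y by (simp add: one_less_power)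
    ultimately show ?thesis using Y assms p \<omega> by (simp add: rate_def del: real_sqrt_gt_0_iff)
  qed
  ultimately show ?thesis by simp
qed


text \<open>
  The inequality \<open>\<bar>r'\<bar> \<le> slope r\<close>, integrated.
\<close>

definition slope_bounded :: "(real \<Rightarrow> real) \<Rightarrow> bool" where
  "slope_bounded r \<longleftrightarrow> continuous_on {0..} r \<and> (\<forall>x\<ge>0. 0 \<le> r x \<and> r x \<le> peak) \<and>
     (\<forall>s t. 0 \<le> s \<longrightarrow> s \<le> t \<longrightarrow> \<bar>r t - r s\<bar> \<le> (LINT x:{s..t}|lborel. \<bar>slope (r x)\<bar>))"

lemma profile_slope_imp_slope_bounded:
  assumes pr: "profile r k" and M: "\<And>x. 0 \<le> x \<Longrightarrow> r x \<le> peak"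
    and eq: "AE x in lborel. 0 < x \<longrightarrow> k x = slope (r x)"
  shows "slope_bounded r"
proof -
  have cont: "continuous_on {0..} r" and r0: "\<And>x. 0 \<le> x \<Longrightarrow> 0 \<le> r x"
    and kT: "\<And>T. set_integrable lborel {0..T} k"
    and rk: "\<And>s t. 0 \<le> s \<Longrightarrow> s \<le> t \<Longrightarrow> \<bar>r t - r s\<bar> \<le> (LINT x:{s..t}|lborel. k x)"
    using pr by (auto simp: profile_def)
  have "(LINT x:{s..t}|lborel. k x) = (LINT x:{s..t}|lborel. \<bar>slope (r x)\<bar>)" if "0 \<le> s" for s t
    unfolding set_integral_Icc_eq_Ioc unfolding set_lebesgue_integral_def
  proof (rule integral_cong_AE)
    have "set_integrable lborel {s<..t} k" by (rule set_integrable_subset[OF kT[of t]]) (use that in auto)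
    thus "(\<lambda>x. indicat_real {s<..t} x *\<^sub>R k x) \<in> borel_measurable lborel"
      unfolding set_integrable_def by (rule borel_measurable_integrable)
    have "continuous_on {s..t} (\<lambda>x. \<bar>slope (r x)\<bar>)"
      by (intro continuous_intros continuous_on_compose2[OF slope_continuous[of UNIV]] continuous_on_subset[OF cont]) (use that in auto)
    hence "set_integrable lborel {s<..t} (\<lambda>x. \<bar>slope (r x)\<bar>)"
      unfolding set_integrable_Icc_iff_Ioc[symmetric] by (rule borel_integrable_atLeastAtMost')
    thus "(\<lambda>x. indicat_real {s<..t} x *\<^sub>R \<bar>slope (r x)\<bar>) \<in> borel_measurable lborel"
      unfolding set_integrable_def by (rule borel_measurable_integrable)
    show "AE x in lborel. indicat_real {s<..t} x *\<^sub>R k x = indicat_real {s<..t} x *\<^sub>R \<bar>slope (r x)\<bar>"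
      using eq by eventually_elim (use that r0 slope_nonneg in \<open>auto split: split_indicator\<close>)
  qed
  thus ?thesis unfolding slope_bounded_def using cont r0 M rk by metis
qed

lemma slope_bounded_chain_bound:
  assumes st: "slope_bounded r" and s: "0 \<le> s" "s \<le> t"
    and lo: "\<And>x. x \<in> {s..t} \<Longrightarrow> lo \<le> r x"
    and \<Phi>: "\<And>y. y \<in> {lo..peak} \<Longrightarrow> (\<Phi> has_real_derivative \<psi> y) (at y within {lo..peak})"
    and \<psi>: "continuous_on {lo..peak} \<psi>"
    and B: "\<And>x. x \<in> {s..t} \<Longrightarrow> \<bar>\<psi> (r x)\<bar> * \<bar>slope (r x)\<bar> \<le> B"
  shows "\<bar>\<Phi> (r t) - \<Phi> (r s)\<bar> \<le> B * (t - s)"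
proof -
  have cont: "continuous_on {s..t} r" using st s by (auto simp: slope_bounded_def intro: continuous_on_subset)
  have ci: "set_integrable lborel {s..t} (\<lambda>x. \<bar>slope (r x)\<bar>)"
    by (intro borel_integrable_atLeastAtMost' continuous_intros continuous_on_compose2[OF slope_continuous[of UNIV] cont]) auto
  have chain: "set_integrable lborel {s..t} (\<lambda>x. \<bar>\<psi> (r x)\<bar> * \<bar>slope (r x)\<bar>)"
    "\<bar>\<Phi> (r t) - \<Phi> (r s)\<bar> \<le> (LINT x:{s..t}|lborel. \<bar>\<psi> (r x)\<bar> * \<bar>slope (r x)\<bar>)"
    using chain_rule_bound[OF s(2) cont _ ci _ _ \<Phi> \<psi>] st s lo by (auto simp: slope_bounded_def)
  note chain(2)
  also have "(LINT x:{s..t}|lborel. \<bar>\<psi> (r x)\<bar> * \<bar>slope (r x)\<bar>) \<le> (LINT x:{s..t}|lborel. B)"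
    by (rule set_integral_mono[OF chain(1)]) (use B in \<open>auto intro!: borel_integrable_atLeastAtMost' continuous_intros\<close>)
  also have "\<dots> = B * (t - s)" using s by (simp add: set_lebesgue_integral_def)
  finally show ?thesis .
qed

text \<open>
  As \<open>slope s \<le> sqrt \<omega> * s\<close>, the logarithm of \<open>r\<close> has slope at most \<open>sqrt \<omega>\<close>. The shift by \<open>e\<close> admits zeros of \<open>r\<close>.
\<close>

lemma slope_bounded_log_bound:
  assumes st: "slope_bounded r" and s: "0 \<le> s" "s \<le> t" and e: "0 < e"
  shows "\<bar>ln (r t + e) - ln (r s + e)\<bar> \<le> sqrt \<omega> * (t - s)"
proof (rule slope_bounded_chain_bound[OF st s, where lo = 0 and \<Phi> = "\<lambda>y. ln (y + e)" and \<psi> = "\<lambda>y. 1 / (y + e)"])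
  show "0 \<le> r x" if "x \<in> {s..t}" for x using that s st by (auto simp: slope_bounded_def)
  show "((\<lambda>y. ln (y + e)) has_real_derivative 1 / (y + e)) (at y within {0..peak})" if "y \<in> {0..peak}" for y
    using that e by (auto intro!: derivative_eq_intros)
  show "continuous_on {0..peak} (\<lambda>y. 1 / (y + e))" using e by (intro continuous_intros) auto
  fix x assume "x \<in> {s..t}"
  hence r: "0 \<le> r x" using s st by (auto simp: slope_bounded_def)
  have "slope (r x) \<le> sqrt \<omega> * r x" by (rule slope_le[OF r])
  also have "\<dots> \<le> sqrt \<omega> * (r x + e)" using \<omega> e by simp
  finally show "\<bar>1 / (r x + e)\<bar> * \<bar>slope (r x)\<bar> \<le> sqrt \<omega>"
    using r e slope_nonneg[OF r] by (simp add: field_simps)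
qed

lemma slope_bounded_positive:
  assumes st: "slope_bounded r" and x: "0 \<le> x0" "0 < r x0" "0 \<le> x"
  shows "0 < r x"
proof -
  (* The bound on the shifted logarithm survives the limit in which the shift tends to 0. *)
  define c where "c = r x0 * exp (- sqrt \<omega> * \<bar>x - x0\<bar>)"
  have "c \<le> r x + e" if e: "e > 0" for e
  proof -
    have r: "0 \<le> r x" using st x by (auto simp: slope_bounded_def)
    have "\<bar>ln (r x + e) - ln (r x0 + e)\<bar> \<le> sqrt \<omega> * \<bar>x - x0\<bar>"
      using slope_bounded_log_bound[OF st x(1) _ e, of x] slope_bounded_log_bound[OF st x(3) _ e, of x0]
      by (cases "x0 \<le> x") (auto simp: abs_minus_commute)
    hence "ln (r x0 + e) + - sqrt \<omega> * \<bar>x - x0\<bar> \<le> ln (r x + e)" by simp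
    hence "exp (ln (r x0 + e) + - sqrt \<omega> * \<bar>x - x0\<bar>) \<le> exp (ln (r x + e))" by simp
    hence "(r x0 + e) * exp (- sqrt \<omega> * \<bar>x - x0\<bar>) \<le> r x + e"
      unfolding exp_add using x e r by simp
    moreover have "c \<le> (r x0 + e) * exp (- sqrt \<omega> * \<bar>x - x0\<bar>)"
      unfolding c_def using e by (intro mult_right_mono) auto
    ultimately show ?thesis by linarith
  qed
  hence "c \<le> r x" by (rule field_le_epsilon)
  moreover have "c > 0" using x by (simp add: c_def)
  ultimately show ?thesis by linarith
qed

text \<open>
  The quotient \<open>slope s / s\<close> decreases in \<open>s\<close>.
\<close>

lemma slope_shrink:
  assumes "0 < s" "s \<le> peak" "0 < \<delta>" "\<delta> < 1"
  shows "(1 - \<delta>) * slope s \<le> slope ((1 - \<delta>) * s)" "0 < slope ((1 - \<delta>) * s)"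
proof -
  have le: "(1 - \<delta>) * s < s" using assms by (simp add: algebra_simps)
  have pos: "0 < (1 - \<delta>) * s" using assms by simp
  have "((1 - \<delta>) * s / peak) powr (p - 2) \<le> (s / peak) powr (p - 2)"
    using le pos peak_pos p by (intro powr_mono2 divide_right_mono less_imp_le[OF le]) auto
  hence "(sqrt \<omega> * ((1 - \<delta>) * s)) * sqrt (1 - (s / peak) powr (p - 2)) \<le> (sqrt \<omega> * ((1 - \<delta>) * s)) * sqrt (1 - ((1 - \<delta>) * s / peak) powr (p - 2))"
    using pos \<omega> by (intro mult_left_mono) auto
  thus "(1 - \<delta>) * slope s \<le> slope ((1 - \<delta>) * s)"
    using slope_eq[of s] slope_eq[of "(1 - \<delta>) * s"] assms pos le by (simp add: mult_ac)
  show "0 < slope ((1 - \<delta>) * s)" by (rule slope_pos[OF pos]) (use le assms in linarith)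
qed

text \<open>
  In the coordinate \<open>depth\<close> the soliton moves with speed one, so every curve bounded by the slope moves at most with
  speed one. The derivative of \<open>depth\<close> is infinite at the peak, which the curve may touch; a slight shrinking of the
  values avoids this.
\<close>

lemma slope_bounded_depth_Lipschitz:
  assumes st: "slope_bounded r" and x0: "0 \<le> x0" "0 < r x0" and s: "0 \<le> s" "s \<le> t"
  shows "\<bar>depth (r t) - depth (r s)\<bar> \<le> t - s"
proof -
  have cont: "continuous_on {s..t} r" using st s by (auto simp: slope_bounded_def intro: continuous_on_subset)
  have pos: "0 < r x" if "0 \<le> x" for x by (rule slope_bounded_positive[OF st x0 that])
  have le: "r x \<le> peak" if "0 \<le> x" for x using st that by (auto simp: slope_bounded_def)
  obtain xm where xm: "xm \<in> {s..t}" "\<And>x. x \<in> {s..t} \<Longrightarrow> r xm \<le> r x"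
    using continuous_attains_inf[OF compact_Icc _ cont] s by auto
  (* Away from the values 0 and \<open>peak\<close> the function \<open>depth\<close> has derivative \<open>- 1 / slope\<close>. The factor
     \<open>1 - \<delta>\<close> keeps the values below the peak, and it only decreases the product with the slope. *)
  define m where "m = r xm"
  have m: "0 < m" "m \<le> peak" using pos le xm s by (auto simp: m_def)
  have bound: "\<bar>depth ((1 - \<delta>) * r t) - depth ((1 - \<delta>) * r s)\<bar> \<le> 1 * (t - s)" if \<delta>: "0 < \<delta>" "\<delta> < 1" for \<delta>
  proof (rule slope_bounded_chain_bound[OF st s, where lo = m and \<Phi> = "\<lambda>y. depth ((1 - \<delta>) * y)" and \<psi> = "\<lambda>y. - 1 / slope ((1 - \<delta>) * y) * (1 - \<delta>)"])
    show "m \<le> r x" if "x \<in> {s..t}" for x using xm that by (simp add: m_def)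
    show "((\<lambda>y. depth ((1 - \<delta>) * y)) has_real_derivative - 1 / slope ((1 - \<delta>) * y) * (1 - \<delta>)) (at y within {m..peak})"
      if y: "y \<in> {m..peak}" for y
    proof (rule DERIV_chain2[where f = depth and g = "\<lambda>y. (1 - \<delta>) * y"])
      have "\<delta> * y > 0" using \<delta> y m by simp
      hence "(1 - \<delta>) * y < peak" using y by (simp add: algebra_simps)
      thus "(depth has_real_derivative - 1 / slope ((1 - \<delta>) * y)) (at ((1 - \<delta>) * y))"
        using y m \<delta> by (intro depth_deriv) auto
    qed (auto intro!: derivative_eq_intros)
    show "continuous_on {m..peak} (\<lambda>y. - 1 / slope ((1 - \<delta>) * y) * (1 - \<delta>))"
    proof (intro continuous_intros continuous_on_compose2[OF slope_continuous[of UNIV]])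
      show "\<forall>y\<in>{m..peak}. slope ((1 - \<delta>) * y) \<noteq> 0"
      proof
        fix y assume "y \<in> {m..peak}"
        thus "slope ((1 - \<delta>) * y) \<noteq> 0" using slope_shrink(2)[of y \<delta>] \<delta> m by auto
      qed
    qed auto
    fix x assume x: "x \<in> {s..t}"
    have r: "0 < r x" "r x \<le> peak" using pos le s x by auto
    note sh = slope_shrink[OF r \<delta>]
    have "\<bar>- 1 / slope ((1 - \<delta>) * r x) * (1 - \<delta>)\<bar> * \<bar>slope (r x)\<bar> = (1 - \<delta>) * slope (r x) / slope ((1 - \<delta>) * r x)"
      using sh(2) \<delta> slope_nonneg[of "r x"] r by (simp add: abs_mult)
    also have "\<dots> \<le> 1" using sh by (simp add: divide_le_eq)
    finally show "\<bar>- 1 / slope ((1 - \<delta>) * r x) * (1 - \<delta>)\<bar> * \<bar>slope (r x)\<bar> \<le> 1" .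
  qed
  have lim: "(\<lambda>n. depth ((1 - inverse (real (Suc (Suc n)))) * y)) \<longlonglongrightarrow> depth y" if y: "0 < y" "y \<le> peak" for y
  proof (rule continuous_on_tendsto_compose[OF depth_continuous])
    have "(\<lambda>n. inverse (real (Suc (Suc n)))) \<longlonglongrightarrow> 0" using LIMSEQ_Suc[OF LIMSEQ_inverse_real_of_nat] by simp
    hence "(\<lambda>n. (1 - inverse (real (Suc (Suc n)))) * y) \<longlonglongrightarrow> (1 - 0) * y" by (intro tendsto_intros)
    thus "(\<lambda>n. (1 - inverse (real (Suc (Suc n)))) * y) \<longlonglongrightarrow> y" by simp
    show "eventually (\<lambda>n. (1 - inverse (real (Suc (Suc n)))) * y \<in> {0<..peak}) sequentially"
    proof (intro always_eventually allI)
      fix n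
      define c where "c = 1 - inverse (real (Suc (Suc n)))"
      have "0 < c" "c \<le> 1" by (auto simp: c_def field_simps)
      hence "0 < c * y" "c * y \<le> 1 * y" using y by (simp, intro mult_right_mono, auto)
      hence "0 < c * y" "c * y \<le> peak" using y by linarith+
      thus "(1 - inverse (real (Suc (Suc n)))) * y \<in> {0<..peak}"
        unfolding c_def[symmetric] by simp
    qed
  qed (use y in auto)
  show ?thesis
  proof (rule tendsto_upperbound)
    show "(\<lambda>n. \<bar>depth ((1 - inverse (real (Suc (Suc n)))) * r t) - depth ((1 - inverse (real (Suc (Suc n)))) * r s)\<bar>) \<longlonglongrightarrow> \<bar>depth (r t) - depth (r s)\<bar>"
      by (intro tendsto_intros lim) (use pos le s in auto)
    show "eventually (\<lambda>n. \<bar>depth ((1 - inverse (real (Suc (Suc n)))) * r t) - depth ((1 - inverse (real (Suc (Suc n)))) * r s)\<bar> \<le> t - s) sequentially"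
    proof (intro always_eventually allI)
      fix n
      have "0 < inverse (real (Suc (Suc n)))" "inverse (real (Suc (Suc n))) < 1" by (auto simp: field_simps)
      from bound[OF this] show "\<bar>depth ((1 - inverse (real (Suc (Suc n)))) * r t) - depth ((1 - inverse (real (Suc (Suc n)))) * r s)\<bar> \<le> t - s" by simp
    qed
  qed simp
qed

text \<open>
  Starting from the same value, no curve bounded by the slope falls below the descending soliton.
\<close>

lemma slope_bounded_lower_bound:
  assumes st: "slope_bounded r" and x0: "0 \<le> x0" "0 < r x0" and x: "0 \<le> x"
  shows "\<phi> (depth (r x0) + \<bar>x - x0\<bar>) \<le> r x"
proof -
  have r: "0 < r x" "r x \<le> peak" using slope_bounded_positive[OF st x0 x] st x by (auto simp: slope_bounded_def)
  have "\<bar>depth (r x) - depth (r x0)\<bar> \<le> \<bar>x - x0\<bar>"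
    using slope_bounded_depth_Lipschitz[OF st x0, of x x0] slope_bounded_depth_Lipschitz[OF st x0, of x0 x] x x0
    by (cases "x \<le> x0") (auto simp: abs_minus_commute)
  hence d: "depth (r x) \<le> depth (r x0) + \<bar>x - x0\<bar>" by linarith
  have "\<phi> (depth (r x0) + \<bar>x - x0\<bar>) \<le> \<phi> (depth (r x))"
    using soliton_strict_antimono[of "depth (r x)" "depth (r x0) + \<bar>x - x0\<bar>"] d soliton_depth[OF r]
    by (cases "depth (r x) = depth (r x0) + \<bar>x - x0\<bar>") auto
  thus ?thesis using soliton_depth[OF r] by simp
qed

text \<open>
  This is the case of equality in the triangle inequality.
\<close>

lemma phase_alignment:
  fixes z w :: complex
  assumes "norm (z - w) \<le> \<bar>norm z - norm w\<bar>"
  shows "norm w *\<^sub>R z = norm z *\<^sub>R w"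
proof -
  have gen: "norm w *\<^sub>R z = norm z *\<^sub>R w" if "norm (z - w) \<le> norm z - norm w" for z w :: complex
  proof -
    have "norm (w + (z - w)) = norm w + norm (z - w)" using that norm_triangle_ineq2[of z w] by simp
    hence "norm w *\<^sub>R (z - w) = norm (z - w) *\<^sub>R w" by (simp only: norm_triangle_eq)
    moreover have "norm (z - w) = norm z - norm w" using that norm_triangle_ineq2[of z w] by simp
    ultimately show ?thesis by (simp add: algebra_simps)
  qed
  show ?thesis
    using gen[of z w] gen[of w z] assms by (cases "norm w \<le> norm z") (auto simp: norm_minus_commute)
qed

text \<open>
  On an interval on which \<open>\<phi>\<close> is monotone, the increment of \<open>v\<close> is at most the integral of \<open>\<bar>\<phi>'\<bar>\<close>, which is the
  increment of the modulus. Hence \<open>v\<close> stays on one ray.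
\<close>

lemma soliton_phase:
  assumes rep: "H1_rep v g" and v: "\<And>x. 0 \<le> x \<Longrightarrow> norm (v x) = \<phi> (x + c)"
    and g: "AE x in lborel. 0 < x \<longrightarrow> norm (g x) = slope (norm (v x))"
  obtains z where "norm z = 1" "\<And>x. 0 \<le> x \<Longrightarrow> v x = z * complex_of_real (\<phi> (x + c))"
proof -
  have gm: "loc_int g" using rep unfolding H1_rep_def by (blast intro: L2_on_loc_int)
  have incr: "norm (v t - v s) \<le> \<bar>norm (v t) - norm (v s)\<bar>" if st: "0 \<le> s" "s \<le> t" and side: "0 \<le> s + c \<or> t + c \<le> 0" for s t
  proof -
    have i: "set_integrable lborel {s..t} g" by (rule loc_intD[OF st(1) gm])
    have "norm (v t - v s) \<le> (LINT x:{s..t}|lborel. norm (g x))"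
      unfolding H1_rep_increment[OF rep st] by (rule set_integral_norm_bound[OF i])
    also have "\<dots> = (LINT x:{s<..t}|lborel. norm (g x))" by (rule set_integral_Icc_eq_Ioc)
    also have "\<dots> = (LINT x:{s<..t}|lborel. slope (\<phi> (x + c)))"
      unfolding set_lebesgue_integral_def
    proof (rule integral_cong_AE)
      have "integrable lborel (\<lambda>x. norm (indicat_real {s<..t} x *\<^sub>R g x))"
        using i[unfolded set_integrable_Icc_iff_Ioc] unfolding set_integrable_def by (rule integrable_norm)
      hence "set_integrable lborel {s<..t} (\<lambda>x. norm (g x))" by (simp add: set_integrable_def)
      thus "(\<lambda>x. indicat_real {s<..t} x *\<^sub>R norm (g x)) \<in> borel_measurable lborel"
        unfolding set_integrable_def by (rule borel_measurable_integrable)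
      have "set_integrable lborel {s<..t} (\<lambda>x. slope (\<phi> (x + c)))"
        unfolding set_integrable_Icc_iff_Ioc[symmetric]
        by (intro borel_integrable_atLeastAtMost' continuous_on_compose2[OF slope_continuous[of UNIV]] shifted_continuous) auto
      thus "(\<lambda>x. indicat_real {s<..t} x *\<^sub>R slope (\<phi> (x + c))) \<in> borel_measurable lborel"
        unfolding set_integrable_def by (rule borel_measurable_integrable)
      show "AE x in lborel. indicat_real {s<..t} x *\<^sub>R norm (g x) = indicat_real {s<..t} x *\<^sub>R slope (\<phi> (x + c))"
        using g by eventually_elim (use st v in \<open>auto split: split_indicator\<close>)
    qed
    also have "\<dots> = (LINT x:{s..t}|lborel. slope (\<phi> (x + c)))" by (rule set_integral_Icc_eq_Ioc[symmetric])
    also have "\<dots> \<le> \<bar>\<phi> (t + c) - \<phi> (s + c)\<bar>"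
    proof -
      have FTC: "(LINT x:{s..t}|lborel. dsol (x + c)) = \<phi> (t + c) - \<phi> (s + c)"
        unfolding set_lebesgue_integral_def
        by (rule integral_FTC_atLeastAtMost[OF st(2)])
           (auto simp: has_real_derivative_iff_has_vector_derivative[symmetric] intro!: shifted_soliton_deriv shifted_continuous)
      show ?thesis
      proof (cases "0 \<le> s + c")
        case True
        have "(LINT x:{s..t}|lborel. slope (\<phi> (x + c))) = (LINT x:{s..t}|lborel. - dsol (x + c))"
          by (rule set_lebesgue_integral_cong) (use True dsol_right in auto)
        also have "\<dots> = - (LINT x:{s..t}|lborel. dsol (x + c))"
          by (intro set_integral_uminus borel_integrable_atLeastAtMost' shifted_continuous)
        finally show ?thesis using FTC by simp
      next
        case False
        hence "(LINT x:{s..t}|lborel. slope (\<phi> (x + c))) = (LINT x:{s..t}|lborel. dsol (x + c))"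
          using side by (intro set_lebesgue_integral_cong) (use dsol_left in auto)
        thus ?thesis using FTC by simp
      qed
    qed
    finally show ?thesis using v st by simp
  qed
  (* The maximum of the modulus is the pivot: on either side of it the modulus is monotone. *)
  define x0 where "x0 = max 0 (- c)"
  define z where "z = v x0 / complex_of_real (\<phi> (x0 + c))"
  have x0: "0 \<le> x0" by (simp add: x0_def)
  have "norm z = 1" using v[OF x0] soliton_pos[of "x0 + c"] by (simp add: z_def norm_divide)
  moreover have "v x = z * complex_of_real (\<phi> (x + c))" if x: "0 \<le> x" for x
  proof -
    have "norm (v x - v x0) \<le> \<bar>norm (v x) - norm (v x0)\<bar>"
    proof (cases "x0 \<le> x")
      case True
      have "0 \<le> x0 + c" by (simp add: x0_def)
      thus ?thesis using incr[OF x0 True] by blast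
    next
      case False
      hence "x0 = - c" using x by (auto simp: x0_def max_def split: if_splits)
      thus ?thesis using incr[of x x0] x False by (simp add: norm_minus_commute abs_minus_commute)
    qed
    hence "norm (v x0) *\<^sub>R v x = norm (v x) *\<^sub>R v x0" by (rule phase_alignment)
    hence "complex_of_real (\<phi> (x0 + c)) * v x = complex_of_real (\<phi> (x + c)) * v x0"
      using v[OF x0] v[OF x] by (simp add: scaleR_conv_of_real)
    thus ?thesis using soliton_pos[of "x0 + c"] by (simp add: z_def field_simps)
  qed
  ultimately show ?thesis using that by blast
qed

end

section \<open>The sharp lower bound\<close>

lemma continuous_eq_of_integral_le:
  fixes f g :: "real \<Rightarrow> real"
  assumes c: "continuous_on {0..} f" "continuous_on {0..} g"
    and le: "\<And>x. 0 \<le> x \<Longrightarrow> 0 \<le> g x \<and> g x \<le> f x" and p: "0 < p"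
    and i: "set_integrable lborel {0<..} (\<lambda>x. f x powr p)" "set_integrable lborel {0<..} (\<lambda>x. g x powr p)"
    and int: "(HINT x. f x powr p) \<le> (HINT x. g x powr p)"
    and x: "0 \<le> x"
  shows "f x = g x"
proof -
  define h where "h = (\<lambda>x. f x powr p - g x powr p)"
  have hi: "set_integrable lborel {0<..} h" unfolding h_def by (rule set_integral_diff(1)[OF i])
  have h0: "0 \<le> h x" if "0 \<le> x" for x
    unfolding h_def using le[OF that] p by (simp add: powr_mono2)
  have "(HINT x. h x) \<le> 0" unfolding h_def set_integral_diff(2)[OF i] using int by simp
  moreover have "0 \<le> (HINT x. h x)"
    unfolding set_lebesgue_integral_def by (rule integral_nonneg_AE) (use h0 in \<open>auto split: split_indicator\<close>)
  ultimately have "(LINT x|lborel. indicator {0<..} x *\<^sub>R h x) = 0" unfolding set_lebesgue_integral_def by linarith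
  hence "AE x in lborel. indicator {0<..} x *\<^sub>R h x = 0"
    using hi unfolding set_integrable_def
    by (subst (asm) integral_nonneg_eq_0_iff_AE) (use h0 in \<open>auto split: split_indicator\<close>)
  hence ae: "AE x in lborel. x \<in> {0<..} \<longrightarrow> f x = g x"
  proof eventually_elim
    case (elim x)
    show ?case
    proof
      assume "x \<in> {0<..}"
      hence *: "f x powr p = g x powr p" "0 \<le> g x" "g x \<le> f x" using elim le[of x] by (auto simp: h_def)
      show "f x = g x"
      proof (rule ccontr)
        assume "f x \<noteq> g x"
        hence "g x powr p < f x powr p" using * p by (intro powr_less_mono2) auto
        thus False using *(1) by linarith
      qed
    qed
  qed
  have sub: "{0<..} \<subseteq> {0::real..}" by auto
  have eq: "f x = g x" if "x > 0" for x
    using continuous_AE_eq_imp_eq[OF continuous_on_subset[OF c(1) sub] continuous_on_subset[OF c(2) sub] open_greaterThan ae] that by auto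
  show ?thesis
  proof (cases "x = 0")
    case True
    have "(f \<longlongrightarrow> f 0) (at 0 within {0<..})" "(g \<longlongrightarrow> g 0) (at 0 within {0<..})"
      using c by (auto simp: continuous_on intro: tendsto_within_subset[OF _ sub])
    moreover have "eventually (\<lambda>x. f x = g x) (at 0 within {0<..})" using eq by (auto simp: eventually_at_filter)
    ultimately have "(g \<longlongrightarrow> f 0) (at 0 within {0<..})" by (metis Lim_transform_eventually)
    thus ?thesis using \<open>(g \<longlongrightarrow> g 0) (at 0 within {0<..})\<close> True
      by (metis tendsto_unique trivial_limit_at_right_real)
  qed (use eq x in auto)
qed

lemma profile_scale:
  assumes "profile r k" "0 \<le> t"
  shows "profile (\<lambda>x. t * r x) (\<lambda>x. t * k x)"
proof -
  have m: "set_borel_measurable lborel {0<..} (\<lambda>x. t * k x)"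
  proof -
    have "(\<lambda>x. indicator {0<..} x *\<^sub>R k x) \<in> borel_measurable lborel" using assms by (simp add: profile_def set_borel_measurable_def)
    hence "(\<lambda>x. t * (indicator {0<..} x *\<^sub>R k x)) \<in> borel_measurable lborel"
      by (rule borel_measurable_times[OF borel_measurable_const])
    thus ?thesis by (simp add: set_borel_measurable_def mult.left_commute)
  qed
  have "\<bar>t * r y - t * r s\<bar> \<le> t * (LINT x:{s..y}|lborel. k x)" if "0 \<le> s" "s \<le> y" for s y
  proof -
    have "\<bar>t * r y - t * r s\<bar> = t * \<bar>r y - r s\<bar>" using assms(2) by (simp add: right_diff_distrib[symmetric] abs_mult)
    also have "\<dots> \<le> t * (LINT x:{s..y}|lborel. k x)"
      using assms that by (intro mult_left_mono) (auto simp: profile_def)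
    finally show ?thesis .
  qed
  thus ?thesis using assms m unfolding profile_def by (auto simp: power_mult_distrib intro!: continuous_intros)
qed

text \<open>
  The action of \<open>t u\<close> for \<open>u\<close> on the Nehari manifold, divided by the \<open>p\<close>-th power of the norm.
\<close>

lemma fiber_map_max:
  fixes p t :: real
  assumes p: "2 < p" and t: "0 < t"
  shows "t\<^sup>2 / 2 - t powr p / p \<le> 1 / 2 - 1 / p" "t\<^sup>2 / 2 - t powr p / p = 1 / 2 - 1 / p \<Longrightarrow> t = 1"
proof -
  define h where "h = (\<lambda>t::real. t\<^sup>2 / 2 - t powr p / p)"
  have h1: "h 1 = 1 / 2 - 1 / p" by (simp add: h_def)
  have d: "(h has_real_derivative t * (1 - t powr (p - 2))) (at t)" if "t > 0" for t
  proof -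
    have "(h has_real_derivative 2 * t / 2 - p * t powr (p - 1) / p) (at t)"
      unfolding h_def using that by (auto intro!: derivative_eq_intros)
    moreover have "t powr (p - 1) = t * t powr (p - 2)" using powr_add[of t 1 "p - 2"] that by simp
    ultimately show ?thesis using p by (simp add: algebra_simps)
  qed
  have c: "continuous_on {x..y} h" if "x > 0" for x y
    by (intro continuous_at_imp_continuous_on ballI DERIV_isCont[OF d]) (use that in auto)
  have lt: "h t < h 1" if "t \<noteq> 1"
  proof (cases "t < 1")
    case True
    show ?thesis
    proof (rule DERIV_pos_imp_increasing_open[OF True])
      fix x assume "t < x" "x < 1"
      moreover have "x powr (p - 2) < 1 powr (p - 2)" using calculation t p by (intro powr_less_mono2) auto
      ultimately show "\<exists>y. (h has_real_derivative y) (at x) \<and> 0 < y"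
        using d[of x] t by (intro exI[of _ "x * (1 - x powr (p - 2))"]) auto
    qed (use c t in auto)
  next
    case False
    hence "1 < t" using that by simp
    thus ?thesis
    proof (rule DERIV_neg_imp_decreasing_open)
      fix x assume "1 < x" "x < t"
      moreover have "1 powr (p - 2) < x powr (p - 2)" using calculation p by (intro powr_less_mono2) auto
      ultimately show "\<exists>y. (h has_real_derivative y) (at x) \<and> y < 0"
        using d[of x] by (intro exI[of _ "x * (1 - x powr (p - 2))"]) (auto simp: mult_pos_neg)
    qed (use c in auto)
  qed
  show "t\<^sup>2 / 2 - t powr p / p \<le> 1 / 2 - 1 / p" using lt h1 unfolding h_def by (cases "t = 1") auto
  show "t\<^sup>2 / 2 - t powr p / p = 1 / 2 - 1 / p \<Longrightarrow> t = 1" using lt h1 unfolding h_def by auto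
qed

context nls_params
begin

text \<open>
  On the right stands twice the action on one half-line. By \<open>slope_squared\<close> it is the integral of \<open>k\<^sup>2 + (slope r)\<^sup>2\<close>,
  and completing the square isolates the calibrated term. For \<open>x0 = 0\<close> the bound is \<open>2 * cost (r 0)\<close>.
\<close>

lemma calibrated_halfline:
  assumes pr: "profile r k" and M: "\<And>x. 0 \<le> x \<Longrightarrow> r x \<le> peak" and x0: "0 \<le> x0"
  shows "2 * (2 * cost (r x0) - cost (r 0)) + (HINT x. (k x - slope (r x))\<^sup>2)
     \<le> (HINT x. (k x)\<^sup>2) + \<omega> * (HINT x. (r x)\<^sup>2) - 2 / p * (HINT x. r x powr p)"
    and "set_integrable lborel {0<..} (\<lambda>x. (k x - slope (r x))\<^sup>2)"
proof -
  have r0: "\<And>x. 0 \<le> x \<Longrightarrow> 0 \<le> r x" and r2: "set_integrable lborel {0<..} (\<lambda>x. \<omega> * (r x)\<^sup>2)" using pr by (auto simp: profile_def)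
  have rp: "set_integrable lborel {0<..} (\<lambda>x. 2 / p * r x powr p)"
    using profile_powr_integrable[OF pr, of p] p by simp
  note cal = calibration_bounds[OF pr M cost_deriv slope_continuous, of "sqrt \<omega>"]
  have i: "set_integrable lborel {0<..} (\<lambda>x. slope (r x) * k x)" "set_integrable lborel {0<..} (\<lambda>x. (slope (r x))\<^sup>2)"
    and bd: "2 * cost (r x0) - cost (r 0) \<le> (HINT x. slope (r x) * k x)"
    using cal(1,2) cal(3)[OF _ _ _ x0] slope_nonneg slope_le by auto
  have "(HINT x. (slope (r x))\<^sup>2) = (HINT x. \<omega> * (r x)\<^sup>2 - 2 / p * r x powr p)"
    by (rule set_lebesgue_integral_cong) (use slope_squared r0 M in auto)
  also have "\<dots> = \<omega> * (HINT x. (r x)\<^sup>2) - 2 / p * (HINT x. r x powr p)"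
    unfolding set_integral_diff(2)[OF r2 rp] by simp
  finally have slope_int: "(HINT x. (slope (r x))\<^sup>2) = \<omega> * (HINT x. (r x)\<^sup>2) - 2 / p * (HINT x. r x powr p)" .
  show "2 * (2 * cost (r x0) - cost (r 0)) + (HINT x. (k x - slope (r x))\<^sup>2)
     \<le> (HINT x. (k x)\<^sup>2) + \<omega> * (HINT x. (r x)\<^sup>2) - 2 / p * (HINT x. r x powr p)"
  proof -
    have "2 * c + e \<le> D + W - Q" if "S = W - Q" "D + S = 2 * I + e" "c \<le> I" for c e D W Q S I :: real
      using that by linarith
    from this[OF slope_int completed_square_integral(2)[OF pr i] bd] show ?thesis .
  qed
  show "set_integrable lborel {0<..} (\<lambda>x. (k x - slope (r x))\<^sup>2)" by (rule completed_square_integral(1)[OF pr i])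
qed

text \<open>
  Rescaled so that its maximum is \<open>peak\<close>, the function has action at least \<open>jump_cost\<close> of its traces, and rescaling does
  not increase the action above its value on the Nehari manifold. The phases of
  the traces enter through the modulus \<open>J\<close> of the jump.
\<close>

lemma sharp_lower_bound:
  assumes \<beta>: "0 < \<beta>"
    and ab: "0 < b" "b < a" "a < peak"
    and best: "\<forall>x\<in>{0..peak}. \<forall>y\<in>{0..peak}. jump_cost \<beta> a b \<le> jump_cost \<beta> x y \<and>
      (jump_cost \<beta> x y \<le> jump_cost \<beta> a b \<longrightarrow> x = a \<and> y = b)"
    and pl: "profile rl kl" and pr: "profile rr kr"
    and J: "\<bar>rl 0 - rr 0\<bar> \<le> J"
    and N: "(HINT x. (kl x)\<^sup>2) + (HINT x. (kr x)\<^sup>2) + 1 / \<beta> * J\<^sup>2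
       + \<omega> * ((HINT x. (rl x)\<^sup>2) + (HINT x. (rr x)\<^sup>2)) = P"
    and P: "P = (HINT x. rl x powr p) + (HINT x. rr x powr p)"
    and x0: "0 \<le> x0" "\<forall>x\<ge>0. rl x \<le> rl x0 \<and> rr x \<le> rl x0" "0 < rl x0"
  shows "jump_cost \<beta> a b \<le> (1 / 2 - 1 / p) * P"
    and "(1 / 2 - 1 / p) * P = jump_cost \<beta> a b \<Longrightarrow> rl x0 = peak \<and> rl 0 = a \<and> rr 0 = b \<and> J = a - b \<and>
       (AE x in lborel. 0 < x \<longrightarrow> kl x = slope (rl x)) \<and> (AE x in lborel. 0 < x \<longrightarrow> kr x = slope (rr x))"
proof -
  (* The amplitude for which the larger of the two maxima is the height of the soliton. *)
  define t where "t = peak / rl x0"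
  have t: "0 < t" "t * rl x0 = peak" using x0 peak_pos by (auto simp: t_def)
  have bnd: "t * rl x \<le> peak" "t * rr x \<le> peak" if "0 \<le> x" for x
    using mult_left_mono[of "rl x" "rl x0" t] mult_left_mono[of "rr x" "rl x0" t] x0(2) t that by auto
  have nn: "0 \<le> rl x" "0 \<le> rr x" if "0 \<le> x" for x using pl pr that by (auto simp: profile_def)
  note L = calibrated_halfline[OF profile_scale[OF pl, of t] bnd(1) x0(1)]
  note R = calibrated_halfline[OF profile_scale[OF pr, of t] bnd(2), of 0]
  define el where "el = (HINT x. (t * kl x - slope (t * rl x))\<^sup>2)"
  define er where "er = (HINT x. (t * kr x - slope (t * rr x))\<^sup>2)"
  have e0: "0 \<le> el" "0 \<le> er" unfolding el_def er_def set_lebesgue_integral_def by (auto intro!: integral_nonneg_AE)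
  have pow: "(HINT x. (t * r x) powr p) = t powr p * (HINT x. r x powr p)" if "\<And>x. 0 \<le> x \<Longrightarrow> 0 \<le> r x" for r :: "real \<Rightarrow> real"
  proof -
    have "(HINT x. (t * r x) powr p) = (HINT x. t powr p * r x powr p)"
      by (rule set_lebesgue_integral_cong) (use t that in \<open>auto simp: powr_mult\<close>)
    thus ?thesis by simp
  qed
  define S where "S = (t\<^sup>2 / 2 - t powr p / p) * P"
  have Seq: "2 * S = t\<^sup>2 * ((HINT x. (kl x)\<^sup>2) + (HINT x. (kr x)\<^sup>2)) + t\<^sup>2 / \<beta> * J\<^sup>2
     + \<omega> * t\<^sup>2 * ((HINT x. (rl x)\<^sup>2) + (HINT x. (rr x)\<^sup>2)) - 2 / p * (t powr p * P)"
  proof -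
    have "2 * S = t\<^sup>2 * P - 2 / p * (t powr p * P)" by (simp add: S_def algebra_simps)
    thus ?thesis unfolding N[symmetric] by (simp add: algebra_simps)
  qed
  (* All losses are kept: the two squares and the difference between the squared jump and the
     squared difference of the moduli. *)
  have low: "2 * jump_cost \<beta> (t * rl 0) (t * rr 0) + el + er + (t\<^sup>2 * J\<^sup>2 - (t * rl 0 - t * rr 0)\<^sup>2) / \<beta> \<le> 2 * S"
  proof -
    have 1: "2 * (2 * cost peak - cost (t * rl 0)) + el \<le> t\<^sup>2 * (HINT x. (kl x)\<^sup>2) + \<omega> * (t\<^sup>2 * (HINT x. (rl x)\<^sup>2)) - 2 / p * (t powr p * (HINT x. rl x powr p))"
      using L(1) t pow[of rl, OF nn(1)] unfolding el_def by (simp add: power_mult_distrib)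
    have 2: "2 * cost (t * rr 0) + er \<le> t\<^sup>2 * (HINT x. (kr x)\<^sup>2) + \<omega> * (t\<^sup>2 * (HINT x. (rr x)\<^sup>2)) - 2 / p * (t powr p * (HINT x. rr x powr p))"
      using R(1) t pow[of rr, OF nn(2)] unfolding er_def by (simp add: power_mult_distrib)
    have 3: "2 * jump_cost \<beta> (t * rl 0) (t * rr 0) = 2 * (2 * cost peak - cost (t * rl 0)) + 2 * cost (t * rr 0) + (t * rl 0 - t * rr 0)\<^sup>2 / \<beta>"
      by (simp add: jump_cost_def algebra_simps)
    show ?thesis unfolding Seq 3 using 1 2 unfolding P by (simp add: algebra_simps diff_divide_distrib)
  qed
  have Jsq: "(t * rl 0 - t * rr 0)\<^sup>2 \<le> t\<^sup>2 * J\<^sup>2"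
  proof -
    have "\<bar>t * rl 0 - t * rr 0\<bar> \<le> t * J" using mult_left_mono[OF J, of t] t by (simp add: right_diff_distrib[symmetric] abs_mult)
    hence "\<bar>t * rl 0 - t * rr 0\<bar>\<^sup>2 \<le> (t * J)\<^sup>2" by (intro power_mono) auto
    thus ?thesis by (simp add: power_mult_distrib)
  qed
  hence Jq: "0 \<le> (t\<^sup>2 * J\<^sup>2 - (t * rl 0 - t * rr 0)\<^sup>2) / \<beta>" using \<beta> by simp
  have rng: "0 \<le> t * rl 0" "t * rl 0 \<le> peak" "0 \<le> t * rr 0" "t * rr 0 \<le> peak"
    using bnd[of 0] nn[of 0] t by auto
  have m: "jump_cost \<beta> a b \<le> jump_cost \<beta> (t * rl 0) (t * rr 0)" using best rng by simp
  have P0: "0 \<le> P" unfolding P set_lebesgue_integral_def by (auto intro!: add_nonneg_nonneg integral_nonneg_AE)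
  have SP: "S \<le> (1 / 2 - 1 / p) * P" unfolding S_def using fiber_map_max(1)[OF p t(1)] P0 by (rule mult_right_mono)
  have jS: "jump_cost \<beta> (t * rl 0) (t * rr 0) \<le> S" using low e0 Jq by linarith
  show "jump_cost \<beta> a b \<le> (1 / 2 - 1 / p) * P" using m jS SP by linarith
  assume eq: "(1 / 2 - 1 / p) * P = jump_cost \<beta> a b"
  have jpos: "0 < jump_cost \<beta> a b"
  proof -
    have "cost a < cost peak" "0 < cost b" "0 < cost peak" using cost_strict_mono[of a peak] cost_strict_mono[of 0 b] cost_strict_mono[of 0 peak] ab peak_pos by auto
    moreover have "0 \<le> (a - b)\<^sup>2 / (2 * \<beta>)" using \<beta> by simp
    ultimately show ?thesis unfolding jump_cost_def by linarith
  qed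
  hence Pne: "P \<noteq> 0" using eq by auto
  have "S = (1 / 2 - 1 / p) * P" using eq m jS SP by linarith
  hence "t\<^sup>2 / 2 - t powr p / p = 1 / 2 - 1 / p" using Pne by (simp add: S_def)
  hence t1: "t = 1" by (rule fiber_map_max(2)[OF p t(1)])
  have "rl 0 = a \<and> rr 0 = b" using best rng jS SP eq t1 by simp
  hence ends: "rl 0 = a" "rr 0 = b" by auto
  have "2 * jump_cost \<beta> a b + el + er + (J\<^sup>2 - (a - b)\<^sup>2) / \<beta> \<le> 2 * jump_cost \<beta> a b"
    using low SP eq t1 ends by simp
  moreover have "0 \<le> (J\<^sup>2 - (a - b)\<^sup>2) / \<beta>" using Jq t1 ends by simp
  ultimately have z: "el = 0" "er = 0" "(J\<^sup>2 - (a - b)\<^sup>2) / \<beta> = 0" using e0 by linarith+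
  have "J\<^sup>2 = (a - b)\<^sup>2" using z(3) \<beta> by simp
  moreover have "0 \<le> J" using J by linarith
  ultimately have Jab: "J = a - b" using ab by (metis less_imp_le diff_ge_0_iff_ge power2_eq_imp_eq)
  have ae: "AE x in lborel. 0 < x \<longrightarrow> k x = slope (r x)" if "(HINT x. (k x - slope (r x))\<^sup>2) = 0"
    "set_integrable lborel {0<..} (\<lambda>x. (k x - slope (r x))\<^sup>2)" for k r
  proof -
    have "AE x in lborel. indicator {0<..} x *\<^sub>R (k x - slope (r x))\<^sup>2 = 0"
      using that unfolding set_integrable_def set_lebesgue_integral_def
      by (subst (asm) integral_nonneg_eq_0_iff_AE) (auto split: split_indicator)
    thus ?thesis by eventually_elim auto
  qed
  have "AE x in lborel. 0 < x \<longrightarrow> kl x = slope (rl x)" "AE x in lborel. 0 < x \<longrightarrow> kr x = slope (rr x)"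
    using ae[of kl rl] ae[of kr rr] z L(2) R(2) t1 unfolding el_def er_def by simp_all
  thus "rl x0 = peak \<and> rl 0 = a \<and> rr 0 = b \<and> J = a - b \<and>
       (AE x in lborel. 0 < x \<longrightarrow> kl x = slope (rl x)) \<and> (AE x in lborel. 0 < x \<longrightarrow> kr x = slope (rr x))"
    using t t1 ends Jab by simp
qed

end

section \<open>Action minimizers at positive frequency\<close>

lemma set_integral_norm_powr_2:
  fixes v :: "real \<Rightarrow> complex"
  shows "(HINT x. norm (v x) powr 2) = (HINT x. (norm (v x))\<^sup>2)"
  by (rule set_lebesgue_integral_cong) auto

lemma split_rep_mass:
  assumes "split_rep u vl gl vr gr"
  shows "norm_Lp_pow 2 u = (HINT x. (norm (vl x))\<^sup>2) + (HINT x. (norm (vr x))\<^sup>2)"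
  using split_rep_norm_Lp_pow[OF assms, of 2] by (simp add: set_integral_norm_powr_2)

lemma split_rep_zero:
  assumes "split_rep u vl gl vr gr" "\<And>x. 0 \<le> x \<Longrightarrow> vl x = 0" "\<And>x. 0 \<le> x \<Longrightarrow> vr x = 0"
  shows "AE x in lborel. u x = 0"
proof -
  have l: "AE x in lborel. 0 < x \<longrightarrow> u (- x) = vl x" and r: "AE x in lborel. 0 < x \<longrightarrow> u x = vr x"
    using assms(1) unfolding split_rep_def by blast+
  have "AE x in lborel. x \<noteq> (0::real)" by (rule AE_lborel_singleton)
  with r AE_lborel_reflect[OF l] show ?thesis
  proof eventually_elim
    case (elim x)
    thus ?case using assms(2)[of "- x"] assms(3)[of x] by (cases "0 < x") auto
  qed
qed

lemma action_on_nehari: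
  assumes "u \<in> nehari_manifold \<beta> p \<omega>"
  shows "action \<beta> p \<omega> u = (1 / 2 - 1 / p) * norm_Lp_pow p u"
proof -
  have "Qf \<beta> u + \<omega> * norm_Lp_pow 2 u = norm_Lp_pow p u"
    using assms by (simp add: nehari_manifold_def nehari_functional_def)
  hence "action \<beta> p \<omega> u = 1 / 2 * norm_Lp_pow p u - 1 / p * norm_Lp_pow p u"
    unfolding action_def by (simp add: algebra_simps flip: distrib_left)
  thus ?thesis by (simp add: algebra_simps)
qed

lemma norm_Lp_pow_nonneg: "0 \<le> norm_Lp_pow p u"
  unfolding norm_Lp_pow_def by (rule integral_nonneg_AE) auto

context nls_params
begin

text \<open>
  A shift to the right integrates \<open>\<phi> powr p\<close> over a larger half-line.
\<close>

lemma shifted_powr_integral_mono: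
  assumes "a \<le> b"
  shows "(HINT x. \<phi> (x + b) powr p) \<le> (HINT x. \<phi> (x + a) powr p)"
proof -
  have "integrable lborel (\<lambda>x. indicator {a<..} x *\<^sub>R \<phi> x powr p)"
  proof -
    have "integrable lborel (\<lambda>x. indicator {0<..} x *\<^sub>R \<phi> (x + a) powr p)"
      using shifted_set_integrable(3)[of p a] p by (simp add: set_integrable_def)
    also have "(\<lambda>x. indicator {0<..} x *\<^sub>R \<phi> (x + a) powr p) = (\<lambda>x. indicator {a<..} (a + 1 * x) *\<^sub>R \<phi> (a + 1 * x) powr p)"
      by (auto simp: fun_eq_iff add.commute split: split_indicator)
    finally show ?thesis by (subst (asm) lborel_integrable_real_affine_iff[where c = 1]) auto
  qed
  hence "set_integrable lborel {a<..} (\<lambda>x. \<phi> x powr p)" by (simp add: set_integrable_def)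
  hence "(LINT x:{b<..}|lborel. \<phi> x powr p) \<le> (LINT x:{a<..}|lborel. \<phi> x powr p)"
    by (rule set_integral_mono_set) (use assms in auto)
  thus ?thesis by (simp only: set_integral_translate[where c = a] set_integral_translate[where c = b])
qed

text \<open>
  The modulus on the left is at least the soliton centred at \<open>x0\<close>, and on the right it is at least the soliton that
  starts at depth \<open>xp\<close>. Climbing from depth \<open>xm\<close> to the peak takes \<open>xm \<le> x0\<close>, so the lower bounds already have the
  largest \<open>L\<^sup>p\<close> norm that assumption \<open>P\<close> permits. Hence the bounds are attained, and the phases follow.
\<close>

lemma equality_case:
  assumes rl: "H1_rep vl gl" and rr: "H1_rep vr gr"
    and x0: "0 \<le> x0" "norm (vl x0) = peak" and le: "\<And>x. 0 \<le> x \<Longrightarrow> norm (vl x) \<le> peak \<and> norm (vr x) \<le> peak"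
    and xm: "0 \<le> xm" "norm (vl 0) = \<phi> xm" and xp: "0 \<le> xp" "norm (vr 0) = \<phi> xp"
    and J: "norm (vr 0 - vl 0) = \<phi> xm - \<phi> xp"
    and gl: "AE x in lborel. 0 < x \<longrightarrow> norm (gl x) = slope (norm (vl x))"
    and gr: "AE x in lborel. 0 < x \<longrightarrow> norm (gr x) = slope (norm (vr x))"
    and P: "(HINT x. norm (vl x) powr p) + (HINT x. norm (vr x) powr p)
      \<le> (HINT x. \<phi> (x + - xm) powr p) + (HINT x. \<phi> (x + xp) powr p)"
  obtains z where "norm z = 1" "\<And>x. 0 \<le> x \<Longrightarrow> vl x = z * complex_of_real (\<phi> (x + - xm))"
    "\<And>x. 0 \<le> x \<Longrightarrow> vr x = z * complex_of_real (\<phi> (x + xp))"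
proof -
  note prl = H1_rep_profile[OF rl] and prr = H1_rep_profile[OF rr]
  have stl: "slope_bounded (\<lambda>x. norm (vl x))" and str: "slope_bounded (\<lambda>x. norm (vr x))"
    using profile_slope_imp_slope_bounded[OF prl _ gl] profile_slope_imp_slope_bounded[OF prr _ gr] le by auto
  have dp: "depth peak = 0" using depth_soliton[of 0] by (simp add: soliton_0)
  have lowl: "\<phi> (x + - x0) \<le> norm (vl x)" if "0 \<le> x" for x
  proof -
    have "\<phi> (0 + \<bar>x - x0\<bar>) \<le> norm (vl x)"
      using slope_bounded_lower_bound[OF stl x0(1) _ that] x0(2) peak_pos dp by simp
    moreover have "\<phi> \<bar>x - x0\<bar> = \<phi> (x + - x0)" using soliton_even[of "x - x0"] by (simp add: abs_if)
    ultimately show ?thesis by simp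
  qed
  have lowr: "\<phi> (x + xp) \<le> norm (vr x)" if "0 \<le> x" for x
    using slope_bounded_lower_bound[OF str order_refl _ that] xp soliton_pos[of xp] that
    by (simp add: depth_soliton add.commute)
  (* The modulus needs at least the length xm to climb from its trace to the peak. *)
  have "\<bar>depth (norm (vl x0)) - depth (norm (vl 0))\<bar> \<le> x0 - 0"
    by (rule slope_bounded_depth_Lipschitz[OF stl x0(1)]) (use x0 peak_pos in auto)
  hence x0m: "xm \<le> x0" using x0(2) xm dp by (simp add: depth_soliton)
  have il: "set_integrable lborel {0<..} (\<lambda>x. norm (vl x) powr p)" "set_integrable lborel {0<..} (\<lambda>x. norm (vr x) powr p)"
    using profile_powr_integrable[OF prl] profile_powr_integrable[OF prr] p by auto
  have ish: "set_integrable lborel {0<..} (\<lambda>x. \<phi> (x + c) powr p)" for c using shifted_set_integrable(3)[of p c] p by simp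
  have "(HINT x. \<phi> (x + - x0) powr p) \<le> (HINT x. norm (vl x) powr p)"
    by (rule set_integral_mono[OF ish il(1)], rule powr_mono2) (use lowl soliton_pos p less_imp_le in auto)
  moreover have "(HINT x. \<phi> (x + xp) powr p) \<le> (HINT x. norm (vr x) powr p)"
    by (rule set_integral_mono[OF ish il(2)], rule powr_mono2) (use lowr soliton_pos p less_imp_le in auto)
  moreover have "(HINT x. \<phi> (x + - xm) powr p) \<le> (HINT x. \<phi> (x + - x0) powr p)"
    by (rule shifted_powr_integral_mono) (use x0m in simp)
  ultimately have Pl: "(HINT x. norm (vl x) powr p) \<le> (HINT x. \<phi> (x + - x0) powr p)"
    and Pr: "(HINT x. norm (vr x) powr p) \<le> (HINT x. \<phi> (x + xp) powr p)"
    using P by linarith+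
  have cl: "continuous_on {0..} (\<lambda>x. norm (vl x))" and cr: "continuous_on {0..} (\<lambda>x. norm (vr x))"
    using H1_rep_continuous[OF rl] H1_rep_continuous[OF rr] by (auto intro!: continuous_intros)
  have p0: "0 < p" using p by simp
  have eql: "norm (vl x) = \<phi> (x + - x0)" if "0 \<le> x" for x
    using continuous_eq_of_integral_le[OF cl shifted_continuous(1) _ p0 il(1) ish Pl that] lowl soliton_pos less_imp_le by blast
  have eqr: "norm (vr x) = \<phi> (x + xp)" if "0 \<le> x" for x
    using continuous_eq_of_integral_le[OF cr shifted_continuous(1) _ p0 il(2) ish Pr that] lowr soliton_pos less_imp_le by blast
  have "\<phi> xm = \<phi> (- x0)" using eql[of 0] xm by simp
  hence "depth (\<phi> xm) = depth (\<phi> (- x0))" by simp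
  hence x0eq: "x0 = xm" using x0 xm by (simp add: depth_soliton)
  obtain z1 where z1: "norm z1 = 1" "\<And>x. 0 \<le> x \<Longrightarrow> vl x = z1 * complex_of_real (\<phi> (x + - xm))"
    using soliton_phase[OF rl _ gl, of "- xm"] eql x0eq by metis
  obtain z2 where z2: "norm z2 = 1" "\<And>x. 0 \<le> x \<Longrightarrow> vr x = z2 * complex_of_real (\<phi> (x + xp))"
    using soliton_phase[OF rr _ gr, of xp] eqr by metis
  (* The jump is as small as the moduli permit, which aligns the phases of the two sides. *)
  have "norm (vl 0 - vr 0) \<le> \<bar>norm (vl 0) - norm (vr 0)\<bar>" using J xm xp by (simp add: norm_minus_commute)
  hence "norm (vr 0) *\<^sub>R vl 0 = norm (vl 0) *\<^sub>R vr 0" by (rule phase_alignment)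
  hence "\<phi> xp *\<^sub>R (z1 * complex_of_real (\<phi> xm)) = \<phi> xm *\<^sub>R (z2 * complex_of_real (\<phi> xp))"
    using z1(2)[of 0] z2(2)[of 0] xm xp by (simp add: soliton_even)
  hence "z1 = z2" using soliton_pos[of xp] soliton_pos[of xm] by (simp add: scaleR_conv_of_real)
  thus ?thesis using that[of z1] z1 z2 by blast
qed

text \<open>
  The points of the soliton whose values are the unique minimum point of the reduced problem.
\<close>

definition optimal_shifts :: "real \<Rightarrow> real \<Rightarrow> real \<Rightarrow> bool" where
  "optimal_shifts \<beta> xm xp \<longleftrightarrow> 0 < xm \<and> xm < xp \<and>
     slope (\<phi> xm) = (\<phi> xm - \<phi> xp) / \<beta> \<and> slope (\<phi> xp) = (\<phi> xm - \<phi> xp) / \<beta> \<and>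
     (\<forall>x\<in>{0..peak}. \<forall>y\<in>{0..peak}. jump_cost \<beta> (\<phi> xm) (\<phi> xp) \<le> jump_cost \<beta> x y \<and>
      (jump_cost \<beta> x y \<le> jump_cost \<beta> (\<phi> xm) (\<phi> xp) \<longrightarrow> x = \<phi> xm \<and> y = \<phi> xp))"

lemma optimal_shifts_exist:
  assumes \<beta>: "0 < \<beta>"
  obtains xm xp where "optimal_shifts \<beta> xm xp"
proof -
  obtain a b where ab: "0 < b" "b < a" "a < peak" "slope a = (a - b) / \<beta>" "slope b = (a - b) / \<beta>"
    and best: "\<forall>x\<in>{0..peak}. \<forall>y\<in>{0..peak}. jump_cost \<beta> a b \<le> jump_cost \<beta> x y \<and>
      (jump_cost \<beta> x y \<le> jump_cost \<beta> a b \<longrightarrow> x = a \<and> y = b)"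
    using jump_cost_unique_minimum[OF \<beta>] by metis
  have x: "\<phi> (depth a) = a" "0 \<le> depth a" "\<phi> (depth b) = b" "0 \<le> depth b"
    using soliton_depth[of a] soliton_depth[of b] ab by auto
  have "0 < depth a" using x ab soliton_0 by (cases "depth a = 0") auto
  moreover have "depth a < depth b"
    using soliton_strict_antimono[of "depth b" "depth a"] x ab linorder_less_linear[of "depth a" "depth b"] by auto
  ultimately show ?thesis using that ab best x unfolding optimal_shifts_def by metis
qed

text \<open>
  The minimizer, for the optimal shifts; it decreases from the left trace to the smaller right trace.
\<close>

definition stitched :: "real \<Rightarrow> real \<Rightarrow> real \<Rightarrow> complex" where
  "stitched xm xp x = complex_of_real (\<phi> (x + (if 0 < x then xp else xm)))"

lemma stitched_right: "0 < x \<Longrightarrow> stitched xm xp x = complex_of_real (\<phi> (x + xp))"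
  by (simp add: stitched_def)

lemma stitched_left: "0 < x \<Longrightarrow> stitched xm xp (- x) = complex_of_real (\<phi> (x + - xm))"
  using soliton_even[of "x - xm"] by (simp add: stitched_def)

lemma stitched_split_rep:
  "split_rep (stitched xm xp) (\<lambda>x. complex_of_real (\<phi> (x + - xm))) (\<lambda>x. complex_of_real (dsol (x + - xm)))
     (\<lambda>x. complex_of_real (\<phi> (x + xp))) (\<lambda>x. complex_of_real (dsol (x + xp)))"
proof -
  have m: "(\<lambda>x. complex_of_real (\<phi> (x + c))) \<in> borel_measurable borel" for c
    by (intro borel_measurable_continuous_onI continuous_intros shifted_continuous)
  have sm: "set_borel_measurable lborel A (stitched xm xp)"
    if "A \<in> sets borel" "\<And>x. x \<in> A \<Longrightarrow> stitched xm xp x = complex_of_real (\<phi> (x + c))" for A c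
  proof -
    have "set_borel_measurable lborel A (\<lambda>x. complex_of_real (\<phi> (x + c)))"
      unfolding set_borel_measurable_def by (rule borel_measurable_scaleR) (use m that in auto)
    moreover have "(\<lambda>x. indicator A x *\<^sub>R complex_of_real (\<phi> (x + c))) = (\<lambda>x. indicator A x *\<^sub>R stitched xm xp x)"
      using that(2) by (auto simp: fun_eq_iff split: split_indicator)
    ultimately show ?thesis by (simp add: set_borel_measurable_def)
  qed
  have "set_borel_measurable lborel {0<..} (stitched xm xp)" "set_borel_measurable lborel {..<0} (stitched xm xp)"
    by (rule sm[of _ xp], auto simp: stitched_def) (rule sm[of _ xm], auto simp: stitched_def)
  thus ?thesis
    unfolding split_rep_def
    by (intro conjI shifted_soliton_H1_rep AE_I2 impI) (assumption | rule stitched_left stitched_right, assumption)+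
qed

text \<open>
  The boundary terms \<open>- \<phi> xm * slope (\<phi> xm)\<close> and \<open>\<phi> xp * slope (\<phi> xp)\<close> of the two half-lines cancel the jump term because
  both slopes are \<open>(\<phi> xm - \<phi> xp) / \<beta>\<close>.
\<close>

lemma stitched_nehari_action:
  assumes x: "0 \<le> xm" "0 \<le> xp"
    and s: "slope (\<phi> xm) = (\<phi> xm - \<phi> xp) / \<beta>" "slope (\<phi> xp) = (\<phi> xm - \<phi> xp) / \<beta>"
  shows "stitched xm xp \<in> nehari_manifold \<beta> p \<omega>"
    and "action \<beta> p \<omega> (stitched xm xp) = jump_cost \<beta> (\<phi> xm) (\<phi> xp)"
    and "norm_Lp_pow p (stitched xm xp) = (HINT x. \<phi> (x + - xm) powr p) + (HINT x. \<phi> (x + xp) powr p)"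
proof -
  let ?u = "stitched xm xp"
  note sr = stitched_split_rep[of xm xp]
  define El where "El = (HINT x. (dsol (x + - xm))\<^sup>2)"
  define Er where "Er = (HINT x. (dsol (x + xp))\<^sup>2)"
  define Ml where "Ml = (HINT x. (\<phi> (x + - xm))\<^sup>2)"
  define Mr where "Mr = (HINT x. (\<phi> (x + xp))\<^sup>2)"
  define Pl where "Pl = (HINT x. \<phi> (x + - xm) powr p)"
  define Pr where "Pr = (HINT x. \<phi> (x + xp) powr p)"
  define a where "a = \<phi> xm"
  define b where "b = \<phi> xp"
  have Qu: "Qf \<beta> ?u = El + Er + 1 / \<beta> * (a - b)\<^sup>2"
  proof -
    have "complex_of_real (\<phi> (0 + xp)) - complex_of_real (\<phi> (0 + - xm)) = complex_of_real (b - a)"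
      using soliton_even[of xm] by (simp add: a_def b_def)
    hence "(norm (complex_of_real (\<phi> (0 + xp)) - complex_of_real (\<phi> (0 + - xm))))\<^sup>2 = (a - b)\<^sup>2"
      by (simp only: norm_of_real power2_abs power2_commute)
    thus ?thesis using split_rep_Qf[OF sr, of \<beta>] by (simp add: El_def Er_def)
  qed
  have Mu: "norm_Lp_pow 2 ?u = Ml + Mr"
    using split_rep_mass[OF sr] by (simp add: Ml_def Mr_def)
  have Pu: "norm_Lp_pow p ?u = Pl + Pr"
    using split_rep_norm_Lp_pow[OF sr, of p] p soliton_pos by (simp add: Pl_def Pr_def less_imp_le)
  thus "norm_Lp_pow p ?u = (HINT x. \<phi> (x + - xm) powr p) + (HINT x. \<phi> (x + xp) powr p)"
    by (simp add: Pl_def Pr_def)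
  have E: "El = 2 * cost peak - cost a" "Er = cost b"
    using soliton_peak_energy[OF x(1)] soliton_tail_energy[OF x(2)] by (auto simp: El_def Er_def a_def b_def)
  have bd: "El + \<omega> * Ml - Pl = - (a * slope a)" "Er + \<omega> * Mr - Pr = b * slope b"
    using soliton_nehari_identity[of "- xm"] soliton_nehari_identity[of xp] dsol_left[of "- xm"] dsol_right[of xp] x soliton_even[of xm]
    by (simp_all add: El_def Er_def Ml_def Mr_def Pl_def Pr_def a_def b_def)
  have "Qf \<beta> ?u + \<omega> * norm_Lp_pow 2 ?u - norm_Lp_pow p ?u = b * ((a - b) / \<beta>) - a * ((a - b) / \<beta>) + 1 / \<beta> * (a - b)\<^sup>2"
    using bd s unfolding Qu Mu Pu a_def[symmetric] b_def[symmetric] by (simp add: algebra_simps)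
  also have "\<dots> = 0" by (simp add: power2_eq_square algebra_simps diff_divide_distrib add_divide_distrib)
  finally have "nehari_functional \<beta> p \<omega> ?u = 0" by (simp add: nehari_functional_def)
  moreover have "\<not> (AE x in lborel. ?u x = 0)"
  proof
    assume "AE x in lborel. ?u x = 0"
    moreover have "?u x \<noteq> 0" for x using soliton_pos[of "x + (if 0 < x then xp else xm)"] by (simp add: stitched_def)
    ultimately have "AE x in (lborel :: real measure). False" by simp
    thus False by (simp add: eventually_False ae_filter_eq_bot_iff)
  qed
  ultimately show "?u \<in> nehari_manifold \<beta> p \<omega>" using split_rep_H1_split[OF sr] by (simp add: nehari_manifold_def)
  have en: "E = \<omega> * M - 2 / p * P"
    if "E = (HINT x. (dsol (x + c))\<^sup>2)" "M = (HINT x. (\<phi> (x + c))\<^sup>2)" "P = (HINT x. \<phi> (x + c) powr p)" for E M P c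
  proof -
    have i: "set_integrable lborel {0<..} (\<lambda>x. \<omega> * (\<phi> (x + c))\<^sup>2)" "set_integrable lborel {0<..} (\<lambda>x. 2 / p * \<phi> (x + c) powr p)"
      using shifted_set_integrable[of c] shifted_set_integrable(3)[of p c] p by auto
    have "E = (HINT x. \<omega> * (\<phi> (x + c))\<^sup>2 - 2 / p * \<phi> (x + c) powr p)"
      unfolding that(1)
      by (rule set_lebesgue_integral_cong)
         (simp, unfold slope_soliton_sq[symmetric],
          use slope_squared[OF less_imp_le[OF soliton_pos] soliton_le_peak] in blast)
    also have "\<dots> = \<omega> * M - 2 / p * P" unfolding set_integral_diff(2)[OF i] that by simp
    finally show ?thesis .
  qed
  have enl: "El = \<omega> * Ml - 2 / p * Pl" by (rule en[OF El_def Ml_def Pl_def])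
  have enr: "Er = \<omega> * Mr - 2 / p * Pr" by (rule en[OF Er_def Mr_def Pr_def])
  have "2 * action \<beta> p \<omega> ?u = El + Er + 1 / \<beta> * (a - b)\<^sup>2 + (\<omega> * Ml - 2 / p * Pl) + (\<omega> * Mr - 2 / p * Pr)"
    unfolding action_def Qu Mu Pu by (simp add: algebra_simps add_divide_distrib)
  also have "\<dots> = 2 * (El + Er) + 1 / \<beta> * (a - b)\<^sup>2" unfolding enl[symmetric] enr[symmetric] by simp
  also have "\<dots> = 2 * jump_cost \<beta> a b" unfolding E jump_cost_def by simp
  finally show "action \<beta> p \<omega> ?u = jump_cost \<beta> (\<phi> xm) (\<phi> xp)" by (simp add: a_def b_def)
qed

text \<open>
  The left representative carries the maximum; the other case is the same statement with the half-lines exchanged.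
\<close>

lemma nehari_bound_peak_left:
  assumes \<beta>: "0 < \<beta>" and opt: "optimal_shifts \<beta> xm xp"
    and H: "H1_rep wl hl" "H1_rep wr hr"
    and N: "(HINT x. (norm (hl x))\<^sup>2) + (HINT x. (norm (hr x))\<^sup>2) + 1 / \<beta> * (norm (wr 0 - wl 0))\<^sup>2
       + \<omega> * ((HINT x. (norm (wl x))\<^sup>2) + (HINT x. (norm (wr x))\<^sup>2)) = P"
    and P: "P = (HINT x. norm (wl x) powr p) + (HINT x. norm (wr x) powr p)"
    and x0: "0 \<le> x0" "\<forall>x\<ge>0. norm (wl x) \<le> norm (wl x0) \<and> norm (wr x) \<le> norm (wl x0)" "0 < norm (wl x0)"
  shows "jump_cost \<beta> (\<phi> xm) (\<phi> xp) \<le> (1 / 2 - 1 / p) * P"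
    and "(1 / 2 - 1 / p) * P = jump_cost \<beta> (\<phi> xm) (\<phi> xp) \<Longrightarrow>
      \<exists>z. norm z = 1 \<and> (\<forall>x\<ge>0. wl x = z * complex_of_real (\<phi> (x + - xm)) \<and> wr x = z * complex_of_real (\<phi> (x + xp)))"
proof -
  have x: "0 \<le> xm" "0 \<le> xp" and sl: "slope (\<phi> xm) = (\<phi> xm - \<phi> xp) / \<beta>" "slope (\<phi> xp) = (\<phi> xm - \<phi> xp) / \<beta>"
    and best: "\<forall>x\<in>{0..peak}. \<forall>y\<in>{0..peak}. jump_cost \<beta> (\<phi> xm) (\<phi> xp) \<le> jump_cost \<beta> x y \<and>
      (jump_cost \<beta> x y \<le> jump_cost \<beta> (\<phi> xm) (\<phi> xp) \<longrightarrow> x = \<phi> xm \<and> y = \<phi> xp)"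
    and ord: "\<phi> xp < \<phi> xm" "\<phi> xm < peak"
    using opt soliton_strict_antimono[of xm xp] soliton_strict_antimono[of 0 xm] soliton_0 by (auto simp: optimal_shifts_def)
  have J: "\<bar>norm (wl 0) - norm (wr 0)\<bar> \<le> norm (wr 0 - wl 0)"
    using norm_triangle_ineq3[of "wl 0" "wr 0"] by (simp add: norm_minus_commute)
  note sh = sharp_lower_bound[OF \<beta> soliton_pos ord best H1_rep_profile[OF H(1)] H1_rep_profile[OF H(2)] J N P x0]
  show "jump_cost \<beta> (\<phi> xm) (\<phi> xp) \<le> (1 / 2 - 1 / p) * P" by (rule sh(1))
  assume eq: "(1 / 2 - 1 / p) * P = jump_cost \<beta> (\<phi> xm) (\<phi> xp)"
  note st = stitched_nehari_action[OF x sl]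
  have "(1 / 2 - 1 / p) * P = (1 / 2 - 1 / p) * norm_Lp_pow p (stitched xm xp)"
    using eq st(2) action_on_nehari[OF st(1)] by simp
  hence PP: "P = (HINT x. \<phi> (x + - xm) powr p) + (HINT x. \<phi> (x + xp) powr p)" using p st(3) by auto
  have e: "norm (wl x0) = peak" "norm (wl 0) = \<phi> xm" "norm (wr 0) = \<phi> xp" "norm (wr 0 - wl 0) = \<phi> xm - \<phi> xp"
    "AE x in lborel. 0 < x \<longrightarrow> norm (hl x) = slope (norm (wl x))" "AE x in lborel. 0 < x \<longrightarrow> norm (hr x) = slope (norm (wr x))"
    using sh(2)[OF eq] by auto
  obtain z where "norm z = 1" "\<And>x. 0 \<le> x \<Longrightarrow> wl x = z * complex_of_real (\<phi> (x + - xm))"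
    "\<And>x. 0 \<le> x \<Longrightarrow> wr x = z * complex_of_real (\<phi> (x + xp))"
    by (rule equality_case[OF H x0(1) e(1) _ x(1) e(2) x(2) e(3,4,5,6)]) (use e x0 P PP in auto)
  thus "\<exists>z. norm z = 1 \<and> (\<forall>x\<ge>0. wl x = z * complex_of_real (\<phi> (x + - xm)) \<and> wr x = z * complex_of_real (\<phi> (x + xp)))"
    by blast
qed

lemma nehari_action_ge_stitched:
  assumes \<beta>: "0 < \<beta>" and opt: "optimal_shifts \<beta> xm xp" and v: "v \<in> nehari_manifold \<beta> p \<omega>"
  shows "jump_cost \<beta> (\<phi> xm) (\<phi> xp) \<le> action \<beta> p \<omega> v"
    and "action \<beta> p \<omega> v = jump_cost \<beta> (\<phi> xm) (\<phi> xp) \<Longrightarrow>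
      \<exists>z. norm z = 1 \<and> ((AE x in lborel. v x = z * stitched xm xp x) \<or> (AE x in lborel. v x = z * stitched xm xp (- x)))"
proof -
  have vH: "v \<in> H1_split" and vne: "\<not> (AE x in lborel. v x = 0)" and vI: "nehari_functional \<beta> p \<omega> v = 0"
    using v by (auto simp: nehari_manifold_def)
  obtain wl hl wr hr where rep: "split_rep v wl hl wr hr" using H1_split_imp_split_rep[OF vH] by blast
  have H: "H1_rep wl hl" "H1_rep wr hr" and AEl: "AE x in lborel. 0 < x \<longrightarrow> v (- x) = wl x" and AEr: "AE x in lborel. 0 < x \<longrightarrow> v x = wr x"
    using rep unfolding split_rep_def by blast+
  define P where "P = norm_Lp_pow p v"
  have Pv: "P = (HINT x. norm (wl x) powr p) + (HINT x. norm (wr x) powr p)"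
    using split_rep_norm_Lp_pow[OF rep] p by (simp add: P_def)
  have Nv: "(HINT x. (norm (hl x))\<^sup>2) + (HINT x. (norm (hr x))\<^sup>2) + 1 / \<beta> * (norm (wr 0 - wl 0))\<^sup>2
       + \<omega> * ((HINT x. (norm (wl x))\<^sup>2) + (HINT x. (norm (wr x))\<^sup>2)) = P"
    using vI split_rep_Qf[OF rep, of \<beta>] split_rep_mass[OF rep] by (simp add: nehari_functional_def P_def)
  have av: "action \<beta> p \<omega> v = (1 / 2 - 1 / p) * P" using action_on_nehari[OF v] by (simp add: P_def)
  obtain xl where xl: "0 \<le> xl" "\<And>x. 0 \<le> x \<Longrightarrow> norm (wl x) \<le> norm (wl xl)"
    using profile_attains_sup[OF H1_rep_profile[OF H(1)]] by metis
  obtain xr where xr: "0 \<le> xr" "\<And>x. 0 \<le> x \<Longrightarrow> norm (wr x) \<le> norm (wr xr)"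
    using profile_attains_sup[OF H1_rep_profile[OF H(2)]] by metis
  have pos: "0 < norm (wl xl) \<or> 0 < norm (wr xr)"
  proof (rule ccontr)
    assume "\<not> ?thesis"
    hence "wl x = 0" "wr x = 0" if "0 \<le> x" for x using xl(2)[OF that] xr(2)[OF that] by auto
    thus False using split_rep_zero[OF rep] vne by blast
  qed
  have glue: "AE x in lborel. v x = f x" if "\<And>x. 0 < x \<Longrightarrow> wr x = f x" "\<And>x. 0 < x \<Longrightarrow> wl x = f (- x)" for f
  proof -
    have "AE x in lborel. x \<noteq> (0::real)" by (rule AE_lborel_singleton)
    with AEr AE_lborel_reflect[OF AEl] show ?thesis
    proof eventually_elim
      case (elim x)
      thus ?case using that(1)[of x] that(2)[of "- x"] by (cases "0 < x") auto
    qed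
  qed
  have "jump_cost \<beta> (\<phi> xm) (\<phi> xp) \<le> (1 / 2 - 1 / p) * P \<and> ((1 / 2 - 1 / p) * P = jump_cost \<beta> (\<phi> xm) (\<phi> xp) \<longrightarrow>
      (\<exists>z. norm z = 1 \<and> ((AE x in lborel. v x = z * stitched xm xp x) \<or> (AE x in lborel. v x = z * stitched xm xp (- x)))))"
  proof (cases "norm (wr xr) \<le> norm (wl xl)")
    case True
    have sup: "\<forall>x\<ge>0. norm (wl x) \<le> norm (wl xl) \<and> norm (wr x) \<le> norm (wl xl)"
      using xl(2) xr(2) True by (meson order_trans)
    have "0 < norm (wl xl)" using pos True by auto
    note bd = nehari_bound_peak_left[OF \<beta> opt H Nv Pv xl(1) sup this]
    have "\<exists>z. norm z = 1 \<and> (AE x in lborel. v x = z * stitched xm xp x)" if eq: "(1 / 2 - 1 / p) * P = jump_cost \<beta> (\<phi> xm) (\<phi> xp)"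
    proof -
      obtain z where z: "norm z = 1" "\<forall>x\<ge>0. wl x = z * complex_of_real (\<phi> (x + - xm)) \<and> wr x = z * complex_of_real (\<phi> (x + xp))"
        using bd(2)[OF eq] by blast
      have "AE x in lborel. v x = z * stitched xm xp x"
        by (rule glue) (use z in \<open>simp_all only: stitched_left stitched_right less_imp_le\<close>)
      thus ?thesis using z(1) by blast
    qed
    thus ?thesis using bd(1) by auto
  next
    case False
    have sup: "\<forall>x\<ge>0. norm (wr x) \<le> norm (wr xr) \<and> norm (wl x) \<le> norm (wr xr)"
      using xl(2) xr(2) False by (meson order_trans linear)
    have pr: "0 < norm (wr xr)" using pos False by auto
    have sym: "(HINT x. (norm (hr x))\<^sup>2) + (HINT x. (norm (hl x))\<^sup>2) + 1 / \<beta> * (norm (wl 0 - wr 0))\<^sup>2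
       + \<omega> * ((HINT x. (norm (wr x))\<^sup>2) + (HINT x. (norm (wl x))\<^sup>2)) = P"
      "P = (HINT x. norm (wr x) powr p) + (HINT x. norm (wl x) powr p)"
      using Nv Pv by (simp_all add: algebra_simps norm_minus_commute)
    note bd = nehari_bound_peak_left[OF \<beta> opt H(2,1) sym xr(1) sup pr]
    have "\<exists>z. norm z = 1 \<and> (AE x in lborel. v x = z * stitched xm xp (- x))" if eq: "(1 / 2 - 1 / p) * P = jump_cost \<beta> (\<phi> xm) (\<phi> xp)"
    proof -
      obtain z where z: "norm z = 1" "\<forall>x\<ge>0. wr x = z * complex_of_real (\<phi> (x + - xm)) \<and> wl x = z * complex_of_real (\<phi> (x + xp))"
        using bd(2)[OF eq] by blast
      have "AE x in lborel. v x = z * stitched xm xp (- x)"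
        by (rule glue) (use z in \<open>simp_all only: stitched_left stitched_right less_imp_le minus_minus\<close>)
      thus ?thesis using z(1) by blast
    qed
    thus ?thesis using bd(1) by auto
  qed
  thus "jump_cost \<beta> (\<phi> xm) (\<phi> xp) \<le> action \<beta> p \<omega> v"
    and "action \<beta> p \<omega> v = jump_cost \<beta> (\<phi> xm) (\<phi> xp) \<Longrightarrow>
      \<exists>z. norm z = 1 \<and> ((AE x in lborel. v x = z * stitched xm xp x) \<or> (AE x in lborel. v x = z * stitched xm xp (- x)))"
    unfolding av by auto
qed

lemma stitched_unique_minimizer:
  assumes \<beta>: "0 < \<beta>" and opt: "optimal_shifts \<beta> xm xp"
  shows "action_minimizer \<beta> p \<omega> (stitched xm xp)"
    and "action_minimizer \<beta> p \<omega> v \<Longrightarrow>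
      \<exists>\<theta>::real. (AE x in lborel. v x = exp (\<i> * complex_of_real \<theta>) * stitched xm xp x) \<or>
                (AE x in lborel. v x = exp (\<i> * complex_of_real \<theta>) * stitched xm xp (- x))"
proof -
  have "0 \<le> xm" "0 \<le> xp" "slope (\<phi> xm) = (\<phi> xm - \<phi> xp) / \<beta>" "slope (\<phi> xp) = (\<phi> xm - \<phi> xp) / \<beta>"
    using opt by (auto simp: optimal_shifts_def)
  note st = stitched_nehari_action(1,2)[OF this]
  have level: "action_level \<beta> p \<omega> = jump_cost \<beta> (\<phi> xm) (\<phi> xp)"
    unfolding action_level_def
  proof (rule cInf_eq_minimum)
    show "jump_cost \<beta> (\<phi> xm) (\<phi> xp) \<in> action \<beta> p \<omega> ` nehari_manifold \<beta> p \<omega>" using st by force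
  qed (use nehari_action_ge_stitched(1)[OF \<beta> opt] in auto)
  show "action_minimizer \<beta> p \<omega> (stitched xm xp)" using st level by (simp add: action_minimizer_def)
  assume "action_minimizer \<beta> p \<omega> v"
  hence "v \<in> nehari_manifold \<beta> p \<omega>" "action \<beta> p \<omega> v = jump_cost \<beta> (\<phi> xm) (\<phi> xp)" using level by (auto simp: action_minimizer_def)
  from nehari_action_ge_stitched(2)[OF \<beta> opt this] obtain z where z: "norm z = 1"
    "(AE x in lborel. v x = z * stitched xm xp x) \<or> (AE x in lborel. v x = z * stitched xm xp (- x))" by blast
  obtain \<theta> :: real where "z = exp (\<i> * complex_of_real \<theta>)" using z(1) complex_norm_eq_1_exp[of z] by metis
  thus "\<exists>\<theta>::real. (AE x in lborel. v x = exp (\<i> * complex_of_real \<theta>) * stitched xm xp x) \<or>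
                (AE x in lborel. v x = exp (\<i> * complex_of_real \<theta>) * stitched xm xp (- x))" using z(2) by blast
qed

text \<open>
  With \<open>slope (\<phi> x) = sqrt \<omega> * t * \<phi> x\<close> for \<open>t = tanh (rate * x)\<close>, the equality of the slopes is the first equation, and
  \<open>\<phi> xm - \<phi> xp = \<beta> * slope\<close> divided by the common slope is the second one.
\<close>

lemma tanh_system:
  assumes \<beta>: "0 < \<beta>" and opt: "optimal_shifts \<beta> xm xp"
    and t: "tp = tanh (rate * xp)" "tm = tanh (rate * xm)"
  shows "tp * (1 - tp\<^sup>2) powr (1 / (p - 2)) = tm * (1 - tm\<^sup>2) powr (1 / (p - 2))"
    "inverse tp - inverse tm = - \<beta> * sqrt \<omega>"
proof -
  have x: "0 < xm" "xm < xp" and s: "slope (\<phi> xp) = slope (\<phi> xm)" "slope (\<phi> xp) = (\<phi> xm - \<phi> xp) / \<beta>"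
    using opt by (auto simp: optimal_shifts_def)
  have tpos: "0 < tp" "0 < tm" using x rate_pos by (auto simp: t)
  have sp: "slope (\<phi> xp) = sqrt \<omega> * tp * \<phi> xp" "slope (\<phi> xm) = sqrt \<omega> * tm * \<phi> xm"
    using slope_soliton[of xp] slope_soliton[of xm] tpos by (auto simp: t)
  have f: "\<phi> xp = peak * (1 - tp\<^sup>2) powr (1 / (p - 2))" "\<phi> xm = peak * (1 - tm\<^sup>2) powr (1 / (p - 2))"
    unfolding t by (rule soliton_tanh)+
  have "sqrt \<omega> * tp * \<phi> xp = sqrt \<omega> * tm * \<phi> xm" by (metis s(1) sp)
  hence "sqrt \<omega> * peak * (tp * (1 - tp\<^sup>2) powr (1 / (p - 2))) = sqrt \<omega> * peak * (tm * (1 - tm\<^sup>2) powr (1 / (p - 2)))"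
    unfolding f by (simp only: mult_ac)
  thus "tp * (1 - tp\<^sup>2) powr (1 / (p - 2)) = tm * (1 - tm\<^sup>2) powr (1 / (p - 2))"
    using \<omega> peak_pos by simp
  define \<sigma> where "\<sigma> = slope (\<phi> xp)"
  have \<sigma>: "\<sigma> > 0" unfolding \<sigma>_def sp using \<omega> tpos soliton_pos[of xp] by simp
  have "inverse tp = sqrt \<omega> * \<phi> xp / \<sigma>" "inverse tm = sqrt \<omega> * \<phi> xm / \<sigma>"
    using sp s(1) \<sigma> tpos \<omega> by (auto simp: \<sigma>_def field_simps)
  hence "inverse tp - inverse tm = - sqrt \<omega> * (\<phi> xm - \<phi> xp) / \<sigma>"
    by (simp add: diff_divide_distrib right_diff_distrib)
  moreover have "\<phi> xm - \<phi> xp = \<beta> * \<sigma>" using s(2) \<beta> by (simp add: \<sigma>_def)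
  ultimately show "inverse tp - inverse tm = - \<beta> * sqrt \<omega>" using \<sigma> by simp
qed

end

section \<open>Nonpositive frequencies\<close>

text \<open>
  For \<open>l\<^sup>2 = \<mu> - \<omega>\<close> the trial function \<open>s * exp (- l * \<bar>x\<bar>)\<close> has \<open>Qf + \<omega> * mass = s\<^sup>2 * \<mu> / l\<close>. On the Nehari manifold this is
  the \<open>p\<close>-th power of its norm, which is at most a constant times a positive power of \<open>\<mu>\<close> and tends to 0 with \<open>\<mu>\<close>. A minimizer would then vanish.
\<close>

lemma no_minimizer_of_nonpos_frequency:
  assumes p: "2 < p" and \<omega>: "\<omega> \<le> 0"
  shows "\<not> action_minimizer \<beta> p \<omega> u"
proof
  assume min: "action_minimizer \<beta> p \<omega> u"
  hence uN: "u \<in> nehari_manifold \<beta> p \<omega>" by (simp add: action_minimizer_def)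
  have c: "1 / 2 - 1 / p > 0" using p by (simp add: field_simps)
  have bdd: "bdd_below (action \<beta> p \<omega> ` nehari_manifold \<beta> p \<omega>)"
    by (rule bdd_belowI2[of _ 0]) (use action_on_nehari norm_Lp_pow_nonneg c in auto)
  have le: "norm_Lp_pow p u \<le> norm_Lp_pow p v" if v: "v \<in> nehari_manifold \<beta> p \<omega>" for v
  proof -
    have "action \<beta> p \<omega> u \<le> action \<beta> p \<omega> v"
      using min cINF_lower[OF bdd v] by (simp add: action_minimizer_def action_level_def)
    thus ?thesis using c unfolding action_on_nehari[OF uN] action_on_nehari[OF v] by simp
  qed
  have small: "norm_Lp_pow p u \<le> (p * \<mu> / 2) powr (2 / (p - 2)) * sqrt \<mu>" if \<mu>: "0 < \<mu>" for \<mu>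
  proof -
    (* The rate and the amplitude for which \<open>s * exp (- l * \<bar>x\<bar>)\<close> lies on the Nehari manifold. *)
    define l where "l = sqrt (\<mu> - \<omega>)"
    have l: "0 < l" "l\<^sup>2 = \<mu> - \<omega>" using \<mu> \<omega> by (auto simp: l_def)
    define s where "s = (p * \<mu> / 2) powr (1 / (p - 2))"
    have s: "0 < s" using \<mu> p by (simp add: s_def)
    define v where "v = (\<lambda>x::real. s * exp (- l * x))"
    define g where "g = (\<lambda>x::real. - l * (s * exp (- l * x)))"
    define w where "w = (\<lambda>x. complex_of_real (s * exp (- l * \<bar>x\<bar>)))"
    have rep: "H1_rep (\<lambda>x. complex_of_real (v x)) (\<lambda>x. complex_of_real (g x))"
    proof (rule exp_decay_H1_rep[where c = l and C = "max 1 l * s"])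
      fix x :: real
      show "(v has_real_derivative g x) (at x within {0..})" unfolding v_def g_def by (auto intro!: derivative_eq_intros)
      have "1 * (s * exp (- l * x)) \<le> max 1 l * (s * exp (- l * x))" "l * (s * exp (- l * x)) \<le> max 1 l * (s * exp (- l * x))"
        using s by (intro mult_right_mono; simp)+
      thus "\<bar>v x\<bar> \<le> max 1 l * s * exp (- l * x)" "\<bar>g x\<bar> \<le> max 1 l * s * exp (- l * x)"
        using s l by (auto simp: v_def g_def abs_mult mult.assoc)
    qed (use l in \<open>auto simp: g_def intro!: continuous_intros\<close>)
    have sr: "split_rep w (\<lambda>x. complex_of_real (v x)) (\<lambda>x. complex_of_real (g x)) (\<lambda>x. complex_of_real (v x)) (\<lambda>x. complex_of_real (g x))"
    proof -
      have "w \<in> borel_measurable borel" unfolding w_def by (intro borel_measurable_continuous_onI continuous_intros)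
      hence "set_borel_measurable lborel A w" if "A \<in> sets borel" for A
        unfolding set_borel_measurable_def using that by (intro borel_measurable_scaleR) auto
      thus ?thesis unfolding split_rep_def using rep by (auto simp: w_def v_def)
    qed
    have e2: "(HINT x. (exp (- l * x))\<^sup>2) = 1 / (2 * l)"
      using set_integrable_exp_decay(2)[of "2 * l"] l by (simp add: exp_double[symmetric] mult.assoc)
    have ep: "(HINT x. exp (- l * x) powr p) = 1 / (p * l)"
      using set_integrable_exp_decay(2)[of "p * l"] l p by (simp add: powr_def mult.assoc mult.left_commute)
    have Q: "Qf \<beta> w = s\<^sup>2 * l"
    proof -
      have "(HINT x. (norm (complex_of_real (g x)))\<^sup>2) = (HINT x. (l\<^sup>2 * s\<^sup>2) * (exp (- l * x))\<^sup>2)"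
        by (rule set_lebesgue_integral_cong) (auto simp: g_def power_mult_distrib norm_mult)
      also have "\<dots> = s\<^sup>2 * l / 2" unfolding set_integral_mult_right e2 using l(1) by (simp add: power2_eq_square)
      finally show ?thesis using split_rep_Qf[OF sr, of \<beta>] by simp
    qed
    have M: "norm_Lp_pow 2 w = s\<^sup>2 / l"
    proof -
      have "(HINT x. (norm (complex_of_real (v x)))\<^sup>2) = (HINT x. s\<^sup>2 * (exp (- l * x))\<^sup>2)"
        by (rule set_lebesgue_integral_cong) (auto simp: v_def power_mult_distrib norm_mult)
      also have "\<dots> = s\<^sup>2 / (2 * l)" unfolding set_integral_mult_right e2 by simp
      finally show ?thesis using split_rep_mass[OF sr] by simp
    qed
    have P: "norm_Lp_pow p w = 2 * s powr p / (p * l)"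
    proof -
      have "(HINT x. norm (complex_of_real (v x)) powr p) = (HINT x. s powr p * exp (- l * x) powr p)"
        by (rule set_lebesgue_integral_cong) (use s in \<open>auto simp: v_def powr_mult abs_mult norm_mult\<close>)
      also have "\<dots> = s powr p / (p * l)" unfolding set_integral_mult_right ep by simp
      finally show ?thesis using split_rep_norm_Lp_pow[OF sr, of p] p by simp
    qed
    have sp: "s powr p = s\<^sup>2 * (p * \<mu> / 2)"
    proof -
      have "s powr (p - 2) = p * \<mu> / 2" using p \<mu> by (simp add: s_def powr_powr)
      thus ?thesis using powr_add[of s 2 "p - 2"] s by (simp add: powr_numeral)
    qed
    have P': "norm_Lp_pow p w = s\<^sup>2 * \<mu> / l" unfolding P sp using p l by (simp add: field_simps)
    have "Qf \<beta> w + \<omega> * norm_Lp_pow 2 w = s\<^sup>2 * (l\<^sup>2 + \<omega>) / l"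
      unfolding Q M using l(1) by (simp add: field_simps power2_eq_square)
    hence "nehari_functional \<beta> p \<omega> w = 0" unfolding nehari_functional_def P' l(2) by simp
    moreover have "\<not> (AE x in lborel. w x = 0)" using s by (auto simp: w_def eventually_False ae_filter_eq_bot_iff)
    ultimately have "w \<in> nehari_manifold \<beta> p \<omega>" using split_rep_H1_split[OF sr] by (simp add: nehari_manifold_def)
    hence "norm_Lp_pow p u \<le> s\<^sup>2 * \<mu> / l" using le P' by metis
    also have "\<dots> \<le> s\<^sup>2 * \<mu> / sqrt \<mu>"
      using \<mu> \<omega> s unfolding l_def by (intro divide_left_mono) auto
    also have "\<dots> = s\<^sup>2 * sqrt \<mu>" using \<mu> by (simp add: real_div_sqrt flip: times_divide_eq_right)
    also have "s\<^sup>2 = (p * \<mu> / 2) powr (2 / (p - 2))"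
    proof -
      have "s\<^sup>2 = s powr 2" using s by (simp add: powr_numeral)
      also have "\<dots> = (p * \<mu> / 2) powr (1 / (p - 2) * 2)" unfolding s_def by (simp only: powr_powr)
      finally show ?thesis by simp
    qed
    finally show ?thesis .
  qed
  have "((\<lambda>\<mu>. (p * \<mu> / 2) powr (2 / (p - 2)) * sqrt \<mu>) \<longlongrightarrow> (p * 0 / 2) powr (2 / (p - 2)) * sqrt 0) (at_right 0)"
    using p by (intro tendsto_intros tendsto_powr') (auto simp: eventually_at_right_field intro!: exI[of _ 1])
  hence "norm_Lp_pow p u \<le> 0"
    using small by (intro tendsto_lowerbound[where F = "at_right 0"]) (auto simp: eventually_at_right_field intro!: exI[of _ 1])
  hence z: "norm_Lp_pow p u = 0" using norm_Lp_pow_nonneg[of p u] by linarith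
  have uH: "u \<in> H1_split" and une: "\<not> (AE x in lborel. u x = 0)" using uN by (auto simp: nehari_manifold_def)
  obtain vl gl vr gr where rep: "split_rep u vl gl vr gr" using H1_split_imp_split_rep[OF uH] by blast
  have H: "H1_rep vl gl" "H1_rep vr gr" using rep unfolding split_rep_def by blast+
  have nn: "0 \<le> (HINT x. norm (v x) powr p)" for v :: "real \<Rightarrow> complex"
    unfolding set_lebesgue_integral_def by (rule integral_nonneg_AE) auto
  have z2: "(HINT x. norm (vl x) powr p) = 0" "(HINT x. norm (vr x) powr p) = 0"
    using split_rep_norm_Lp_pow[OF rep, of p] z nn[of vl] nn[of vr] p by simp_all
  have "v x = 0" if v: "H1_rep v g" "(HINT x. norm (v x) powr p) = 0" "0 \<le> x" for v g x
  proof -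
    have "norm (v x) = 0"
    proof (rule continuous_eq_of_integral_le[where p = p and f = "\<lambda>x. norm (v x)" and g = "\<lambda>_. 0"])
      show "continuous_on {0..} (\<lambda>x. norm (v x))" using H1_rep_continuous[OF v(1)] by (intro continuous_intros)
      show "set_integrable lborel {0<..} (\<lambda>x. norm (v x) powr p)"
        using profile_powr_integrable[OF H1_rep_profile[OF v(1)]] p by simp
    qed (use v p in \<open>auto simp: set_integrable_def\<close>)
    thus ?thesis by simp
  qed
  hence "AE x in lborel. u x = 0" using split_rep_zero[OF rep] H z2 by metis
  thus False using une by simp
qed

section \<open>Existence and uniqueness of action minimizers\<close>

theorem theorem2p4:
  fixes \<beta> p \<omega> :: real
  assumes "\<beta> > 0" and "p > 2"
  shows "((\<exists>u. action_minimizer \<beta> p \<omega> u) \<longleftrightarrow> \<omega> > 0) \<and>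
    (\<omega> > 0 \<longrightarrow>
      (\<exists>u x\<^sub>p x\<^sub>m.
        action_minimizer \<beta> p \<omega> u \<and>
        (\<forall>v. action_minimizer \<beta> p \<omega> v \<longrightarrow>
           (\<exists>\<theta>::real. (AE x in lborel. v x = exp (\<i> * complex_of_real \<theta>) * u x) \<or>
                    (AE x in lborel. v x = exp (\<i> * complex_of_real \<theta>) * u (- x)))) \<and>
        (\<forall>x. x \<noteq> 0 \<longrightarrow> u x \<in> \<real> \<and> Re (u x) > 0) \<and>
        (\<forall>x>0. u x = complex_of_real (soliton p \<omega> (x + x\<^sub>p))) \<and>
        (\<forall>x<0. u x = complex_of_real (soliton p \<omega> (x + x\<^sub>m))) \<and>
        x\<^sub>p > x\<^sub>m \<and> x\<^sub>m > 0 \<and>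
        (let t\<^sub>p = tanh ((p - 2) / 2 * sqrt \<omega> * x\<^sub>p);
             t\<^sub>m = tanh ((p - 2) / 2 * sqrt \<omega> * x\<^sub>m)
         in t\<^sub>p * (1 - t\<^sub>p\<^sup>2) powr (1 / (p - 2)) = t\<^sub>m * (1 - t\<^sub>m\<^sup>2) powr (1 / (p - 2)) \<and>
            inverse t\<^sub>p - inverse t\<^sub>m = - \<beta> * sqrt \<omega>)))"
proof (cases "\<omega> > 0")
  case True
  interpret nls_params p \<omega> by unfold_locales (use assms True in auto)
  obtain xm xp where opt: "optimal_shifts \<beta> xm xp" using optimal_shifts_exist[OF assms(1)] .
  hence xs: "0 < xm" "xm < xp" by (auto simp: optimal_shifts_def)
  note min = stitched_unique_minimizer[OF assms(1) opt]
  note tanh = tanh_system[OF assms(1) opt refl refl, unfolded rate_def]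
  show ?thesis
    using True min xs tanh unfolding Let_def
    by (intro conjI iffI impI exI[of _ "stitched xm xp"] exI[of _ xp] exI[of _ xm])
       (auto simp: stitched_def soliton_pos)
next
  case False
  thus ?thesis using no_minimizer_of_nonpos_frequency[OF assms(2)] by auto
qed

end
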